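(* Let $n\ge 3$ and let $(E,\phi)$ be a cyclic $SL(n,\mathbb{C})$-Higgs bundle parameterized by $(\gamma_1,\dots,\gamma_n)$ over a closed Riemann surface $\Sigma$ of genus $\ge 2$. For $t\in\mathbb{C}^*$ let $g^t$ denote the pullback metric of the branched minimal immersion associated with $(E,t\phi)$. Then along the $\mathbb{C}^*$-orbit of $(E,\phi)$, outside the branch points, $g^t$ strictly increases as $|t|$ increases; that is, if $0<|t'|<|t|$, then $g^{t'}<g^{t}$ at every point $p\in\Sigma$ with $\phi(p)\ne 0$.
   Context: Let $K_\Sigma$ be the canonical bundle of $\Sigma$. A cyclic $SL(n,\mathbb{C})$-Higgs bundle parameterized by $(\gamma_1,\dots,\gamma_n)$ is a pair $(E,\phi)$ with $E=L_1\oplus\cdots\oplus L_n$ a direct sum of holomorphic line bundles, $\det E=\mathcal{O}$, and $\phi$ the holomorphic section of $\mathrm{End}(E)\otimes K_\Sigma$ whose only nonzero components are $\gamma_k:L_k\to L_{k+1}\otimes K_\Sigma$, $k=1,\dots,n$ (indices mod $n$, so $\gamma_n:L_n\to L_1\otimes K_\Sigma$). Here $\gamma_k$ is a holomorphic section of $L_k^{-1}L_{k+1}K_\Sigma$, and $\gamma_k\neq 0$ for $1\le k\le n-1$, while $\gamma_n$ is allowed to be zero. If $\gamma_n\ne0$ the Higgs bundle is automatically stable; if $\gamma_n=0$ it is taken to be stable, which means $\sum_{i=1}^k\deg(L_{n+1-i})<0$ for all $1\le k\le n-1$. The group $\mathbb{C}^*$ acts by $t\cdot(E,\phi)=(E,t\phi)$.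 The harmonic metric $h$ of $(E,\phi)$ is the unique Hermitian metric on $E$ inducing the trivial metric on $\det E=\mathcal{O}$ and solving the Hitchin equation $F^{\nabla^h}+[\phi,\phi^{*_h}]=0$, where $\nabla^h$ is the Chern connection and $\phi^{*_h}$ the $h$-adjoint. For a cyclic Higgs bundle it is diagonal, $h=\mathrm{diag}(h_1,\dots,h_n)$ with $h_k$ a Hermitian metric on $L_k$. The harmonic metric gives an equivariant harmonic map $f:\widetilde\Sigma\to SL(n,\mathbb{C})/SU(n)$ (the target having the Riemannian metric induced by the Killing form $B(X,Y)=2n\,\mathrm{tr}(XY)$), which for cyclic Higgs bundles with $n\ge3$ is a (possibly branched) minimal immersion. Its pullback metric is the Hermitian form on $\Sigma$ given by $g=2n\,\mathrm{tr}(\phi\phi^{*_h})\,dz\otimes d\bar z=2n\big(\sum_{k=1}^n|\gamma_k|^2h_k^{-1}h_{k+1}\big)dz\otimes d\bar z$ (indices mod $n$), and its branch points are the zeros of $\phi$ (where $g=0$). For $(E,t\phi)$ the metric $g^t$ is computed with $t\phi$ and the harmonic metric of $(E,t\phi)$.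
   Formalization: The formal theorem assumes in addition that γ_n is not identically zero; if γ_n = 0, then (E, tφ) is gauge equivalent to (E, φ) for every t, so g^t is constant along the orbit and the strict inequality fails. *)

theory Defs
  imports
    "HOL-Complex_Analysis.Complex_Analysis"
    "HOL-Homology.Homology"
    "Jordan_Normal_Form.Schur_Decomposition"
    "Jordan_Normal_Form.Gauss_Jordan_Elimination"
begin

section \<open>Closed Riemann surfaces\<close>

text \<open>
  A surface comes with an indexed holomorphic atlas: for \<open>i\<close> in \<open>charts S\<close>, the map \<open>coord S i\<close>
  is a complex coordinate on the open set \<open>chart_dom S i\<close>.
\<close>

record ('a, 'i) surface =
  space_of :: "'a topology"
  charts :: "'i set"
  chart_dom :: "'i \<Rightarrow> 'a set"
  coord :: "'i \<Rightarrow> 'a \<Rightarrow> complex"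

definition chart_inv :: "('a, 'i) surface \<Rightarrow> 'i \<Rightarrow> complex \<Rightarrow> 'a" where
  "chart_inv S i = inv_into (chart_dom S i) (coord S i)"

definition chart_image :: "('a, 'i) surface \<Rightarrow> 'i \<Rightarrow> complex set" where
  "chart_image S i = coord S i ` chart_dom S i"

definition closed_riemann_surface :: "('a, 'i) surface \<Rightarrow> bool" where
  "closed_riemann_surface S \<longleftrightarrow>
     Hausdorff_space (space_of S) \<and> connected_space (space_of S) \<and> compact_space (space_of S) \<and>
     topspace (space_of S) = (\<Union>i\<in>charts S. chart_dom S i) \<and>
     (\<forall>i\<in>charts S. openin (space_of S) (chart_dom S i) \<and> open (chart_image S i) \<and>
        homeomorphic_map (subtopology (space_of S) (chart_dom S i))
          (top_of_set (chart_image S i)) (coord S i)) \<and>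
     (\<forall>i\<in>charts S. \<forall>j\<in>charts S.
        (coord S j \<circ> chart_inv S i) holomorphic_on
          (coord S i ` (chart_dom S i \<inter> chart_dom S j)))"

definition has_genus :: "('a, 'i) surface \<Rightarrow> nat \<Rightarrow> bool" where
  "has_genus S g \<longleftrightarrow> homology_group 1 (space_of S) \<cong> free_Abelian_group {..<2 * g}"

section \<open>Holomorphic line bundles\<close>

text \<open>
  A holomorphic line bundle is given by its transition functions over the charts: a section is a
  family of local functions with \<open>s i = g i j * s j\<close> on overlaps.  Asking for a trivialisation over
  every chart is no restriction, because a holomorphic line bundle over an open subset of the
  complex plane is holomorphically trivial.
\<close>

type_synonym ('a, 'i) cocycle = "'i \<Rightarrow> 'i \<Rightarrow> 'a \<Rightarrow> complex"

definition line_bundle :: "('a, 'i) surface \<Rightarrow> ('a, 'i) cocycle \<Rightarrow> bool" where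
  "line_bundle S g \<longleftrightarrow>
     (\<forall>i\<in>charts S. \<forall>j\<in>charts S.
        (g i j \<circ> chart_inv S i) holomorphic_on (coord S i ` (chart_dom S i \<inter> chart_dom S j)) \<and>
        (\<forall>p\<in>chart_dom S i \<inter> chart_dom S j. g i j p \<noteq> 0)) \<and>
     (\<forall>i\<in>charts S. \<forall>j\<in>charts S. \<forall>k\<in>charts S.
        \<forall>p\<in>chart_dom S i \<inter> chart_dom S j \<inter> chart_dom S k. g i j p * g j k p = g i k p)"

definition bundle_dual :: "('a, 'i) cocycle \<Rightarrow> ('a, 'i) cocycle" where
  "bundle_dual g = (\<lambda>i j p. inverse (g i j p))"

definition bundle_tensor :: "('a, 'i) cocycle \<Rightarrow> ('a, 'i) cocycle \<Rightarrow> ('a, 'i) cocycle" where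
  "bundle_tensor g g' = (\<lambda>i j p. g i j p * g' i j p)"

text \<open>The local function of a section \<open>s\<close> is its coefficient with respect to \<open>dz\<^sub>i\<close>, so the
  transition function is \<open>dz\<^sub>j / dz\<^sub>i\<close>.\<close>

definition canonical_bundle :: "('a, 'i) surface \<Rightarrow> ('a, 'i) cocycle" where
  "canonical_bundle S = (\<lambda>i j p. deriv (coord S j \<circ> chart_inv S i) (coord S i p))"

text \<open>The determinant of the direct sum of \<open>L 0, \<dots>, L (n - 1)\<close>.\<close>

definition det_bundle :: "nat \<Rightarrow> (nat \<Rightarrow> ('a, 'i) cocycle) \<Rightarrow> ('a, 'i) cocycle" where
  "det_bundle n L = (\<lambda>i j p. \<Prod>k<n. L k i j p)"

definition is_section ::
    "('a, 'i) surface \<Rightarrow> ('a, 'i) cocycle \<Rightarrow> ('i \<Rightarrow> 'a \<Rightarrow> complex) \<Rightarrow> bool" where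
  "is_section S g s \<longleftrightarrow>
     (\<forall>i\<in>charts S. \<forall>j\<in>charts S. \<forall>p\<in>chart_dom S i \<inter> chart_dom S j. s i p = g i j p * s j p)"

definition holomorphic_section ::
    "('a, 'i) surface \<Rightarrow> ('a, 'i) cocycle \<Rightarrow> ('i \<Rightarrow> 'a \<Rightarrow> complex) \<Rightarrow> bool" where
  "holomorphic_section S g s \<longleftrightarrow> is_section S g s \<and>
     (\<forall>i\<in>charts S. (s i \<circ> chart_inv S i) holomorphic_on chart_image S i)"

definition zero_section :: "('a, 'i) surface \<Rightarrow> ('i \<Rightarrow> 'a \<Rightarrow> complex) \<Rightarrow> bool" where
  "zero_section S s \<longleftrightarrow> (\<forall>i\<in>charts S. \<forall>p\<in>chart_dom S i. s i p = 0)"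

text \<open>A meromorphic section that does not vanish identically near any point.\<close>

definition nonzero_meromorphic_section ::
    "('a, 'i) surface \<Rightarrow> ('a, 'i) cocycle \<Rightarrow> ('i \<Rightarrow> 'a \<Rightarrow> complex) \<Rightarrow> bool" where
  "nonzero_meromorphic_section S g s \<longleftrightarrow> is_section S g s \<and>
     (\<forall>i\<in>charts S. (s i \<circ> chart_inv S i) meromorphic_on chart_image S i \<and>
        (\<forall>w\<in>chart_image S i. \<forall>\<^sub>F x in at w. (s i \<circ> chart_inv S i) x \<noteq> 0))"

definition section_order ::
    "('a, 'i) surface \<Rightarrow> ('i \<Rightarrow> 'a \<Rightarrow> complex) \<Rightarrow> 'a \<Rightarrow> int" where
  "section_order S s p =
     (let i = (SOME i. i \<in> charts S \<and> p \<in> chart_dom S i)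
      in zorder (s i \<circ> chart_inv S i) (coord S i p))"

text \<open>The degree is the degree of the divisor of any nonzero meromorphic section; on a closed
  Riemann surface such sections exist and all give the same number.\<close>

definition bundle_degree :: "('a, 'i) surface \<Rightarrow> ('a, 'i) cocycle \<Rightarrow> int" where
  "bundle_degree S g =
     (THE d. \<exists>s. nonzero_meromorphic_section S g s \<and>
        d = (\<Sum>p | p \<in> topspace (space_of S) \<and> section_order S s p \<noteq> 0. section_order S s p))"

section \<open>Cyclic Higgs bundles\<close>

text \<open>
  Line bundles and the sections \<open>\<gamma>\<close> are indexed by \<open>0, \<dots>, n - 1\<close> instead of \<open>1, \<dots>, n\<close>; so
  \<open>\<gamma> k\<close> maps \<open>L k\<close> to \<open>L ((k + 1) mod n)\<close> twisted by the canonical bundle, and the section that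
  is allowed to vanish is \<open>\<gamma> (n - 1)\<close>.  The identification of \<open>det E\<close> with the trivial bundle
  is part of the data: \<open>\<delta>\<close> is the nowhere vanishing section of \<open>det E\<close> corresponding to \<open>1\<close>.
\<close>

definition det_trivialization ::
    "('a, 'i) surface \<Rightarrow> nat \<Rightarrow> (nat \<Rightarrow> ('a, 'i) cocycle) \<Rightarrow> ('i \<Rightarrow> 'a \<Rightarrow> complex) \<Rightarrow> bool" where
  "det_trivialization S n L \<delta> \<longleftrightarrow> holomorphic_section S (det_bundle n L) \<delta> \<and>
     (\<forall>i\<in>charts S. \<forall>p\<in>chart_dom S i. \<delta> i p \<noteq> 0)"

definition cyclic_higgs_bundle ::
    "('a, 'i) surface \<Rightarrow> nat \<Rightarrow> (nat \<Rightarrow> ('a, 'i) cocycle) \<Rightarrow> ('i \<Rightarrow> 'a \<Rightarrow> complex) \<Rightarrow>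
     (nat \<Rightarrow> 'i \<Rightarrow> 'a \<Rightarrow> complex) \<Rightarrow> bool" where
  "cyclic_higgs_bundle S n L \<delta> \<gamma> \<longleftrightarrow>
     (\<forall>k<n. line_bundle S (L k)) \<and>
     det_trivialization S n L \<delta> \<and>
     (\<forall>k<n. holomorphic_section S
        (bundle_tensor (bundle_tensor (bundle_dual (L k)) (L ((k + 1) mod n))) (canonical_bundle S))
        (\<gamma> k)) \<and>
     (\<forall>k<n - 1. \<not> zero_section S (\<gamma> k)) \<and>
     (zero_section S (\<gamma> (n - 1)) \<longrightarrow>
        (\<forall>k\<in>{1..n - 1}. (\<Sum>i=1..k. bundle_degree S (L (n - i))) < 0))"

text \<open>The matrix of \<open>\<phi>\<close> with respect to the chosen frames and \<open>dz\<^sub>i\<close>.\<close>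

definition cyclic_higgs_field ::
    "nat \<Rightarrow> (nat \<Rightarrow> 'i \<Rightarrow> 'a \<Rightarrow> complex) \<Rightarrow> 'i \<Rightarrow> 'a \<Rightarrow> complex mat" where
  "cyclic_higgs_field n \<gamma> i p =
     Matrix.mat n n (\<lambda>(l, k). if l = (k + 1) mod n then \<gamma> k i p else 0)"

definition scale_higgs_field ::
    "complex \<Rightarrow> ('i \<Rightarrow> 'a \<Rightarrow> complex mat) \<Rightarrow> 'i \<Rightarrow> 'a \<Rightarrow> complex mat" where
  "scale_higgs_field t \<Phi> i p = t \<cdot>\<^sub>m \<Phi> i p"

section \<open>Smooth functions and Wirtinger derivatives\<close>

definition partial_x :: "(complex \<Rightarrow> complex) \<Rightarrow> complex \<Rightarrow> complex" where
  "partial_x f w = frechet_derivative f (at w) 1"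

definition partial_y :: "(complex \<Rightarrow> complex) \<Rightarrow> complex \<Rightarrow> complex" where
  "partial_y f w = frechet_derivative f (at w) \<i>"

definition d_z :: "(complex \<Rightarrow> complex) \<Rightarrow> complex \<Rightarrow> complex" where
  "d_z f w = (partial_x f w - \<i> * partial_y f w) / 2"

definition d_zbar :: "(complex \<Rightarrow> complex) \<Rightarrow> complex \<Rightarrow> complex" where
  "d_zbar f w = (partial_x f w + \<i> * partial_y f w) / 2"

primrec Ck_on :: "nat \<Rightarrow> (complex \<Rightarrow> complex) \<Rightarrow> complex set \<Rightarrow> bool" where
  "Ck_on 0 f W \<longleftrightarrow> continuous_on W f"
| "Ck_on (Suc k) f W \<longleftrightarrow>
     f differentiable_on W \<and> Ck_on k (partial_x f) W \<and> Ck_on k (partial_y f) W"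

definition smooth_on :: "(complex \<Rightarrow> complex) \<Rightarrow> complex set \<Rightarrow> bool" where
  "smooth_on f W \<longleftrightarrow> (\<forall>k. Ck_on k f W)"

definition mat_d_z :: "nat \<Rightarrow> (complex \<Rightarrow> complex mat) \<Rightarrow> complex \<Rightarrow> complex mat" where
  "mat_d_z n F w = Matrix.mat n n (\<lambda>(k, l). d_z (\<lambda>x. F x $$ (k, l)) w)"

definition mat_d_zbar :: "nat \<Rightarrow> (complex \<Rightarrow> complex mat) \<Rightarrow> complex \<Rightarrow> complex mat" where
  "mat_d_zbar n F w = Matrix.mat n n (\<lambda>(k, l). d_zbar (\<lambda>x. F x $$ (k, l)) w)"

section \<open>Hermitian metrics and the Hitchin equation\<close>

definition mat_inv :: "complex mat \<Rightarrow> complex mat" where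
  "mat_inv A = the (mat_inverse A)"

definition mat_trace :: "complex mat \<Rightarrow> complex" where
  "mat_trace A = (\<Sum>k<dim_row A. A $$ (k, k))"

definition positive_definite :: "nat \<Rightarrow> complex mat \<Rightarrow> bool" where
  "positive_definite n A \<longleftrightarrow> A \<in> carrier_mat n n \<and> mat_adjoint A = A \<and>
     (\<forall>v\<in>carrier_vec n. v \<noteq> 0\<^sub>v n \<longrightarrow> 0 < Re ((A *\<^sub>v v) \<bullet>c v))"

text \<open>
  A Hermitian metric \<open>h\<close> on the direct sum of \<open>L 0, \<dots>, L (n - 1)\<close> (not assumed diagonal) is given
  by its Gram matrices: \<open>h(u, v) = v\<^sup>* H u\<close> for column vectors \<open>u\<close>, \<open>v\<close> in the frame over chart
  \<open>i\<close>.
\<close>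

definition hermitian_metric ::
    "('a, 'i) surface \<Rightarrow> nat \<Rightarrow> (nat \<Rightarrow> ('a, 'i) cocycle) \<Rightarrow> ('i \<Rightarrow> 'a \<Rightarrow> complex mat) \<Rightarrow> bool"
  where
  "hermitian_metric S n L H \<longleftrightarrow>
     (\<forall>i\<in>charts S. \<forall>p\<in>chart_dom S i. positive_definite n (H i p)) \<and>
     (\<forall>i\<in>charts S. \<forall>k<n. \<forall>l<n. smooth_on (\<lambda>w. H i (chart_inv S i w) $$ (k, l)) (chart_image S i)) \<and>
     (\<forall>i\<in>charts S. \<forall>j\<in>charts S. \<forall>p\<in>chart_dom S i \<inter> chart_dom S j.
        H j p = mat_adjoint (mat_diag n (\<lambda>k. L k i j p)) * H i p * mat_diag n (\<lambda>k. L k i j p))"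

text \<open>The section \<open>\<delta>\<close> has norm one in the metric induced on the determinant.\<close>

definition induces_trivial_det_metric ::
    "('a, 'i) surface \<Rightarrow> ('i \<Rightarrow> 'a \<Rightarrow> complex) \<Rightarrow> ('i \<Rightarrow> 'a \<Rightarrow> complex mat) \<Rightarrow> bool" where
  "induces_trivial_det_metric S \<delta> H \<longleftrightarrow>
     (\<forall>i\<in>charts S. \<forall>p\<in>chart_dom S i. cnj (\<delta> i p) * Determinant.det (H i p) * \<delta> i p = 1)"

text \<open>In a holomorphic frame the Chern connection is \<open>d + H\<^sup>-\<^sup>1 \<partial>H\<close> and its curvature is
  \<open>dbar (H\<^sup>-\<^sup>1 \<partial>H)\<close>.  The sign in \<open>chern_curvature\<close> appears because curvature is represented by its
  coefficient with respect to \<open>dz \<and> d(cnj z)\<close>.\<close>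

definition chern_connection_form :: "nat \<Rightarrow> (complex \<Rightarrow> complex mat) \<Rightarrow> complex \<Rightarrow> complex mat" where
  "chern_connection_form n H w = mat_inv (H w) * mat_d_z n H w"

definition chern_curvature :: "nat \<Rightarrow> (complex \<Rightarrow> complex mat) \<Rightarrow> complex \<Rightarrow> complex mat" where
  "chern_curvature n H w = - mat_d_zbar n (chern_connection_form n H) w"

definition higgs_adjoint :: "complex mat \<Rightarrow> complex mat \<Rightarrow> complex mat" where
  "higgs_adjoint H \<Phi> = mat_inv H * mat_adjoint \<Phi> * H"

text \<open>The bracket of the forms \<open>\<Phi> dz\<close> and \<open>\<Phi>\<^sup>* d(cnj z)\<close> is the commutator times
  \<open>dz \<and> d(cnj z)\<close>.\<close>

definition hitchin_equation ::
    "('a, 'i) surface \<Rightarrow> nat \<Rightarrow> ('i \<Rightarrow> 'a \<Rightarrow> complex mat) \<Rightarrow> ('i \<Rightarrow> 'a \<Rightarrow> complex mat) \<Rightarrow> bool" where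
  "hitchin_equation S n \<Phi> H \<longleftrightarrow>
     (\<forall>i\<in>charts S. \<forall>p\<in>chart_dom S i.
        chern_curvature n (\<lambda>w. H i (chart_inv S i w)) (coord S i p) +
        (\<Phi> i p * higgs_adjoint (H i p) (\<Phi> i p) - higgs_adjoint (H i p) (\<Phi> i p) * \<Phi> i p)
        = 0\<^sub>m n n)"

definition harmonic_metric ::
    "('a, 'i) surface \<Rightarrow> nat \<Rightarrow> (nat \<Rightarrow> ('a, 'i) cocycle) \<Rightarrow> ('i \<Rightarrow> 'a \<Rightarrow> complex) \<Rightarrow>
     ('i \<Rightarrow> 'a \<Rightarrow> complex mat) \<Rightarrow> ('i \<Rightarrow> 'a \<Rightarrow> complex mat) \<Rightarrow> bool" where
  "harmonic_metric S n L \<delta> \<Phi> H \<longleftrightarrow>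
     hermitian_metric S n L H \<and> induces_trivial_det_metric S \<delta> H \<and> hitchin_equation S n \<Phi> H"

text \<open>The coefficient of the pullback metric with respect to \<open>dz\<^sub>i \<otimes> d(cnj z\<^sub>i)\<close>; the trace is a
  nonnegative real number.\<close>

definition pullback_metric ::
    "nat \<Rightarrow> ('i \<Rightarrow> 'a \<Rightarrow> complex mat) \<Rightarrow> ('i \<Rightarrow> 'a \<Rightarrow> complex mat) \<Rightarrow> 'i \<Rightarrow> 'a \<Rightarrow> real" where
  "pullback_metric n \<Phi> H i p =
     2 * real n * Re (mat_trace (\<Phi> i p * higgs_adjoint (H i p) (\<Phi> i p)))"

end

theory Submission
  imports Defs
begin

text \<open>
  Let \<open>h\<^sub>k\<close> denote the weights of the harmonic metric of \<open>(E, t \<phi>)\<close> and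
  \<open>f\<^sub>k = |t \<gamma>\<^sub>k|\<^sup>2 h\<^sub>k\<^sup>-\<^sup>1 h\<^sub>k\<^sub>+\<^sub>1\<close>, so that the pullback metric is \<open>2 n\<close> times the sum of the
  \<open>f\<^sub>k\<close>.  Each summand increases with \<open>|t|\<close>, strictly where it does not vanish.  The reason is a maximum
  principle for the cyclic Toda system
  \<open>\<partial> dbar (log h\<^sub>k) = f\<^sub>k\<^sub>-\<^sub>1 - f\<^sub>k\<close>
  that the Hitchin equation becomes on the diagonal.  For two parameters \<open>t\<close>, \<open>t'\<close> with solutions \<open>f\<close>,
  \<open>f'\<close> the functions \<open>v\<^sub>k = log (f\<^sub>k / f'\<^sub>k)\<close> extend smoothly over the zeros of \<open>\<gamma>\<^sub>k\<close> to the whole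
  closed surface and satisfy
  \<open>\<partial> dbar v\<^sub>k = 2 F\<^sub>k - F\<^sub>k\<^sub>+\<^sub>1 - F\<^sub>k\<^sub>-\<^sub>1\<close> with \<open>F\<^sub>k = f'\<^sub>k (exp v\<^sub>k - 1)\<close>.
  Around the cycle the weights cancel, so the sum of the \<open>v\<^sub>k\<close> is the positive constant
  \<open>2 n log |t / t'|\<close>.  The system is cooperative and its columns sum to zero.  These two properties allow
  the strong maximum principle to be applied to minus the sum of those \<open>v\<^sub>k\<close> that are nonpositive at a
  suitable point; the result is that all \<open>v\<^sub>k\<close> are positive (\<open>cyclic_comparison\<close>).

  The harmonic metric is not given as a diagonal one.  Rotating the frame by the powers of a primitive
  \<open>n\<close>-th root of unity multiplies \<open>\<phi>\<close> by a phase, hence turns a solution \<open>H\<close> into another solution \<open>K\<close>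
  of the same equation.  The trace of \<open>H\<^sup>-\<^sup>1 K\<close> is subharmonic on the closed surface
  (\<open>trace_laplacian\<close>), thus constant, and then the two metrics have the same Chern connection and the same
  \<open>\<phi>\<^sup>*\<close> (\<open>hitchin_solutions_comparison\<close>).  Invariance under the rotation makes the connection diagonal and
  restricts \<open>\<phi>\<^sup>*\<close> to the transposed cycle.  This suffices for the diagonal entries of \<open>H\<close> to satisfy the
  Toda system and to compute the pullback metric (\<open>toda_equations\<close>).

  Both arguments rest on the strong maximum principle for twice differentiable functions with a zero-order term
  (\<open>strong_maximum_principle\<close>), which is proved with a Gaussian barrier.
\<close>

section \<open>Wirtinger derivatives and the Laplacian\<close>

text \<open>
  The two cases \<open>e = - \<i>\<close> and \<open>e = \<i>\<close> are the derivatives with respect to \<open>z\<close> and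
  \<open>cnj z\<close>; a free \<open>e\<close> lets every rule of calculus be proved once for both.
\<close>

definition wirtinger :: "complex \<Rightarrow> (complex \<Rightarrow> complex) \<Rightarrow> complex \<Rightarrow> complex" where
  "wirtinger e f w = (partial_x f w + e * partial_y f w) / 2"

lemma d_z_eq_wirtinger: "d_z = wirtinger (- \<i>)"
  by (simp add: fun_eq_iff d_z_def wirtinger_def)

lemma d_zbar_eq_wirtinger: "d_zbar = wirtinger \<i>"
  by (simp add: fun_eq_iff d_zbar_def wirtinger_def)

lemma wirtinger_has_derivative:
  assumes "(f has_derivative f') (at w)"
  shows "wirtinger e f w = (f' 1 + e * f' \<i>) / 2"
  using frechet_derivative_at[OF assms] by (simp add: wirtinger_def partial_x_def partial_y_def)

lemma wirtinger_cong:
  assumes "\<forall>\<^sub>F x in nhds w. f x = g x"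
  shows "wirtinger e f w = wirtinger e g w"
proof -
  have *: "(g has_derivative D) (at w)" if "(f has_derivative D) (at w)" "\<forall>\<^sub>F x in nhds w. f x = g x"
    for f g D
    using has_derivative_transform_eventually[OF that(1), of g] that(2)
      eventually_nhds_x_imp_x[OF that(2)] by (simp add: eventually_at_filter eventually_mono)
  have "(f has_derivative D) (at w) \<longleftrightarrow> (g has_derivative D) (at w)" for D
    using *[of f D g] *[of g D f] assms by (auto simp: eq_commute)
  then have "frechet_derivative f (at w) = frechet_derivative g (at w)"
    by (simp add: frechet_derivative_def)
  then show ?thesis
    by (simp add: wirtinger_def partial_x_def partial_y_def)
qed

lemma wirtinger_const [simp]: "wirtinger e (\<lambda>x. c) w = 0"
  by (subst wirtinger_has_derivative[OF has_derivative_const]) simp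

lemma wirtinger_add:
  assumes "f differentiable (at w)" "g differentiable (at w)"
  shows "wirtinger e (\<lambda>x. f x + g x) w = wirtinger e f w + wirtinger e g w"
proof -
  obtain f' g' where f: "(f has_derivative f') (at w)" and g: "(g has_derivative g') (at w)"
    using assms by (auto simp: differentiable_def)
  show ?thesis
    unfolding wirtinger_has_derivative[OF has_derivative_add[OF f g]] wirtinger_has_derivative[OF f]
      wirtinger_has_derivative[OF g]
    by (simp add: field_simps)
qed

lemma wirtinger_minus:
  assumes "f differentiable (at w)"
  shows "wirtinger e (\<lambda>x. - f x) w = - wirtinger e f w"
proof -
  obtain f' where f: "(f has_derivative f') (at w)"
    using assms by (auto simp: differentiable_def)
  show ?thesis
    unfolding wirtinger_has_derivative[OF has_derivative_minus[OF f]] wirtinger_has_derivative[OF f]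
    by (simp add: field_simps)
qed

lemma wirtinger_diff:
  assumes "f differentiable (at w)" "g differentiable (at w)"
  shows "wirtinger e (\<lambda>x. f x - g x) w = wirtinger e f w - wirtinger e g w"
  using wirtinger_add[OF assms(1) differentiable_minus[OF assms(2)]] wirtinger_minus[OF assms(2)] by simp

lemma wirtinger_mult:
  assumes "f differentiable (at w)" "g differentiable (at w)"
  shows "wirtinger e (\<lambda>x. f x * g x) w = wirtinger e f w * g w + f w * wirtinger e g w"
proof -
  obtain f' g' where f: "(f has_derivative f') (at w)" and g: "(g has_derivative g') (at w)"
    using assms by (auto simp: differentiable_def)
  show ?thesis
    unfolding wirtinger_has_derivative[OF has_derivative_mult[OF f g]] wirtinger_has_derivative[OF f]
      wirtinger_has_derivative[OF g]
    by (simp add: field_simps)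
qed

lemma wirtinger_sum:
  assumes "\<And>k. k \<in> I \<Longrightarrow> f k differentiable (at w)"
  shows "wirtinger e (\<lambda>x. \<Sum>k\<in>I. f k x) w = (\<Sum>k\<in>I. wirtinger e (f k) w)"
  using assms
proof (induction I rule: infinite_finite_induct)
  case (insert k I)
  have "(\<lambda>x. \<Sum>k\<in>I. f k x) differentiable (at w)"
    by (rule differentiable_sum) (use insert in auto)
  then show ?case
    using insert by (simp add: wirtinger_add)
qed auto

lemma differentiable_cnj:
  assumes "f differentiable (at w)"
  shows "(\<lambda>x. cnj (f x)) differentiable (at w)"
  using assms bounded_linear.has_derivative[OF bounded_linear_cnj]
  unfolding differentiable_def by blast

lemma wirtinger_cnj:
  assumes "f differentiable (at w)"
  shows "wirtinger e (\<lambda>x. cnj (f x)) w = cnj (wirtinger (cnj e) f w)"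
proof -
  obtain f' where f: "(f has_derivative f') (at w)"
    using assms by (auto simp: differentiable_def)
  show ?thesis
    unfolding wirtinger_has_derivative[OF bounded_linear.has_derivative[OF bounded_linear_cnj f]]
      wirtinger_has_derivative[OF f] by simp
qed

lemma has_derivative_of_real_Im:
  fixes f :: "complex \<Rightarrow> real"
  assumes f': "((\<lambda>x. complex_of_real (f x)) has_derivative f') (at w)"
  shows "Im (f' h) = 0"
proof -
  have "((\<lambda>x. 0) has_derivative (\<lambda>h. Im (f' h))) (at w)"
    using bounded_linear.has_derivative[OF bounded_linear_Im f'] by simp
  then have "(\<lambda>h. Im (f' h)) = (\<lambda>h. 0)"
    using has_derivative_const has_derivative_unique by blast
  then show ?thesis by metis
qed

text \<open>
  Real-valued functions are differentiated through their embedding in the complex numbers, so that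
  the same operators apply to them and to matrix entries.
\<close>

lemma wirtinger_of_real_ln:
  fixes f :: "complex \<Rightarrow> real"
  assumes "(\<lambda>x. complex_of_real (f x)) differentiable (at w)" "f w > 0"
  shows "(\<lambda>x. complex_of_real (ln (f x))) differentiable (at w)"
    and "wirtinger e (\<lambda>x. complex_of_real (ln (f x))) w = wirtinger e (\<lambda>x. complex_of_real (f x)) w / of_real (f w)"
proof -
  obtain f' where f': "((\<lambda>x. complex_of_real (f x)) has_derivative f') (at w)"
    using assms by (auto simp: differentiable_def)
  have f: "(f has_derivative (\<lambda>h. Re (f' h))) (at w)"
    using bounded_linear.has_derivative[OF bounded_linear_Re f'] by simp
  note im = has_derivative_of_real_Im[OF f']
  have ff: "complex_of_real (Re (f' h)) = f' h" for h
    by (simp add: complex_eq_iff im)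
  have "((\<lambda>x. complex_of_real (ln (f x))) has_derivative
      (\<lambda>h. complex_of_real (Re (f' h) * inverse (f w)))) (at w)"
    by (intro bounded_linear.has_derivative[OF bounded_linear_of_real] has_derivative_ln f assms)
  then have L: "((\<lambda>x. complex_of_real (ln (f x))) has_derivative
      (\<lambda>h. f' h / of_real (f w))) (at w)"
    by (simp add: ff divide_inverse)
  show "(\<lambda>x. complex_of_real (ln (f x))) differentiable (at w)"
    using L by (auto simp: differentiable_def)
  show "wirtinger e (\<lambda>x. complex_of_real (ln (f x))) w = wirtinger e (\<lambda>x. complex_of_real (f x)) w / of_real (f w)"
    unfolding wirtinger_has_derivative[OF L] wirtinger_has_derivative[OF f'] by (simp add: add_divide_distrib mult.commute)
qed

text \<open>
  If \<open>c > 0\<close>, then \<open>g'\<close>, which vanishes at the maximum, is positive immediately to the right of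
  it, and the mean value theorem makes \<open>g\<close> exceed its maximum.
\<close>

lemma second_derivative_local_max:
  fixes g g' :: "real \<Rightarrow> real"
  assumes d: "d > 0" and g: "\<And>s. \<bar>s\<bar> < d \<Longrightarrow> (g has_real_derivative g' s) (at s)"
    and g': "(g' has_real_derivative c) (at 0)"
    and max: "\<And>s. \<bar>s\<bar> < d \<Longrightarrow> g s \<le> g 0"
  shows "c \<le> 0"
proof (rule ccontr)
  assume "\<not> c \<le> 0"
  then have "c > 0" by simp
  have "g' 0 = 0"
    using DERIV_local_max[OF g[of 0] d] max d by auto
  with DERIV_pos_inc_right[OF g' \<open>c > 0\<close>]
  obtain e where e: "e > 0" "\<And>h. 0 < h \<Longrightarrow> h < e \<Longrightarrow> g' h > 0"
    by auto
  define b where "b = min d e / 2"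
  have b: "0 < b" "b < d" "b < e"
    using e d by (auto simp: b_def)
  have "\<exists>z. z > 0 \<and> z < b \<and> g b - g 0 = (b - 0) * g' z"
    by (rule MVT2) (use b g in auto)
  then obtain z where "0 < z" "z < b" "g b - g 0 = b * g' z" by auto
  moreover have "g b \<le> g 0" using max b by auto
  ultimately show False
    using e(2)[of z] b by (smt (verit) mult_pos_pos)
qed

lemma line_has_real_derivative:
  fixes F :: "complex \<Rightarrow> complex"
  assumes "F differentiable (at (w + of_real s * a))"
  shows "((\<lambda>s. Re (F (w + of_real s * a))) has_real_derivative
     Re (frechet_derivative F (at (w + of_real s * a)) a)) (at s)"
proof -
  let ?D = "frechet_derivative F (at (w + of_real s * a))"
  have F: "(F has_derivative ?D) (at (w + of_real s * a))"
    using assms frechet_derivative_works by blast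
  have l: "((\<lambda>s. w + complex_of_real s * a) has_derivative (\<lambda>h. of_real h * a)) (at s)"
    by (auto intro!: derivative_eq_intros)
  have "((\<lambda>s. Re (F (w + of_real s * a))) has_derivative (\<lambda>h. Re (?D (of_real h * a)))) (at s)"
    using bounded_linear.has_derivative[OF bounded_linear_Re has_derivative_compose[OF l F]] .
  moreover have "Re (?D (of_real h * a)) = Re (?D a) * h" for h
  proof -
    have "?D (h *\<^sub>R a) = h *\<^sub>R ?D a"
      using F has_derivative_linear linear_scale by blast
    then show ?thesis by (simp add: scaleR_conv_of_real)
  qed
  ultimately show ?thesis
    by (simp add: has_field_derivative_def mult_commute_abs)
qed

text \<open>
  For a real-valued function the single complex number \<open>d_z\<close> contains both partial derivatives.
  Hence differentiability of \<open>d_z\<close> is all the second-order regularity that is ever required.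
\<close>

lemma partials_of_real:
  fixes u :: "complex \<Rightarrow> real"
  assumes "(\<lambda>x. complex_of_real (u x)) differentiable (at w)"
  shows "frechet_derivative (\<lambda>x. complex_of_real (u x)) (at w) 1 = 2 * of_real (Re (d_z (\<lambda>x. complex_of_real (u x)) w))"
    and "frechet_derivative (\<lambda>x. complex_of_real (u x)) (at w) \<i> = - 2 * of_real (Im (d_z (\<lambda>x. complex_of_real (u x)) w))"
proof -
  obtain f' where f': "((\<lambda>x. complex_of_real (u x)) has_derivative f') (at w)"
    using assms by (auto simp: differentiable_def)
  note im = has_derivative_of_real_Im[OF f']
  have D: "frechet_derivative (\<lambda>x. complex_of_real (u x)) (at w) = f'"
    using frechet_derivative_at[OF f'] by simp
  show "frechet_derivative (\<lambda>x. complex_of_real (u x)) (at w) 1 = 2 * of_real (Re (d_z (\<lambda>x. complex_of_real (u x)) w))"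
    "frechet_derivative (\<lambda>x. complex_of_real (u x)) (at w) \<i> = - 2 * of_real (Im (d_z (\<lambda>x. complex_of_real (u x)) w))"
    unfolding D d_z_eq_wirtinger wirtinger_has_derivative[OF f'] by (simp_all add: complex_eq_iff im)
qed

definition twice_differentiable_on :: "(complex \<Rightarrow> real) \<Rightarrow> complex set \<Rightarrow> bool" where
  "twice_differentiable_on u W \<longleftrightarrow>
     (\<forall>w\<in>W. (\<lambda>x. complex_of_real (u x)) differentiable (at w) \<and>
             d_z (\<lambda>x. complex_of_real (u x)) differentiable (at w))"

text \<open>
  A quarter of the Euclidean Laplacian.  Taking the real part spares any appeal to the symmetry of
  the mixed second derivatives, which contribute only to the imaginary part.
\<close>

definition laplacian :: "(complex \<Rightarrow> real) \<Rightarrow> complex \<Rightarrow> real" where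
  "laplacian u w = Re (d_zbar (d_z (\<lambda>x. complex_of_real (u x))) w)"

text \<open>
  The second derivative test along the two coordinate lines through the maximum.
\<close>

lemma laplacian_local_max:
  fixes u :: "complex \<Rightarrow> real"
  assumes "open W" "w \<in> W" "twice_differentiable_on u W" "\<And>x. x \<in> W \<Longrightarrow> u x \<le> u w"
  shows "laplacian u w \<le> 0"
proof -
  define U where "U = (\<lambda>x. complex_of_real (u x))"
  have U: "U differentiable (at x)" "d_z U differentiable (at x)" if "x \<in> W" for x
    using that assms by (auto simp: U_def twice_differentiable_on_def)
  obtain d where d: "d > 0" "ball w d \<subseteq> W"
    using assms(1,2) openE by blast
  let ?D = "frechet_derivative (d_z U) (at w)"
  have "Re (b * ?D a) \<le> 0" if a: "cmod a = 1" and b: "b = 1 \<and> a = 1 \<or> b = \<i> \<and> a = \<i>" for a b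
  proof -
    define g where "g = (\<lambda>s. Re (U (w + of_real s * a)))"
    define g' where "g' = (\<lambda>s. Re (frechet_derivative U (at (w + of_real s * a)) a))"
    have inW: "w + of_real s * a \<in> W" if "\<bar>s\<bar> < d" for s
    proof -
      have "w + of_real s * a \<in> ball w d" using that a by (simp add: dist_norm norm_mult)
      then show ?thesis using d by auto
    qed
    have g: "(g has_real_derivative g' s) (at s)" if "\<bar>s\<bar> < d" for s
      unfolding g_def g'_def by (rule line_has_real_derivative) (use U inW that in auto)
    have g'_eq: "g' s = Re (2 * b * d_z U (w + of_real s * a))" if "\<bar>s\<bar> < d" for s
      using partials_of_real[of u "w + of_real s * a"] U(1)[OF inW[OF that]] b
      by (auto simp: g'_def U_def)
    have "((\<lambda>s. Re (2 * b * d_z U (w + of_real s * a))) has_real_derivative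
        Re (frechet_derivative (\<lambda>x. 2 * b * d_z U x) (at (w + of_real 0 * a)) a)) (at 0)"
      by (rule line_has_real_derivative) (use U(2)[OF assms(2)] in \<open>auto intro: differentiable_mult\<close>)
    moreover have "frechet_derivative (\<lambda>x. 2 * b * d_z U x) (at w) a = 2 * b * ?D a"
    proof -
      have "((\<lambda>x. 2 * b * d_z U x) has_derivative (\<lambda>h. 2 * b * ?D h)) (at w)"
        using U(2)[OF assms(2)] frechet_derivative_works by (intro has_derivative_mult_right) blast
      from frechet_derivative_at[OF this] show ?thesis by metis
    qed
    ultimately have "((\<lambda>s. Re (2 * b * d_z U (w + of_real s * a))) has_real_derivative Re (2 * b * ?D a)) (at 0)"
      by simp
    then have g'0: "(g' has_real_derivative Re (2 * b * ?D a)) (at 0)"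
    proof (rule has_field_derivative_transform_within_open[of _ _ _ "{-d<..<d}"])
    qed (use d g'_eq in auto)
    have "Re (2 * b * ?D a) \<le> 0"
      by (rule second_derivative_local_max[OF d(1) g g'0]) (use assms(4) inW in \<open>auto simp: g_def U_def\<close>)
    then show ?thesis by simp
  qed
  from this[of 1 1] this[of \<i> \<i>]
  have "Re (?D 1) \<le> 0" "Re (\<i> * ?D \<i>) \<le> 0" by simp_all
  then show ?thesis
    by (simp add: laplacian_def U_def[symmetric] d_zbar_def partial_x_def partial_y_def)
qed

section \<open>The strong maximum principle in the plane\<close>

lemma twice_differentiable_on_imp_continuous_on:
  assumes "twice_differentiable_on u W"
  shows "continuous_on W u"
proof -
  have "continuous_on W (\<lambda>x. complex_of_real (u x))"
    using assms by (intro continuous_at_imp_continuous_on ballI differentiable_imp_continuous_within)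
      (auto simp: twice_differentiable_on_def)
  from continuous_on_Re[OF this] show ?thesis by simp
qed

lemma twice_differentiable_on_subset:
  "twice_differentiable_on u W \<Longrightarrow> V \<subseteq> W \<Longrightarrow> twice_differentiable_on u V"
  by (auto simp: twice_differentiable_on_def)

lemma eventually_nhds_in:
  assumes "open W" "w \<in> W" "\<And>x. x \<in> W \<Longrightarrow> P x"
  shows "\<forall>\<^sub>F x in nhds w. P x"
  using assms by (auto simp: eventually_nhds)

lemma differentiable_at_cong:
  assumes "open W" "w \<in> W" "\<And>x. x \<in> W \<Longrightarrow> f x = g x" "f differentiable (at w)"
  shows "g differentiable (at w)"
  using assms has_derivative_transform_within_open unfolding differentiable_def by blast

lemma twice_differentiable_on_sum:
  assumes "open W" "\<And>k. k \<in> I \<Longrightarrow> twice_differentiable_on (u k) W"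
  shows "twice_differentiable_on (\<lambda>x. \<Sum>k\<in>I. c k * u k x) W"
    and "w \<in> W \<Longrightarrow> laplacian (\<lambda>x. \<Sum>k\<in>I. c k * u k x) w = (\<Sum>k\<in>I. c k * laplacian (u k) w)"
proof -
  define U where "U = (\<lambda>k x. complex_of_real (u k x))"
  have U: "U k differentiable (at x)" "d_z (U k) differentiable (at x)" if "k \<in> I" "x \<in> W" for k x
    using assms(2) that by (auto simp: twice_differentiable_on_def U_def)
  have eq: "(\<lambda>x. complex_of_real (\<Sum>k\<in>I. c k * u k x)) = (\<lambda>x. \<Sum>k\<in>I. of_real (c k) * U k x)"
    by (simp add: U_def)
  have D: "(\<lambda>x. of_real (c k) * U k x) differentiable (at x)"
    and D': "(\<lambda>x. of_real (c k) * d_z (U k) x) differentiable (at x)" if "k \<in> I" "x \<in> W" for k x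
    using U[OF that] by (auto intro: differentiable_mult)
  have *: "d_z (\<lambda>x. \<Sum>k\<in>I. of_real (c k) * U k x) x = (\<Sum>k\<in>I. of_real (c k) * d_z (U k) x)"
    if "x \<in> W" for x
    using D U(1) that by (simp add: d_z_eq_wirtinger wirtinger_sum wirtinger_mult)
  have diff: "(\<lambda>x. \<Sum>k\<in>I. of_real (c k) * d_z (U k) x) differentiable (at x)" if "x \<in> W" for x
    using D' that by (cases "finite I") (auto intro: differentiable_sum)
  show "twice_differentiable_on (\<lambda>x. \<Sum>k\<in>I. c k * u k x) W"
    unfolding twice_differentiable_on_def eq
  proof (intro ballI conjI)
    fix x assume x: "x \<in> W"
    show "(\<lambda>x. \<Sum>k\<in>I. of_real (c k) * U k x) differentiable (at x)"
      using D x by (cases "finite I") (auto intro: differentiable_sum)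
    show "d_z (\<lambda>x. \<Sum>k\<in>I. of_real (c k) * U k x) differentiable (at x)"
      by (rule differentiable_at_cong[OF assms(1) x _ diff[OF x]]) (use * in auto)
  qed
  assume w: "w \<in> W"
  have "d_zbar (d_z (\<lambda>x. \<Sum>k\<in>I. of_real (c k) * U k x)) w
      = d_zbar (\<lambda>x. \<Sum>k\<in>I. of_real (c k) * d_z (U k) x) w"
    unfolding d_zbar_eq_wirtinger by (rule wirtinger_cong, rule eventually_nhds_in[OF assms(1) w]) (rule *)
  also have "\<dots> = (\<Sum>k\<in>I. of_real (c k) * d_zbar (d_z (U k)) w)"
    using D' U(2) w by (simp add: d_zbar_eq_wirtinger wirtinger_sum wirtinger_mult)
  finally show "laplacian (\<lambda>x. \<Sum>k\<in>I. c k * u k x) w = (\<Sum>k\<in>I. c k * laplacian (u k) w)"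
    unfolding laplacian_def eq by (simp add: U_def)
qed

lemma twice_differentiable_on_combination:
  assumes "open W" "twice_differentiable_on u W" "twice_differentiable_on v W"
  shows "twice_differentiable_on (\<lambda>x. a * u x + b * v x) W"
    and "w \<in> W \<Longrightarrow> laplacian (\<lambda>x. a * u x + b * v x) w = a * laplacian u w + b * laplacian v w"
proof -
  let ?c = "\<lambda>k::nat. if k = 0 then a else b" and ?f = "\<lambda>k::nat. if k = 0 then u else v"
  have eq: "(\<lambda>x. a * u x + b * v x) = (\<lambda>x. \<Sum>k<2::nat. ?c k * ?f k x)"
    by (simp add: numeral_2_eq_2)
  have tw: "twice_differentiable_on (?f k) W" for k using assms by simp
  show "twice_differentiable_on (\<lambda>x. a * u x + b * v x) W"
    unfolding eq by (rule twice_differentiable_on_sum(1)[OF assms(1) tw])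
  assume "w \<in> W"
  then have "laplacian (\<lambda>x. \<Sum>k<2::nat. ?c k * ?f k x) w = (\<Sum>k<2::nat. ?c k * laplacian (?f k) w)"
    by (rule twice_differentiable_on_sum(2)[OF assms(1) tw])
  then show "laplacian (\<lambda>x. a * u x + b * v x) w = a * laplacian u w + b * laplacian v w"
    unfolding eq by (simp add: numeral_2_eq_2)
qed

lemma twice_differentiable_on_const: "twice_differentiable_on (\<lambda>x. a) W"
  and laplacian_const: "laplacian (\<lambda>x. a) w = 0"
proof -
  have "d_z (\<lambda>x. complex_of_real a) = (\<lambda>x. 0)" by (simp add: fun_eq_iff d_z_eq_wirtinger)
  then show "twice_differentiable_on (\<lambda>x. a) W" "laplacian (\<lambda>x. a) w = 0"
    by (simp_all add: twice_differentiable_on_def laplacian_def d_zbar_eq_wirtinger)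
qed

lemma wirtinger_exp:
  assumes "f differentiable (at w)"
  shows "(\<lambda>x. exp (f x)) differentiable (at w)" "wirtinger e (\<lambda>x. exp (f x)) w = exp (f w) * wirtinger e f w"
proof -
  obtain f' where f: "(f has_derivative f') (at w)"
    using assms by (auto simp: differentiable_def)
  have ex: "((\<lambda>x. exp (f x)) has_derivative (\<lambda>h. exp (f w) * f' h)) (at w)"
    using has_derivative_compose[OF f, of exp "(*) (exp (f w))"] DERIV_exp[of "f w"]
    by (simp only: has_field_derivative_def)
  show "(\<lambda>x. exp (f x)) differentiable (at w)"
    using ex by (auto simp: differentiable_def)
  show "wirtinger e (\<lambda>x. exp (f x)) w = exp (f w) * wirtinger e f w"
    unfolding wirtinger_has_derivative[OF ex] wirtinger_has_derivative[OF f] by (simp add: field_simps)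
qed

text \<open>
  At a fixed distance from its centre, a sufficiently steep Gaussian has a Laplacian larger than any
  prescribed multiple of its value.  This is what makes it a barrier below.
\<close>

lemma laplacian_gaussian:
  fixes a :: real and q :: complex
  defines "E \<equiv> (\<lambda>x. exp (- a * (cmod (x - q))\<^sup>2))"
  shows "twice_differentiable_on E UNIV" "laplacian E x = (a\<^sup>2 * (cmod (x - q))\<^sup>2 - a) * E x"
proof -
  define f where "f = (\<lambda>x. - of_real a * ((x - q) * cnj (x - q)))"
  have E: "(\<lambda>x. complex_of_real (E x)) = (\<lambda>x. exp (f x))"
    unfolding E_def f_def complex_norm_square[symmetric] by (simp flip: exp_of_real)
  have id: "(\<lambda>x. x - q) differentiable (at x)" for x by (auto intro!: differentiable_diff)
  have cid: "(\<lambda>x. cnj (x - q)) differentiable (at x)" for x using differentiable_cnj[OF id] .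
  have "((\<lambda>x. x - q) has_derivative (\<lambda>h. h)) (at x)" for x
    by (auto intro!: derivative_eq_intros)
  from wirtinger_has_derivative[OF this] have wid: "wirtinger e (\<lambda>x. x - q) x = (1 + e * \<i>) / 2" for e x by simp
  have wcid: "wirtinger e (\<lambda>x. cnj (x - q)) x = cnj ((1 + cnj e * \<i>) / 2)" for e x
    using wirtinger_cnj[OF id, of e x] wid by simp
  have fd: "f differentiable (at x)" for x
    unfolding f_def by (intro differentiable_mult differentiable_const id cid)
  have prod: "(\<lambda>x. (x - q) * cnj (x - q)) differentiable (at x)" for x
    by (intro differentiable_mult id cid)
  have "wirtinger e f x = - of_real a * (wirtinger e (\<lambda>x. x - q) x * cnj (x - q) + (x - q) * wirtinger e (\<lambda>x. cnj (x - q)) x)" for e x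
    unfolding f_def wirtinger_mult[OF differentiable_const prod] wirtinger_mult[OF id cid] by simp
  note wf = this
  have fz: "d_z f x = - of_real a * cnj (x - q)" "d_zbar f x = - of_real a * (x - q)" for x
    unfolding d_z_eq_wirtinger d_zbar_eq_wirtinger wf wid wcid by simp_all
  have dE: "d_z (\<lambda>x. exp (f x)) = (\<lambda>x. exp (f x) * (- of_real a * cnj (x - q)))"
    using wirtinger_exp(2)[OF fd] fz by (auto simp: d_z_eq_wirtinger)
  have m: "(\<lambda>x. - of_real a * cnj (x - q)) differentiable (at x)" for x
    by (intro differentiable_mult differentiable_const cid)
  show "twice_differentiable_on E UNIV"
    unfolding twice_differentiable_on_def E dE
    by (intro ballI conjI wirtinger_exp(1) fd differentiable_mult m)
  have "wirtinger e (\<lambda>x. - of_real a * cnj (x - q)) x = - of_real a * wirtinger e (\<lambda>x. cnj (x - q)) x" for e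
    by (subst wirtinger_mult[OF differentiable_const cid]) simp
  then have "d_zbar (\<lambda>x. - of_real a * cnj (x - q)) x = - of_real a"
    unfolding d_zbar_eq_wirtinger wcid by simp
  then have "d_zbar (d_z (\<lambda>x. exp (f x))) x
     = exp (f x) * (- of_real a * (x - q)) * (- of_real a * cnj (x - q)) + exp (f x) * (- of_real a)"
    unfolding dE using fz(2) unfolding d_zbar_eq_wirtinger
    by (subst wirtinger_mult[OF wirtinger_exp(1)[OF fd] m]) (simp add: wirtinger_exp(2)[OF fd])
  also have "\<dots> = exp (f x) * (of_real (a\<^sup>2) * ((x - q) * cnj (x - q)) - of_real a)"
    by (simp add: algebra_simps power2_eq_square)
  also have "\<dots> = complex_of_real (E x * (a\<^sup>2 * (cmod (x - q))\<^sup>2 - a))"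
    unfolding fun_cong[OF E, symmetric] complex_norm_square[symmetric] by simp
  finally show "laplacian E x = (a\<^sup>2 * (cmod (x - q))\<^sup>2 - a) * E x"
    unfolding laplacian_def E by (simp add: mult.commute)
qed

text \<open>
  A value below the maximum \<open>M\<close> at the centre of a disc forces values below \<open>M\<close> in the whole disc.
  On a small inner disc \<open>u\<close> stays below \<open>M - \<delta>\<close>.  On the remaining annulus \<open>\<delta>\<close> times a steep Gaussian
  is added to \<open>u\<close>: the sum is at most \<open>M\<close> on the inner circle and at most \<open>M\<close> plus \<open>\<delta>\<close> times the
  boundary value of the Gaussian on the outer one.  A point inside where \<open>u = M\<close> would produce an interior maximum
  above these values, where the Laplacian of the sum would be both nonpositive and positive.
\<close>

lemma below_max_spreads:
  fixes u :: "complex \<Rightarrow> real"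
  assumes W: "open W" "cball q R \<subseteq> W" and u: "twice_differentiable_on u W"
    and le: "\<And>w. w \<in> W \<Longrightarrow> u w \<le> M"
    and lap: "\<And>w. w \<in> cball q R \<Longrightarrow> laplacian u w \<ge> C * (u w - M)" and C: "C \<ge> 0"
    and R: "R > 0" and q: "u q < M" and x0: "x0 \<in> ball q R"
  shows "u x0 < M"
proof (rule ccontr)
  assume "\<not> u x0 < M"
  then have ux0: "u x0 = M" using le[of x0] x0 W(2) by force
  have cont: "continuous_on W u" by (rule twice_differentiable_on_imp_continuous_on[OF u])
  define \<delta> where "\<delta> = (M - u q) / 2"
  have \<delta>: "\<delta> > 0" using q by (simp add: \<delta>_def)
  have "q \<in> W" using W R by auto
  then obtain d where d: "d > 0" "\<And>x. x \<in> W \<Longrightarrow> dist x q < d \<Longrightarrow> dist (u x) (u q) < \<delta>"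
    using cont \<delta> unfolding continuous_on_iff by blast
  define r where "r = min d R / 2"
  have r: "0 < r" "r < d" "r < R" using d R by (auto simp: r_def)
  have inner: "u x \<le> M - \<delta>" if "dist q x \<le> r" for x
  proof -
    have "dist (u x) (u q) < \<delta>"
      using d(2)[of x] that r subsetD[OF W(2), of x] by (simp add: dist_commute)
    then have "u x - u q < (M - u q) / 2" unfolding dist_real_def \<delta>_def by (rule abs_less_iff[THEN iffD1, THEN conjunct1])
    then show ?thesis unfolding \<delta>_def by (simp add: field_simps)
  qed
  (* steep enough for the Gaussian to beat the zero-order term outside the inner disc, see aC *)
  define a where "a = (2 + C) / r\<^sup>2 + 1"
  have a: "a \<ge> 1" "a * r\<^sup>2 \<ge> 2 + C" using C r by (auto simp: a_def field_simps)
  have aC: "a\<^sup>2 * \<rho>\<^sup>2 - a > C" if "\<rho> \<ge> r" for \<rho>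
  proof -
    have "a * \<rho>\<^sup>2 \<ge> a * r\<^sup>2" using that r a by (intro mult_left_mono power_mono) auto
    then have "a * \<rho>\<^sup>2 - 1 \<ge> 1 + C" using a by linarith
    then have "1 * (a * \<rho>\<^sup>2 - 1) \<le> a * (a * \<rho>\<^sup>2 - 1)" using a C by (intro mult_right_mono) auto
    then show ?thesis using \<open>a * \<rho>\<^sup>2 - 1 \<ge> 1 + C\<close> by (simp add: power2_eq_square algebra_simps)
  qed
  define E where "E = (\<lambda>x. exp (- a * (cmod (x - q))\<^sup>2))"
  define v where "v = (\<lambda>x. 1 * u x + \<delta> * E x)"
  have v: "v x = u x + \<delta> * E x" for x
    by (simp add: v_def)
  have Etw: "twice_differentiable_on E W"
    unfolding E_def using laplacian_gaussian(1) by (rule twice_differentiable_on_subset) simp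
  have vtw: "twice_differentiable_on v W"
    unfolding v_def by (rule twice_differentiable_on_combination(1)[OF W(1) u Etw])
  have vlap: "laplacian v x = laplacian u x + \<delta> * laplacian E x" if "x \<in> W" for x
    unfolding v_def using twice_differentiable_on_combination(2)[OF W(1) u Etw that, of 1 \<delta>] by simp
  define A where "A = cball q R - ball q r"
  have A: "compact A" "A \<subseteq> W" using W(2) by (auto simp: A_def compact_diff)
  have x0A: "x0 \<in> A" using inner[of x0] ux0 \<delta> x0 unfolding A_def by auto
  obtain x1 where x1: "x1 \<in> A" "\<And>x. x \<in> A \<Longrightarrow> v x \<le> v x1"
    using continuous_attains_sup[OF A(1), of v] x0A
      continuous_on_subset[OF twice_differentiable_on_imp_continuous_on[OF vtw] A(2)] by blast
  define eR where "eR = exp (- a * R\<^sup>2)"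
  have Emono: "E x > eR" if "dist q x < R" for x
    unfolding E_def eR_def using that a R
    by (simp add: dist_norm norm_minus_commute power_strict_mono)
  (* the value at the maximum exceeds both boundary values *)
  have big: "v x1 > M + \<delta> * eR"
    using x1(2)[OF x0A] Emono[of x0] x0 \<delta> ux0 by (simp add: v) (smt (verit) mult_strict_left_mono)
  have E1: "E x \<le> 1" for x using a by (simp add: E_def)
  have ne1: "dist q x1 \<noteq> r"
  proof
    assume "dist q x1 = r"
    then have "u x1 \<le> M - \<delta>" using inner by simp
    then have "v x1 \<le> M" using E1[of x1] \<delta> by (simp add: v) (smt (verit) mult_left_le)
    moreover have "eR > 0" by (simp add: eR_def)
    ultimately show False using big \<delta> by (smt (verit) mult_pos_pos)
  qed
  have ne2: "dist q x1 \<noteq> R"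
  proof
    assume "dist q x1 = R"
    then have "E x1 = eR" by (simp add: E_def eR_def dist_norm norm_minus_commute)
    then show False using big le[of x1] x1(1) A(2) by (auto simp: v)
  qed
  have x1A: "r < dist q x1" "dist q x1 < R" "x1 \<in> W"
    using x1(1) ne1 ne2 A(2) by (auto simp: A_def)
  have "laplacian v x1 \<le> 0"
  proof (rule laplacian_local_max[where W = "ball q R - cball q r"])
    show "open (ball q R - cball q r)" by (rule open_Diff) auto
    show "x1 \<in> ball q R - cball q r" using x1A by auto
    show "twice_differentiable_on v (ball q R - cball q r)"
      by (rule twice_differentiable_on_subset[OF vtw]) (use W(2) in auto)
    show "v x \<le> v x1" if "x \<in> ball q R - cball q r" for x
      using x1(2)[of x] that by (auto simp: A_def)
  qed
  moreover have "laplacian u x1 \<ge> - C * \<delta> * E x1"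
  proof -
    have "u x1 - M \<ge> - \<delta> * E x1" using big \<delta> by (simp add: v eR_def) (smt (verit) exp_gt_zero mult_pos_pos)
    then have "C * (u x1 - M) \<ge> C * (- \<delta> * E x1)" using C by (rule mult_left_mono)
    then show ?thesis using lap[of x1] x1(1) by (auto simp: A_def)
  qed
  moreover have "\<delta> * laplacian E x1 > \<delta> * (C * E x1)"
  proof -
    have "laplacian E x1 > C * E x1"
      unfolding E_def laplacian_gaussian(2)
      using aC[of "cmod (x1 - q)"] x1A by (intro mult_strict_right_mono) (auto simp: dist_norm norm_minus_commute)
    then show ?thesis using \<delta> by simp
  qed
  ultimately show False using vlap[OF x1A(3)] by (simp add: algebra_simps)
qed

text \<open>
  The zero-order term \<open>c (u - M)\<close> is harmless: a constant bounding \<open>c\<close> on a compact disc can replace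
  \<open>c\<close>, because \<open>u - M\<close> is nonpositive.  A point near \<open>p\<close> with a value below \<open>M\<close> would be the centre
  of a disc containing \<open>p\<close>, in which all values are below \<open>M\<close>.
\<close>

lemma strong_maximum_principle_local:
  fixes u :: "complex \<Rightarrow> real"
  assumes W: "open W" "p \<in> W" and u: "twice_differentiable_on u W"
    and le: "\<And>w. w \<in> W \<Longrightarrow> u w \<le> M"
    and lap: "\<And>w. w \<in> W \<Longrightarrow> laplacian u w \<ge> c w * (u w - M)" and c: "continuous_on W c"
    and p: "u p = M"
  shows "\<exists>r>0. ball p r \<subseteq> W \<and> (\<forall>x\<in>ball p r. u x = M)"
proof -
  obtain d where d: "d > 0" "cball p d \<subseteq> W"
    using W open_contains_cball by metis
  (* half the radius, so that discs of radius R centred near p stay in the given disc and contain p *)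
  define R where "R = d / 2"
  have R: "R > 0" using d by (simp add: R_def)
  obtain B where B: "\<And>x. x \<in> cball p d \<Longrightarrow> c x \<le> B"
  proof -
    have "bdd_above (c ` cball p d)"
      by (intro bounded_imp_bdd_above compact_imp_bounded compact_continuous_image
          continuous_on_subset[OF c d(2)] compact_cball)
    then show ?thesis using that unfolding bdd_above_def by fast
  qed
  have "u x = M" if x: "x \<in> ball p R" for x
  proof (rule ccontr)
    assume "u x \<noteq> M"
    have sub: "cball x R \<subseteq> cball p d"
      using x by (intro cball_subset_cball_iff[THEN iffD2]) (auto simp: R_def dist_commute)
    moreover have "x \<in> cball x R" using R by simp
    ultimately have "x \<in> W" using d(2) by blast
    then have "u x < M" using le \<open>u x \<noteq> M\<close> by force
    have "u p < M"
    proof (rule below_max_spreads[where W = W and q = x and R = R and C = "\<bar>B\<bar>"])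
      fix w assume w: "w \<in> cball x R"
      then have "w \<in> W" "c w \<le> \<bar>B\<bar>" using sub d B[of w] by auto
      then have "\<bar>B\<bar> * (u w - M) \<le> c w * (u w - M)" using le[of w] by (intro mult_right_mono_neg) auto
      then show "laplacian u w \<ge> \<bar>B\<bar> * (u w - M)" using lap[OF \<open>w \<in> W\<close>] by linarith
    qed (use W sub d u le R \<open>u x < M\<close> x in \<open>auto simp: dist_commute\<close>)
    then show False using p by simp
  qed
  moreover have "ball p R \<subseteq> W" using d R by (auto simp: R_def)
  ultimately show ?thesis using R by blast
qed

section \<open>The strong maximum principle on a closed surface\<close>

context
  fixes S :: "('a, 'i) surface"
  assumes S: "closed_riemann_surface S"
begin

lemma chart_inj: "i \<in> charts S \<Longrightarrow> inj_on (coord S i) (chart_dom S i)"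
  and chart_dom_open: "i \<in> charts S \<Longrightarrow> openin (space_of S) (chart_dom S i)"
  and chart_image_open: "i \<in> charts S \<Longrightarrow> open (chart_image S i)"
  and chart_homeomorphic: "i \<in> charts S \<Longrightarrow>
    homeomorphic_map (subtopology (space_of S) (chart_dom S i)) (top_of_set (chart_image S i)) (coord S i)"
  and topspace_charts: "topspace (space_of S) = (\<Union>i\<in>charts S. chart_dom S i)"
proof -
  show *: "i \<in> charts S \<Longrightarrow> openin (space_of S) (chart_dom S i)"
    and "i \<in> charts S \<Longrightarrow> open (chart_image S i)"
    and **: "i \<in> charts S \<Longrightarrow>
      homeomorphic_map (subtopology (space_of S) (chart_dom S i)) (top_of_set (chart_image S i)) (coord S i)"
    and "topspace (space_of S) = (\<Union>i\<in>charts S. chart_dom S i)"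
    using S by (auto simp: closed_riemann_surface_def)
  assume i: "i \<in> charts S"
  have "topspace (subtopology (space_of S) (chart_dom S i)) = chart_dom S i"
    using openin_subset[OF *[OF i]] by auto
  with homeomorphic_imp_injective_map[OF **[OF i]]
  show "inj_on (coord S i) (chart_dom S i)" by simp
qed

lemma chart_inv_coord:
  "i \<in> charts S \<Longrightarrow> p \<in> chart_dom S i \<Longrightarrow> chart_inv S i (coord S i p) = p"
  unfolding chart_inv_def using chart_inj by simp

end

lemma chart_inv_in: "w \<in> chart_image S i \<Longrightarrow> chart_inv S i w \<in> chart_dom S i"
  unfolding chart_inv_def chart_image_def by (rule inv_into_into)

lemma coord_chart_inv: "w \<in> chart_image S i \<Longrightarrow> coord S i (chart_inv S i w) = w"
  unfolding chart_inv_def chart_image_def by (rule f_inv_into_f)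

lemma coord_in: "p \<in> chart_dom S i \<Longrightarrow> coord S i p \<in> chart_image S i"
  by (simp add: chart_image_def)

text \<open>
  Functions on the surface are kept as families of local functions, one for each chart, in the same
  way as sections of bundles; this is the condition that such a family is a single function.
\<close>

definition agree_on_overlaps :: "('a, 'i) surface \<Rightarrow> ('i \<Rightarrow> 'a \<Rightarrow> 'b) \<Rightarrow> bool" where
  "agree_on_overlaps S u \<longleftrightarrow>
     (\<forall>i\<in>charts S. \<forall>j\<in>charts S. \<forall>p\<in>chart_dom S i \<inter> chart_dom S j. u i p = u j p)"

lemma agree_on_overlapsD:
  assumes "agree_on_overlaps S u" "i \<in> charts S" "j \<in> charts S" "p \<in> chart_dom S i" "p \<in> chart_dom S j"
  shows "u i p = u j p"
  using assms(1)[unfolded agree_on_overlaps_def, rule_format, OF assms(2,3)] assms(4,5) by blast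

lemma glue_continuous:
  fixes u :: "'i \<Rightarrow> 'a \<Rightarrow> real"
  assumes S: "closed_riemann_surface S" and u: "agree_on_overlaps S u"
    and cont: "\<And>i. i \<in> charts S \<Longrightarrow> continuous_on (chart_image S i) (u i \<circ> chart_inv S i)"
  obtains g where "continuous_map (space_of S) euclideanreal g"
    "\<And>i p. i \<in> charts S \<Longrightarrow> p \<in> chart_dom S i \<Longrightarrow> g p = u i p"
proof -
  have c: "continuous_map (subtopology (space_of S) (chart_dom S i)) euclideanreal (u i)"
    if i: "i \<in> charts S" for i
  proof -
    have "continuous_map (subtopology (space_of S) (chart_dom S i)) euclideanreal
        ((u i \<circ> chart_inv S i) \<circ> coord S i)"
      by (rule continuous_map_compose[OF homeomorphic_imp_continuous_map[OF chart_homeomorphic[OF S i]]])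
        (use cont[OF i] in \<open>simp add: o_def\<close>)
    then show ?thesis
      by (rule continuous_map_eq) (simp add: chart_inv_coord[OF S i])
  qed
  define g where "g = (\<lambda>p. u (SOME i. i \<in> charts S \<and> p \<in> chart_dom S i) p)"
  have gu: "g p = u i p" if "i \<in> charts S" "p \<in> chart_dom S i" for i p
  proof -
    define j where "j = (SOME i. i \<in> charts S \<and> p \<in> chart_dom S i)"
    have j: "j \<in> charts S \<and> p \<in> chart_dom S j"
      unfolding j_def by (rule someI[of _ i]) (use that in simp)
    have "u j p = u i p" by (rule agree_on_overlapsD[OF u]) (use j that in auto)
    then show ?thesis unfolding g_def j_def .
  qed
  have "continuous_map (space_of S) euclideanreal g"
  proof (rule pasting_lemma[where I = "charts S" and T = "chart_dom S" and f = u])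
    show "u i x = u j x"
      if "i \<in> charts S" "j \<in> charts S" "x \<in> topspace (space_of S) \<inter> chart_dom S i \<inter> chart_dom S j" for i j x
      by (rule agree_on_overlapsD[OF u]) (use that in auto)
    show "\<exists>j. j \<in> charts S \<and> x \<in> chart_dom S j \<and> g x = u j x" if "x \<in> topspace (space_of S)" for x
      using that topspace_charts[OF S] gu by auto
    show "openin (space_of S) (chart_dom S i)" if "i \<in> charts S" for i
      by (rule chart_dom_open[OF S that])
    show "continuous_map (subtopology (space_of S) (chart_dom S i)) euclideanreal (u i)"
      if "i \<in> charts S" for i
      by (rule c[OF that])
  qed
  then show ?thesis using that gu by blast
qed

lemma maximum_attained:
  fixes u :: "'i \<Rightarrow> 'a \<Rightarrow> real"
  assumes S: "closed_riemann_surface S" and u: "agree_on_overlaps S u"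
    and cont: "\<And>i. i \<in> charts S \<Longrightarrow> continuous_on (chart_image S i) (u i \<circ> chart_inv S i)"
    and ne: "i0 \<in> charts S" "p0 \<in> chart_dom S i0"
  obtains i p where "i \<in> charts S" "p \<in> chart_dom S i"
    "\<And>j q. j \<in> charts S \<Longrightarrow> q \<in> chart_dom S j \<Longrightarrow> u j q \<le> u i p"
proof -
  obtain g where g: "continuous_map (space_of S) euclideanreal g"
    and gu: "\<And>i p. i \<in> charts S \<Longrightarrow> p \<in> chart_dom S i \<Longrightarrow> g p = u i p"
    using glue_continuous[OF S u cont] by blast
  have "compact_space (space_of S)"
    using S by (simp add: closed_riemann_surface_def)
  then have "compactin (space_of S) (topspace (space_of S))"
    by (simp only: compact_space_def)
  from image_compactin[OF this g] have "compact (g ` topspace (space_of S))"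
    by simp
  moreover have "g ` topspace (space_of S) \<noteq> {}"
    using ne topspace_charts[OF S] by auto
  ultimately obtain m where m: "m \<in> g ` topspace (space_of S)" "\<forall>t\<in>g ` topspace (space_of S). t \<le> m"
    using compact_attains_sup by blast
  then obtain p where p: "p \<in> topspace (space_of S)" "\<And>q. q \<in> topspace (space_of S) \<Longrightarrow> g q \<le> g p"
    by blast
  then obtain i where i: "i \<in> charts S" "p \<in> chart_dom S i"
    using topspace_charts[OF S] by auto
  show ?thesis
  proof (rule that[OF i])
    fix j q assume j: "j \<in> charts S" "q \<in> chart_dom S j"
    then have "q \<in> topspace (space_of S)" using topspace_charts[OF S] by auto
    then show "u j q \<le> u i p" using p(2) gu i j by force
  qed
qed

text \<open>
  The set where the maximum is attained is closed by continuity and open by the local principle, and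
  the surface is connected.
\<close>

lemma strong_maximum_principle:
  fixes u :: "'i \<Rightarrow> 'a \<Rightarrow> real"
  assumes S: "closed_riemann_surface S" and u: "agree_on_overlaps S u"
    and tw: "\<And>i. i \<in> charts S \<Longrightarrow> twice_differentiable_on (u i \<circ> chart_inv S i) (chart_image S i)"
    and c: "\<And>i. i \<in> charts S \<Longrightarrow> continuous_on (chart_image S i) (c i)"
    and lap: "\<And>i w. i \<in> charts S \<Longrightarrow> w \<in> chart_image S i \<Longrightarrow>
       laplacian (u i \<circ> chart_inv S i) w \<ge> c i w * (u i (chart_inv S i w) - M)"
    and le: "\<And>i p. i \<in> charts S \<Longrightarrow> p \<in> chart_dom S i \<Longrightarrow> u i p \<le> M"
    and max: "i0 \<in> charts S" "p0 \<in> chart_dom S i0" "u i0 p0 = M"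
    and i: "i \<in> charts S" "p \<in> chart_dom S i"
  shows "u i p = M"
proof -
  obtain g where g: "continuous_map (space_of S) euclideanreal g"
    and gu: "\<And>i p. i \<in> charts S \<Longrightarrow> p \<in> chart_dom S i \<Longrightarrow> g p = u i p"
    using glue_continuous[OF S u twice_differentiable_on_imp_continuous_on[OF tw]] by blast
  define T where "T = {p \<in> topspace (space_of S). g p \<in> {M}}"
  have "closedin (space_of S) T"
    unfolding T_def by (rule closedin_continuous_map_preimage[OF g]) simp
  moreover have "openin (space_of S) T"
  proof (subst openin_subopen, intro ballI)
    fix p assume p: "p \<in> T"
    then obtain i where i: "i \<in> charts S" "p \<in> chart_dom S i"
      using topspace_charts[OF S] by (auto simp: T_def)
    let ?v = "u i \<circ> chart_inv S i" and ?W = "chart_image S i" and ?w = "coord S i p"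
    have "\<exists>r>0. ball ?w r \<subseteq> ?W \<and> (\<forall>x\<in>ball ?w r. ?v x = M)"
    proof (rule strong_maximum_principle_local[where c = "c i"])
      show "?v ?w = M" using p i gu[OF i] by (simp add: T_def chart_inv_coord[OF S i])
      show "?w \<in> ?W" using i by (rule_tac coord_in)
      show "?v w \<le> M" if "w \<in> ?W" for w
        using le[OF i(1) chart_inv_in[OF that]] by simp
      show "c i w * (?v w - M) \<le> laplacian ?v w" if "w \<in> ?W" for w
        using lap[OF i(1) that] by simp
    qed (rule tw[OF i(1)] c[OF i(1)] chart_image_open[OF S i(1)])+
    then obtain r where r: "r > 0" "ball ?w r \<subseteq> ?W" "\<And>x. x \<in> ball ?w r \<Longrightarrow> ?v x = M" by blast
    define V where "V = {q \<in> chart_dom S i. coord S i q \<in> ball ?w r}"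
    have dom: "chart_dom S i \<subseteq> topspace (space_of S)"
      using openin_subset[OF chart_dom_open[OF S i(1)]] .
    have "coord S i ` V = ball ?w r"
      using r(2) unfolding V_def chart_image_def by blast
    then have "openin (top_of_set ?W) (coord S i ` V)"
      using r(2) by (simp add: open_subset)
    then have "openin (subtopology (space_of S) (chart_dom S i)) V"
      using homeomorphic_map_openness_eq[OF chart_homeomorphic[OF S i(1)], of V] dom
      by (auto simp: V_def)
    then have "openin (space_of S) V"
      using chart_dom_open[OF S i(1)] openin_trans_full by blast
    moreover have "p \<in> V" using i r by (simp add: V_def)
    moreover have "V \<subseteq> T"
    proof
      fix q assume q: "q \<in> V"
      then have "?v (coord S i q) = M" using r(3) by (simp add: V_def)
      then show "q \<in> T"
        using q dom gu[OF i(1)] chart_inv_coord[OF S i(1)] by (auto simp: V_def T_def)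
    qed
    ultimately show "\<exists>V. openin (space_of S) V \<and> p \<in> V \<and> V \<subseteq> T" by blast
  qed
  moreover have "p0 \<in> T" using max gu[OF max(1,2)] topspace_charts[OF S] by (auto simp: T_def)
  moreover have "connected_space (space_of S)"
    using S by (simp add: closed_riemann_surface_def)
  ultimately have "T = topspace (space_of S)"
    unfolding connected_space_clopen_in by blast
  then have "p \<in> T" using i topspace_charts[OF S] by auto
  then show ?thesis using gu[OF i] by (simp add: T_def)
qed

section \<open>Positive definite matrices\<close>

lemma mat_adjoint_dim [simp]:
  "dim_row (mat_adjoint A) = dim_col A" "dim_col (mat_adjoint A) = dim_row A"
  by (simp_all add: mat_adjoint_def)

lemma mat_adjoint_index:
  "i < dim_col A \<Longrightarrow> j < dim_row A \<Longrightarrow> mat_adjoint A $$ (i, j) = cnj (A $$ (j, i))"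
  by (simp add: mat_adjoint_def mat_of_rows_index)

lemma mat_adjoint_carrier [simp]:
  "A \<in> carrier_mat n m \<Longrightarrow> mat_adjoint A \<in> carrier_mat m n"
  by auto

lemma square_mult_carrier [simp]:
  "A \<in> carrier_mat n n \<Longrightarrow> B \<in> carrier_mat n n \<Longrightarrow> A * B \<in> carrier_mat n n"
  by simp

lemma mat_cancel_left:
  fixes A B X :: "complex mat"
  assumes "A * B = 1\<^sub>m n" "A \<in> carrier_mat n n" "B \<in> carrier_mat n n" "X \<in> carrier_mat n n"
  shows "A * (B * X) = X"
  using assoc_mult_mat[OF assms(2-4)] assms by simp

lemma mat_mult_index:
  assumes "A \<in> carrier_mat n m" "B \<in> carrier_mat m k" "i < n" "j < k"
  shows "(A * B) $$ (i, j) = (\<Sum>l<m. A $$ (i, l) * B $$ (l, j))"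
  using assms by (auto simp: scalar_prod_def lessThan_atLeast0)

lemma mat_adjoint_mult:
  fixes A B :: "complex mat"
  assumes "A \<in> carrier_mat n n" "B \<in> carrier_mat n n"
  shows "mat_adjoint (A * B) = mat_adjoint B * mat_adjoint A"
proof (rule eq_matI)
  note [simp] = mat_mult_index[of _ n n _ n] mat_adjoint_index
  fix i j assume "i < dim_row (mat_adjoint B * mat_adjoint A)" "j < dim_col (mat_adjoint B * mat_adjoint A)"
  then have ij: "i < n" "j < n" using assms mat_adjoint_carrier[OF assms(1)] mat_adjoint_carrier[OF assms(2)] by auto
  have "mat_adjoint (A * B) $$ (i, j) = cnj (\<Sum>l<n. A $$ (j, l) * B $$ (l, i))"
    using assms ij mat_mult_index[OF assms ij(2,1)] by (subst mat_adjoint_index) auto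
  also have "\<dots> = (\<Sum>l<n. mat_adjoint B $$ (i, l) * mat_adjoint A $$ (l, j))"
    using assms ij by (simp add: mat_adjoint_index mult.commute)
  also have "\<dots> = (mat_adjoint B * mat_adjoint A) $$ (i, j)"
    by (rule mat_mult_index[symmetric, of _ n n _ n]) (use assms ij in auto)
  finally show "mat_adjoint (A * B) $$ (i, j) = (mat_adjoint B * mat_adjoint A) $$ (i, j)" .
qed (use assms mat_adjoint_carrier[OF assms(1)] mat_adjoint_carrier[OF assms(2)] mat_adjoint_carrier[of "A * B" n n] in auto)

lemma mat_adjoint_adjoint [simp]:
  "mat_adjoint (mat_adjoint (A :: complex mat)) = A"
  by (rule eq_matI) (auto simp: mat_adjoint_index mat_adjoint_def mat_of_rows_index)

lemma mat_adjoint_minus: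
  fixes A B :: "complex mat"
  assumes "A \<in> carrier_mat n n" "B \<in> carrier_mat n n"
  shows "mat_adjoint (A - B) = mat_adjoint A - mat_adjoint B"
  using assms mat_adjoint_carrier[OF assms(1)] mat_adjoint_carrier[OF assms(2)] mat_adjoint_carrier[of "A - B" n n]
  by (intro eq_matI) (auto simp: mat_adjoint_index)

lemma mat_trace_mult_commute:
  assumes "A \<in> carrier_mat n n" "B \<in> carrier_mat n n"
  shows "mat_trace (A * B) = mat_trace (B * A)"
proof -
  have "mat_trace (A * B) = (\<Sum>k<n. \<Sum>l<n. A $$ (k, l) * B $$ (l, k))"
    using assms by (simp add: mat_trace_def mat_mult_index[OF assms] del: index_mult_mat(1))
  also have "\<dots> = (\<Sum>l<n. \<Sum>k<n. B $$ (l, k) * A $$ (k, l))"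
    by (subst sum.swap) (simp add: mult.commute)
  also have "\<dots> = mat_trace (B * A)"
    using assms by (simp add: mat_trace_def mat_mult_index[OF assms(2,1)] del: index_mult_mat(1))
  finally show ?thesis .
qed

lemma mat_trace_add:
  "A \<in> carrier_mat n n \<Longrightarrow> B \<in> carrier_mat n n \<Longrightarrow> mat_trace (A + B) = mat_trace A + mat_trace B"
  by (auto simp: mat_trace_def sum.distrib)

lemma mat_trace_minus:
  "A \<in> carrier_mat n n \<Longrightarrow> B \<in> carrier_mat n n \<Longrightarrow> mat_trace (A - B) = mat_trace A - mat_trace B"
  by (auto simp: mat_trace_def sum_subtractf)

lemma mat_trace_adjoint:
  "A \<in> carrier_mat n n \<Longrightarrow> mat_trace (mat_adjoint A) = cnj (mat_trace A)"
  using mat_adjoint_carrier[of A n n] by (auto simp: mat_trace_def mat_adjoint_index intro!: sum.cong)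

lemma quadratic_form:
  assumes "A \<in> carrier_mat n n" "v \<in> carrier_vec n"
  shows "(A *\<^sub>v v) \<bullet>c v = (\<Sum>i<n. \<Sum>j<n. cnj (v $ i) * A $$ (i, j) * v $ j)"
proof -
  have "(A *\<^sub>v v) \<bullet>c v = (\<Sum>i<n. (\<Sum>j<n. A $$ (i, j) * v $ j) * cnj (v $ i))"
    using assms by (auto simp: scalar_prod_def lessThan_atLeast0 intro!: sum.cong)
  then show ?thesis by (simp add: sum_distrib_left mult_ac)
qed

lemma positive_definite_carrier: "positive_definite n A \<Longrightarrow> A \<in> carrier_mat n n"
  and positive_definite_adjoint: "positive_definite n A \<Longrightarrow> mat_adjoint A = A"
  by (auto simp: positive_definite_def)

lemma positive_definite_det:
  assumes "positive_definite n A"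
  shows "Determinant.det A \<noteq> 0"
proof
  assume "Determinant.det A = 0"
  then obtain v where v: "v \<in> carrier_vec n" "v \<noteq> 0\<^sub>v n" "A *\<^sub>v v = 0\<^sub>v n"
    using det_0_iff_vec_prod_zero[OF positive_definite_carrier[OF assms]] by blast
  then have "0 < Re (0\<^sub>v n \<bullet>c v)" using assms unfolding positive_definite_def by metis
  then show False using v(1) by (simp add: scalar_prod_def)
qed

lemma positive_definite_inverse:
  assumes "positive_definite n A"
  shows "mat_inv A \<in> carrier_mat n n" "A * mat_inv A = 1\<^sub>m n" "mat_inv A * A = 1\<^sub>m n"
proof -
  note A = positive_definite_carrier[OF assms]
  have "A \<in> Units (ring_mat TYPE(complex) n ())"
    using det_non_zero_imp_unit[OF A positive_definite_det[OF assms]] .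
  then obtain B where "mat_inverse A = Some B"
    using mat_inverse(1)[OF A, where b = "()"] by (cases "mat_inverse A") auto
  with mat_inverse(2)[OF A] have "A * mat_inv A = 1\<^sub>m n \<and> mat_inv A * A = 1\<^sub>m n \<and> mat_inv A \<in> carrier_mat n n"
    by (simp add: mat_inv_def)
  then show "mat_inv A \<in> carrier_mat n n" "A * mat_inv A = 1\<^sub>m n" "mat_inv A * A = 1\<^sub>m n" by auto
qed

lemma inverse_unique:
  fixes A B C :: "complex mat"
  assumes "A \<in> carrier_mat n n" "B \<in> carrier_mat n n" "C \<in> carrier_mat n n" "B * A = 1\<^sub>m n" "A * C = 1\<^sub>m n"
  shows "B = C"
proof -
  have "B = B * (A * C)" unfolding assms(5) using assms(2) by simp
  also have "\<dots> = (B * A) * C" by (rule assoc_mult_mat[OF assms(2,1,3), symmetric])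
  finally show ?thesis unfolding assms(4) using assms(3) by simp
qed

text \<open>
  The left inverse \<open>B\<close> expresses that \<open>C\<close> is injective, so that the form of \<open>A\<close> is evaluated at a
  nonzero vector.
\<close>

lemma positive_definite_congruence:
  assumes A: "positive_definite n A" and C: "C \<in> carrier_mat n n"
    and B: "B \<in> carrier_mat n n" "B * C = 1\<^sub>m n"
  shows "positive_definite n (mat_adjoint C * A * C)"
  unfolding positive_definite_def
proof (intro conjI ballI impI)
  note A' = positive_definite_carrier[OF A] and C' = mat_adjoint_carrier[OF C]
  show "mat_adjoint C * A * C \<in> carrier_mat n n" using A' C C' by simp
  show "mat_adjoint (mat_adjoint C * A * C) = mat_adjoint C * A * C"
    using A' C C' positive_definite_adjoint[OF A]
    by (simp add: mat_adjoint_mult[of _ n] assoc_mult_mat[of _ n n _ n _ n])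
  fix v :: "complex Matrix.vec" assume v: "v \<in> carrier_vec n" "v \<noteq> 0\<^sub>v n"
  define x where "x = C *\<^sub>v v"
  have x: "x \<in> carrier_vec n" using C v by (simp add: x_def)
  have "x \<noteq> 0\<^sub>v n"
  proof
    assume "x = 0\<^sub>v n"
    moreover have "B *\<^sub>v 0\<^sub>v n = 0\<^sub>v n" by (rule eq_vecI) (use B in auto)
    ultimately have "B *\<^sub>v (C *\<^sub>v v) = 0\<^sub>v n" by (simp add: x_def)
    then have "(B * C) *\<^sub>v v = 0\<^sub>v n" using B(1) C v by (simp add: assoc_mult_mat_vec[of _ n n _ n])
    then show False using v B by simp
  qed
  then have "0 < Re ((A *\<^sub>v x) \<bullet>c x)"
    using A x unfolding positive_definite_def by blast
  also have "(A *\<^sub>v x) \<bullet>c x = ((mat_adjoint C * A * C) *\<^sub>v v) \<bullet>c v"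
  proof -
    have xi: "x $ i = (\<Sum>k<n. C $$ (i, k) * v $ k)" if "i < n" for i
      using C v that by (simp add: x_def scalar_prod_def lessThan_atLeast0)
    have "((mat_adjoint C * A * C) *\<^sub>v v) \<bullet>c v
      = (\<Sum>k<n. \<Sum>l<n. cnj (v $ k) * (\<Sum>j<n. (\<Sum>i<n. cnj (C $$ (i, k)) * A $$ (i, j)) * C $$ (j, l)) * v $ l)"
    proof -
      have "(mat_adjoint C * A * C) $$ (k, l) = (\<Sum>j<n. (\<Sum>i<n. cnj (C $$ (i, k)) * A $$ (i, j)) * C $$ (j, l))"
        if "k < n" "l < n" for k l
        using that A' C C' mat_mult_index[OF mult_carrier_mat[OF C' A'] C that]
        by (simp add: mat_mult_index[OF C' A'] mat_adjoint_index del: index_mult_mat(1))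
      then show ?thesis
        by (subst quadratic_form[of _ n])
          (use A' C C' v in \<open>auto simp del: index_mult_mat(1) assoc_mult_mat\<close>)
    qed
    also have "\<dots> = (\<Sum>k<n. \<Sum>l<n. \<Sum>j<n. \<Sum>i<n. cnj (v $ k) * cnj (C $$ (i, k)) * A $$ (i, j) * C $$ (j, l) * v $ l)"
      by (simp add: sum_distrib_left sum_distrib_right mult_ac)
    also have "\<dots> = (\<Sum>k<n. \<Sum>i<n. \<Sum>l<n. \<Sum>j<n. cnj (v $ k) * cnj (C $$ (i, k)) * A $$ (i, j) * C $$ (j, l) * v $ l)"
      by (subst (2) sum.swap[of _ "{..<n}" "{..<n}"], subst (3) sum.swap) (rule refl)
    also have "\<dots> = (\<Sum>i<n. \<Sum>k<n. \<Sum>j<n. \<Sum>l<n. cnj (v $ k) * cnj (C $$ (i, k)) * A $$ (i, j) * C $$ (j, l) * v $ l)"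
      by (subst sum.swap, subst (3) sum.swap) (rule refl)
    also have "\<dots> = (\<Sum>i<n. \<Sum>j<n. cnj (x $ i) * A $$ (i, j) * x $ j)"
      by (subst (2) sum.swap) (simp add: xi sum_distrib_left sum_distrib_right mult_ac)
    also have "\<dots> = (A *\<^sub>v x) \<bullet>c x"
      by (rule quadratic_form[OF A' x, symmetric])
    finally show ?thesis by simp
  qed
  finally show "0 < Re (((mat_adjoint C * A * C) *\<^sub>v v) \<bullet>c v)" .
qed

lemma positive_definite_mat_inv:
  assumes "positive_definite n A"
  shows "positive_definite n (mat_inv A)"
proof -
  note A = positive_definite_carrier[OF assms] and inv = positive_definite_inverse[OF assms]
  have "mat_adjoint (mat_inv A) = mat_inv A"
  proof (rule inverse_unique[OF A])
    have "mat_adjoint (mat_inv A) * A = mat_adjoint (A * mat_inv A)"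
      unfolding mat_adjoint_mult[OF A inv(1)] positive_definite_adjoint[OF assms] ..
    also have "\<dots> = 1\<^sub>m n" unfolding inv
      by (rule eq_matI) (auto simp: mat_adjoint_index mat_adjoint_def mat_of_rows_index)
    finally show "mat_adjoint (mat_inv A) * A = 1\<^sub>m n" .
  qed (use inv in auto)
  moreover have "positive_definite n (mat_adjoint (mat_inv A) * A * mat_inv A)"
    by (rule positive_definite_congruence[OF assms inv(1) A inv(2)])
  ultimately show ?thesis using inv by simp
qed

text \<open>
  The Cholesky decomposition: the form splits off the square of the functional
  \<open>v \<mapsto> (\<Sum>j. a n j * v j) / sqrt (a n n)\<close>, and the rest, a Schur complement, is positive definite in
  one variable less, because its value at \<open>v\<close> is the value of the given form at the extension of \<open>v\<close>
  that annihilates this functional.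
\<close>

lemma positive_form_gram:
  fixes a :: "nat \<Rightarrow> nat \<Rightarrow> complex"
  assumes "\<And>i j. i < n \<Longrightarrow> j < n \<Longrightarrow> a j i = cnj (a i j)"
    and "\<And>v. (\<exists>i<n. v i \<noteq> 0) \<Longrightarrow> 0 < Re (\<Sum>i<n. \<Sum>j<n. cnj (v i) * a i j * v j)"
  shows "\<exists>c. \<forall>i<n. \<forall>j<n. a i j = (\<Sum>m<n. cnj (c m i) * c m j)"
  using assms
proof (induction n arbitrary: a)
  case (Suc n)
  define d where "d = Re (a n n)"
  have dn: "a n n = of_real d"
    using Suc.prems(1)[of n n] by (simp add: complex_eq_iff d_def)
  have d: "d > 0"
    using Suc.prems(2)[of "\<lambda>i. if i = n then 1 else 0"]
    by (simp add: if_distrib[of cnj] if_distribR sum.delta d_def cong: if_cong)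
  define b where "b = (\<lambda>i j. a i j - a i n * a n j / of_real d)"
  have "\<exists>c. \<forall>i<n. \<forall>j<n. b i j = (\<Sum>m<n. cnj (c m i) * c m j)"
  proof (rule Suc.IH)
    show "b j i = cnj (b i j)" if "i < n" "j < n" for i j
      using Suc.prems(1)[of i j] Suc.prems(1)[of i n] Suc.prems(1)[of n j] that
      by (simp add: b_def mult.commute)
    fix v :: "nat \<Rightarrow> complex" assume v: "\<exists>i<n. v i \<noteq> 0"
    (* the last coordinate of x is chosen so that row n of the matrix annihilates x *)
    define s where "s = (\<Sum>j<n. a n j * v j)"
    define x where "x = (\<lambda>i. if i = n then - s / of_real d else v i)"
    have cs: "(\<Sum>i<n. cnj (v i) * a i n) = cnj s"
      unfolding s_def by (simp, rule sum.cong) (use Suc.prems(1)[of n] in auto)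
    from v obtain i where "i < n" "v i \<noteq> 0" by blast
    then have "\<exists>i<Suc n. x i \<noteq> 0" by (intro exI[of _ i]) (simp add: x_def)
    from Suc.prems(2)[OF this] have "0 < Re (\<Sum>i<Suc n. \<Sum>j<Suc n. cnj (x i) * a i j * x j)" .
    also have "(\<Sum>i<Suc n. \<Sum>j<Suc n. cnj (x i) * a i j * x j)
      = (\<Sum>i<n. \<Sum>j<n. cnj (v i) * a i j * v j) + (\<Sum>i<n. cnj (v i) * a i n) * x n
        + (cnj (x n) * s + cnj (x n) * a n n * x n)"
    proof -
      have "x i = v i" if "i < n" for i using that by (simp add: x_def)
      then show ?thesis
        by (simp add: sum.distrib s_def sum_distrib_left sum_distrib_right mult.assoc)
    qed
    also have "\<dots> = (\<Sum>i<n. \<Sum>j<n. cnj (v i) * a i j * v j) - cnj s * s / of_real d"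
      unfolding cs using d by (simp add: dn x_def field_simps)
    also have "\<dots> = (\<Sum>i<n. \<Sum>j<n. cnj (v i) * b i j * v j)"
    proof -
      have "cnj s * s / of_real d = (\<Sum>i<n. \<Sum>j<n. cnj (v i) * (a i n * a n j / of_real d) * v j)"
      proof -
        have "cnj s * s = (\<Sum>i<n. cnj (v i) * a i n) * (\<Sum>j<n. a n j * v j)"
          unfolding cs unfolding s_def ..
        then show ?thesis
          by (simp only: sum_product) (simp add: sum_divide_distrib mult_ac)
      qed
      then show ?thesis
        by (simp add: b_def sum_subtractf algebra_simps)
    qed
    finally show "0 < Re (\<Sum>i<n. \<Sum>j<n. cnj (v i) * b i j * v j)" .
  qed
  then obtain c where c: "\<And>i j. i < n \<Longrightarrow> j < n \<Longrightarrow> b i j = (\<Sum>m<n. cnj (c m i) * c m j)" by blast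
  define c' where "c' = (\<lambda>m i. if m = n then a n i / of_real (sqrt d) else if i = n then 0 else c m i)"
  have "cnj (a n i / of_real (sqrt d)) * (a n j / of_real (sqrt d)) = a i n * a n j / of_real d" if "i < Suc n" for i j
    using Suc.prems(1)[of n i] that d by (simp flip: of_real_mult)
  then have "a i j = (\<Sum>m<Suc n. cnj (c' m i) * c' m j)" if "i < Suc n" "j < Suc n" for i j
    using that c[of i j] d by (auto simp: c'_def b_def dn less_Suc_eq diff_eq_eq)
  then show ?case by blast
qed simp

lemma positive_definite_gram:
  assumes "positive_definite n A"
  obtains C where "C \<in> carrier_mat n n" "A = mat_adjoint C * C"
proof -
  note A = positive_definite_carrier[OF assms]
  have "\<exists>c. \<forall>i<n. \<forall>j<n. A $$ (i, j) = (\<Sum>m<n. cnj (c m i) * c m j)"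
  proof (rule positive_form_gram)
    show "A $$ (j, i) = cnj (A $$ (i, j))" if "i < n" "j < n" for i j
      using mat_adjoint_index[of j A i] positive_definite_adjoint[OF assms] A that by simp
    fix v :: "nat \<Rightarrow> complex" assume "\<exists>i<n. v i \<noteq> 0"
    then have "Matrix.vec n v \<noteq> 0\<^sub>v n" by (metis index_vec index_zero_vec(1))
    then have "0 < Re ((A *\<^sub>v Matrix.vec n v) \<bullet>c Matrix.vec n v)"
      using assms unfolding positive_definite_def by (meson vec_carrier)
    then show "0 < Re (\<Sum>i<n. \<Sum>j<n. cnj (v i) * A $$ (i, j) * v j)"
      by (simp add: quadratic_form[OF A])
  qed
  then obtain c where c: "\<And>i j. i < n \<Longrightarrow> j < n \<Longrightarrow> A $$ (i, j) = (\<Sum>m<n. cnj (c m i) * c m j)" by blast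
  define C where "C = Matrix.mat n n (\<lambda>(m, i). c m i)"
  have C: "C \<in> carrier_mat n n" by (simp add: C_def)
  moreover have "A = mat_adjoint C * C"
  proof (rule eq_matI)
    fix i j assume "i < dim_row (mat_adjoint C * C)" "j < dim_col (mat_adjoint C * C)"
    then have ij: "i < n" "j < n" using C mat_adjoint_carrier[OF C] by auto
    show "A $$ (i, j) = (mat_adjoint C * C) $$ (i, j)"
      using ij c C by (simp add: mat_mult_index[OF mat_adjoint_carrier[OF C] C ij] mat_adjoint_index)
        (simp add: C_def)
  qed (use A C mat_adjoint_carrier[OF C] in auto)
  ultimately show ?thesis using that by blast
qed

text \<open>
  With \<open>N = C\<^sup>* C\<close> and \<open>Y = C Z\<close>, the trace is that of \<open>Y P Y\<^sup>*\<close>, a sum of values of the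
  form \<open>P\<close> at the conjugated rows of \<open>Y\<close>.  It is the squared norm of \<open>Z\<close> as a homomorphism between
  Hermitian vector spaces.
\<close>

lemma trace_positive:
  assumes P: "positive_definite n P" and N: "positive_definite n N" and Z: "Z \<in> carrier_mat n n"
  shows "0 \<le> Re (mat_trace (P * (mat_adjoint Z * (N * Z))))"
    and "Re (mat_trace (P * (mat_adjoint Z * (N * Z)))) = 0 \<Longrightarrow> Z = 0\<^sub>m n n"
proof -
  note P' = positive_definite_carrier[OF P] and N' = positive_definite_carrier[OF N]
  obtain C where C: "C \<in> carrier_mat n n" "N = mat_adjoint C * C"
    using positive_definite_gram[OF N] by blast
  note C' = mat_adjoint_carrier[OF C(1)] and Z' = mat_adjoint_carrier[OF Z]
  define Y where "Y = C * Z"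
  have Y: "Y \<in> carrier_mat n n" using C Z by (simp add: Y_def)
  define x where "x = (\<lambda>m. Matrix.vec n (\<lambda>j. cnj (Y $$ (m, j))))"
  have "mat_trace (P * (mat_adjoint Z * (N * Z))) = mat_trace (P * mat_adjoint Y * Y)"
    unfolding C(2) Y_def using P' C(1) Z C' Z'
    by (simp add: mat_adjoint_mult[of _ n] assoc_mult_mat[of _ n n _ n _ n])
  also have "\<dots> = mat_trace (Y * (P * mat_adjoint Y))"
    by (rule mat_trace_mult_commute[of _ n]) (use P' Y mat_adjoint_carrier[OF Y] in auto)
  also have "\<dots> = (\<Sum>m<n. (P *\<^sub>v x m) \<bullet>c x m)"
  proof -
    have "(Y * (P * mat_adjoint Y)) $$ (m, m) = (\<Sum>i<n. \<Sum>j<n. Y $$ (m, i) * P $$ (i, j) * cnj (Y $$ (m, j)))"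
      if "m < n" for m
      using that Y P' by (simp add: mat_mult_index[OF Y mult_carrier_mat[OF P' mat_adjoint_carrier[OF Y]]]
          mat_mult_index[OF P' mat_adjoint_carrier[OF Y]] mat_adjoint_index sum_distrib_left mult_ac del: index_mult_mat(1))
    then show ?thesis
      using Y P' by (simp add: mat_trace_def quadratic_form[OF P'] x_def)
  qed
  finally have tr: "Re (mat_trace (P * (mat_adjoint Z * (N * Z)))) = (\<Sum>m<n. Re ((P *\<^sub>v x m) \<bullet>c x m))"
    by simp
  have pos: "0 < Re ((P *\<^sub>v x m) \<bullet>c x m)" if "x m \<noteq> 0\<^sub>v n" for m
    using P that unfolding positive_definite_def by (simp add: x_def)
  have nn: "0 \<le> Re ((P *\<^sub>v x m) \<bullet>c x m)" for m
  proof (cases "x m = 0\<^sub>v n")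
    case True
    then show ?thesis unfolding True using P' by (simp add: scalar_prod_def)
  qed (use pos in fastforce)
  show "0 \<le> Re (mat_trace (P * (mat_adjoint Z * (N * Z))))"
    unfolding tr by (rule sum_nonneg) (rule nn)
  assume "Re (mat_trace (P * (mat_adjoint Z * (N * Z)))) = 0"
  then have "\<forall>m\<in>{..<n}. Re ((P *\<^sub>v x m) \<bullet>c x m) = 0"
    unfolding tr by (subst sum_nonneg_eq_0_iff[symmetric]) (auto simp: nn)
  then have x0: "x m = 0\<^sub>v n" if "m < n" for m
    using pos[of m] that by force
  have "Y $$ (m, j) = 0" if "m < n" "j < n" for m j
    using arg_cong[OF x0[OF that(1)], of "\<lambda>v. vec_index v j"] that by (simp add: x_def)
  then have Y0: "C * Z = 0\<^sub>m n n" using Y unfolding Y_def by (intro eq_matI) auto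
  have "N * Z = mat_adjoint C * (C * Z)" unfolding C(2) using C(1) C' Z by (simp add: assoc_mult_mat[of _ n n _ n _ n])
  then have "mat_inv N * (N * Z) = 0\<^sub>m n n"
    unfolding Y0 using C' positive_definite_inverse[OF N] by (simp add: right_mult_zero_mat[of _ n n])
  moreover have "mat_inv N * (N * Z) = (mat_inv N * N) * Z"
    by (rule assoc_mult_mat[symmetric, OF positive_definite_inverse(1)[OF N] N' Z])
  ultimately show "Z = 0\<^sub>m n n" using positive_definite_inverse[OF N] Z by simp
qed

section \<open>Derivatives of matrix-valued functions\<close>

definition mat_wirtinger :: "complex \<Rightarrow> nat \<Rightarrow> (complex \<Rightarrow> complex mat) \<Rightarrow> complex \<Rightarrow> complex mat" where
  "mat_wirtinger e n F w = Matrix.mat n n (\<lambda>(k, l). wirtinger e (\<lambda>x. F x $$ (k, l)) w)"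

lemma mat_d_z_eq_wirtinger: "mat_d_z = mat_wirtinger (- \<i>)"
  by (simp add: fun_eq_iff mat_d_z_def mat_wirtinger_def d_z_eq_wirtinger)

lemma mat_d_zbar_eq_wirtinger: "mat_d_zbar = mat_wirtinger \<i>"
  by (simp add: fun_eq_iff mat_d_zbar_def mat_wirtinger_def d_zbar_eq_wirtinger)

definition mat_differentiable :: "nat \<Rightarrow> (complex \<Rightarrow> complex mat) \<Rightarrow> complex \<Rightarrow> bool" where
  "mat_differentiable n F w \<longleftrightarrow>
     (\<forall>k<n. \<forall>l<n. (\<lambda>x. F x $$ (k, l)) differentiable (at w))"

lemma mat_differentiableD:
  "mat_differentiable n F w \<Longrightarrow> k < n \<Longrightarrow> l < n \<Longrightarrow> (\<lambda>x. F x $$ (k, l)) differentiable (at w)"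
  by (simp add: mat_differentiable_def)

lemma mat_wirtinger_carrier [simp]: "mat_wirtinger e n F w \<in> carrier_mat n n"
  by (simp add: mat_wirtinger_def)

lemma mat_wirtinger_dim [simp]: "dim_row (mat_wirtinger e n F w) = n" "dim_col (mat_wirtinger e n F w) = n"
  by (simp_all add: mat_wirtinger_def)

lemma mat_wirtinger_const: "mat_wirtinger e n (\<lambda>x. C) w = 0\<^sub>m n n"
  by (rule eq_matI) (auto simp: mat_wirtinger_def)

lemma mat_differentiable_const: "mat_differentiable n (\<lambda>x. C) w"
  by (simp add: mat_differentiable_def)

lemma mat_wirtinger_cong:
  assumes "open W" "w \<in> W" "\<And>x. x \<in> W \<Longrightarrow> F x = F' x"
  shows "mat_wirtinger e n F w = mat_wirtinger e n F' w"
    and "mat_differentiable n F w \<Longrightarrow> mat_differentiable n F' w"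
proof -
  show "mat_wirtinger e n F w = mat_wirtinger e n F' w"
    unfolding mat_wirtinger_def
    by (intro cong_mat refl) (use assms in \<open>auto intro!: wirtinger_cong eventually_nhds_in[OF assms(1,2)]\<close>)
  assume d: "mat_differentiable n F w"
  show "mat_differentiable n F' w"
    unfolding mat_differentiable_def
  proof (intro allI impI)
    fix k l assume "k < n" "l < n"
    then have "(\<lambda>x. F x $$ (k, l)) differentiable (at w)"
      using d by (simp add: mat_differentiable_def)
    then show "(\<lambda>x. F' x $$ (k, l)) differentiable (at w)"
      by (rule differentiable_at_cong[OF assms(1,2), rotated]) (simp add: assms(3))
  qed
qed

context
  fixes W :: "complex set" and w :: complex and n :: nat
  assumes W: "open W" "w \<in> W"
begin

lemma mat_wirtinger_mult:
  assumes F: "\<And>x. x \<in> W \<Longrightarrow> F x \<in> carrier_mat n n" "mat_differentiable n F w"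
    and G: "\<And>x. x \<in> W \<Longrightarrow> G x \<in> carrier_mat n n" "mat_differentiable n G w"
  shows "mat_differentiable n (\<lambda>x. F x * G x) w"
    and "mat_wirtinger e n (\<lambda>x. F x * G x) w = mat_wirtinger e n F w * G w + F w * mat_wirtinger e n G w"
proof -
  note Fd = mat_differentiableD[OF F(2)]
  note Gd = mat_differentiableD[OF G(2)]
  have prod: "(\<lambda>x. F x $$ (k, m) * G x $$ (m, l)) differentiable (at w)" if "k < n" "l < n" "m < n" for k l m
    using Fd Gd that by (intro differentiable_mult) auto
  have idx: "(F x * G x) $$ (k, l) = (\<Sum>m<n. F x $$ (k, m) * G x $$ (m, l))" if "x \<in> W" "k < n" "l < n" for x k l
    using mat_mult_index[OF F(1) G(1)] that by blast
  show "mat_differentiable n (\<lambda>x. F x * G x) w"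
    unfolding mat_differentiable_def
  proof (intro allI impI)
    fix k l assume kl: "k < n" "l < n"
    have "(\<lambda>x. \<Sum>m<n. F x $$ (k, m) * G x $$ (m, l)) differentiable (at w)"
      by (rule differentiable_sum) (use prod kl in auto)
    then show "(\<lambda>x. (F x * G x) $$ (k, l)) differentiable (at w)"
      by (rule differentiable_at_cong[OF W, rotated]) (use idx kl in auto)
  qed
  show "mat_wirtinger e n (\<lambda>x. F x * G x) w = mat_wirtinger e n F w * G w + F w * mat_wirtinger e n G w" (is "?L = ?R")
  proof (rule eq_matI)
    note Fw = F(1)[OF W(2)] and Gw = G(1)[OF W(2)]
    fix k l assume "k < dim_row ?R" "l < dim_col ?R"
    then have kl: "k < n" "l < n" using F(1)[OF W(2)] mat_wirtinger_carrier[of e n G w] by auto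
    have "?L $$ (k, l) = wirtinger e (\<lambda>x. \<Sum>m<n. F x $$ (k, m) * G x $$ (m, l)) w"
      using kl by (simp add: mat_wirtinger_def del: index_mult_mat)
        (rule wirtinger_cong, rule eventually_nhds_in[OF W], use idx kl in auto)
    also have "\<dots> = (\<Sum>m<n. wirtinger e (\<lambda>x. F x $$ (k, m)) w * G w $$ (m, l) + F w $$ (k, m) * wirtinger e (\<lambda>x. G x $$ (m, l)) w)"
      using prod Fd Gd kl by (subst wirtinger_sum) (auto simp: wirtinger_mult)
    also have "\<dots> = (mat_wirtinger e n F w * G w) $$ (k, l) + (F w * mat_wirtinger e n G w) $$ (k, l)"
      unfolding mat_mult_index[OF mat_wirtinger_carrier Gw kl] mat_mult_index[OF Fw mat_wirtinger_carrier kl]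
      using kl by (simp add: mat_wirtinger_def sum.distrib)
    also have "\<dots> = ?R $$ (k, l)"
      using kl Fw Gw mat_wirtinger_carrier[of e n G w] mat_wirtinger_carrier[of e n F w]
      by (subst index_add_mat) auto
    finally show "?L $$ (k, l) = ?R $$ (k, l)" .
  qed (use F(1)[OF W(2)] G(1)[OF W(2)] mat_wirtinger_carrier[of e n G w] mat_wirtinger_carrier[of e n F w] in \<open>auto simp: mat_wirtinger_def\<close>)
qed

lemma mat_wirtinger_diff:
  assumes F: "\<And>x. x \<in> W \<Longrightarrow> F x \<in> carrier_mat n n" "mat_differentiable n F w"
    and G: "\<And>x. x \<in> W \<Longrightarrow> G x \<in> carrier_mat n n" "mat_differentiable n G w"
  shows "mat_differentiable n (\<lambda>x. F x - G x) w"
    and "mat_wirtinger e n (\<lambda>x. F x - G x) w = mat_wirtinger e n F w - mat_wirtinger e n G w"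
proof -
  note Fd = mat_differentiableD[OF F(2)]
  note Gd = mat_differentiableD[OF G(2)]
  have idx: "(F x - G x) $$ (k, l) = F x $$ (k, l) - G x $$ (k, l)" if "x \<in> W" "k < n" "l < n" for x k l
    using F(1)[OF that(1)] G(1)[OF that(1)] that by auto
  show "mat_differentiable n (\<lambda>x. F x - G x) w"
    unfolding mat_differentiable_def
  proof (intro allI impI)
    fix k l assume kl: "k < n" "l < n"
    have "(\<lambda>x. F x $$ (k, l) - G x $$ (k, l)) differentiable (at w)"
      using Fd Gd kl by auto
    then show "(\<lambda>x. (F x - G x) $$ (k, l)) differentiable (at w)"
      by (rule differentiable_at_cong[OF W, rotated]) (use idx kl in auto)
  qed
  have "wirtinger e (\<lambda>x. (F x - G x) $$ (k, l)) w = wirtinger e (\<lambda>x. F x $$ (k, l)) w - wirtinger e (\<lambda>x. G x $$ (k, l)) w"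
    if kl: "k < n" "l < n" for k l
  proof -
    have "wirtinger e (\<lambda>x. (F x - G x) $$ (k, l)) w = wirtinger e (\<lambda>x. F x $$ (k, l) - G x $$ (k, l)) w"
      by (rule wirtinger_cong, rule eventually_nhds_in[OF W]) (use idx kl in auto)
    also have "\<dots> = wirtinger e (\<lambda>x. F x $$ (k, l)) w - wirtinger e (\<lambda>x. G x $$ (k, l)) w"
      by (rule wirtinger_diff) (use Fd Gd kl in auto)
    finally show ?thesis .
  qed
  then show "mat_wirtinger e n (\<lambda>x. F x - G x) w = mat_wirtinger e n F w - mat_wirtinger e n G w"
    by (intro eq_matI) (auto simp: mat_wirtinger_def)
qed

lemma wirtinger_trace:
  assumes F: "\<And>x. x \<in> W \<Longrightarrow> F x \<in> carrier_mat n n" "mat_differentiable n F w"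
  shows "(\<lambda>x. mat_trace (F x)) differentiable (at w)"
    and "wirtinger e (\<lambda>x. mat_trace (F x)) w = mat_trace (mat_wirtinger e n F w)"
proof -
  note Fd = mat_differentiableD[OF F(2)]
  have tr: "mat_trace (F x) = (\<Sum>k<n. F x $$ (k, k))" if "x \<in> W" for x
    using F(1)[OF that] by (auto simp: mat_trace_def)
  have "(\<lambda>x. \<Sum>k<n. F x $$ (k, k)) differentiable (at w)"
    by (rule differentiable_sum) (use Fd in auto)
  then show "(\<lambda>x. mat_trace (F x)) differentiable (at w)"
    by (rule differentiable_at_cong[OF W, rotated]) (use tr in auto)
  have "wirtinger e (\<lambda>x. mat_trace (F x)) w = wirtinger e (\<lambda>x. \<Sum>k<n. F x $$ (k, k)) w"
    by (rule wirtinger_cong, rule eventually_nhds_in[OF W]) (use tr in auto)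
  also have "\<dots> = mat_trace (mat_wirtinger e n F w)"
    using Fd by (subst wirtinger_sum) (auto simp: mat_trace_def mat_wirtinger_def)
  finally show "wirtinger e (\<lambda>x. mat_trace (F x)) w = mat_trace (mat_wirtinger e n F w)" .
qed

text \<open>
  Conjugation exchanges the two Wirtinger derivatives, hence the two derivatives of a Hermitian
  metric are adjoint to each other.
\<close>

lemma mat_wirtinger_hermitian:
  assumes F: "\<And>x. x \<in> W \<Longrightarrow> F x \<in> carrier_mat n n" "mat_differentiable n F w"
    and herm: "\<And>x. x \<in> W \<Longrightarrow> mat_adjoint (F x) = F x"
  shows "mat_wirtinger e n F w = mat_adjoint (mat_wirtinger (cnj e) n F w)"
proof -
  have "wirtinger e (\<lambda>x. F x $$ (k, l)) w = cnj (wirtinger (cnj e) (\<lambda>x. F x $$ (l, k)) w)" if kl: "k < n" "l < n" for k l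
  proof -
    have "F x $$ (k, l) = cnj (F x $$ (l, k))" if "x \<in> W" for x
      using mat_adjoint_index[of k "F x" l] herm[OF that] F(1)[OF that] kl by simp
    then have "wirtinger e (\<lambda>x. F x $$ (k, l)) w = wirtinger e (\<lambda>x. cnj (F x $$ (l, k))) w"
      by (intro wirtinger_cong eventually_nhds_in[OF W]) auto
    also have "\<dots> = cnj (wirtinger (cnj e) (\<lambda>x. F x $$ (l, k)) w)"
      by (rule wirtinger_cnj) (use F(2) kl in \<open>auto simp: mat_differentiable_def\<close>)
    finally show ?thesis .
  qed
  then show ?thesis
    by (intro eq_matI) (auto simp: mat_adjoint_index mat_wirtinger_def)
qed

end

lemma differentiable_prod:
  fixes f :: "'b \<Rightarrow> complex \<Rightarrow> complex"
  assumes "\<And>k. k \<in> I \<Longrightarrow> f k differentiable (at w)"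
  shows "(\<lambda>x. \<Prod>k\<in>I. f k x) differentiable (at w)"
  using assms by (induction I rule: infinite_finite_induct) (auto intro!: differentiable_mult)

lemma differentiable_det:
  fixes F :: "complex \<Rightarrow> complex mat"
  assumes W: "open W" "w \<in> W"
    and F: "\<And>x. x \<in> W \<Longrightarrow> F x \<in> carrier_mat m m" "mat_differentiable m F w"
  shows "(\<lambda>x. Determinant.det (F x)) differentiable (at w)"
proof (rule differentiable_at_cong[OF W])
  show "(\<Sum>p | p permutes {0..<m}. signof p * (\<Prod>i = 0..<m. F x $$ (i, p i))) = Determinant.det (F x)"
    if "x \<in> W" for x
    by (rule det_def'[symmetric, OF F(1)[OF that]])
  show "(\<lambda>x. \<Sum>p | p permutes {0..<m}. signof p * (\<Prod>i = 0..<m. F x $$ (i, p i))) differentiable (at w)"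
    using F(2) finite_permutations[of "{0..<m}"] permutes_in_image
    by (intro differentiable_sum differentiable_mult differentiable_prod ballI)
      (fastforce simp: mat_differentiable_def)+
qed

text \<open>
  Cramer's rule; it makes the inverse of a differentiable family differentiable, since the
  determinants are polynomials in the entries.
\<close>

lemma mat_inv_index:
  assumes "positive_definite n A" "k < n" "l < n"
  shows "mat_inv A $$ (k, l) = cofactor A l k / Determinant.det A"
proof -
  note A = positive_definite_carrier[OF assms(1)] and det = positive_definite_det[OF assms(1)]
  have "mat_inv A = (1 / Determinant.det A) \<cdot>\<^sub>m adj_mat A"
  proof (rule inverse_unique[OF A])
    show "A * ((1 / Determinant.det A) \<cdot>\<^sub>m adj_mat A) = 1\<^sub>m n"
      using adj_mat[OF A] A det by (simp add: mult_smult_distrib[of _ n n _ n]) (rule eq_matI, auto)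
  qed (use positive_definite_inverse[OF assms(1)] adj_mat[OF A] in auto)
  then show ?thesis using assms(2,3) A by (simp add: adj_mat_def)
qed

lemma mat_differentiable_inv:
  assumes W: "open W" "w \<in> W"
    and F: "\<And>x. x \<in> W \<Longrightarrow> positive_definite n (F x)" "mat_differentiable n F w"
  shows "mat_differentiable n (\<lambda>x. mat_inv (F x)) w"
  unfolding mat_differentiable_def
proof (intro allI impI)
  fix k l assume kl: "k < n" "l < n"
  note carr = positive_definite_carrier[OF F(1)]
  show "(\<lambda>x. mat_inv (F x) $$ (k, l)) differentiable (at w)"
  proof (rule differentiable_at_cong[OF W])
    show "cofactor (F x) l k / Determinant.det (F x) = mat_inv (F x) $$ (k, l)" if "x \<in> W" for x
      by (rule mat_inv_index[symmetric, OF F(1)[OF that] kl])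
    have "mat_differentiable (n - 1) (\<lambda>x. mat_delete (F x) l k) w"
      unfolding mat_differentiable_def
    proof (intro allI impI)
      fix a b assume ab: "a < n - 1" "b < n - 1"
      show "(\<lambda>x. mat_delete (F x) l k $$ (a, b)) differentiable (at w)"
      proof (rule differentiable_at_cong[OF W])
        show "F x $$ (if a < l then a else Suc a, if b < k then b else Suc b) = mat_delete (F x) l k $$ (a, b)"
          if "x \<in> W" for x
          using carr[OF that] ab by (auto simp: mat_delete_def)
        show "(\<lambda>x. F x $$ (if a < l then a else Suc a, if b < k then b else Suc b)) differentiable (at w)"
          using F(2) ab by (auto simp: mat_differentiable_def)
      qed
    qed
    moreover have "mat_delete (F x) l k \<in> carrier_mat (n - 1) (n - 1)" if "x \<in> W" for x
      using mat_delete_carrier[OF carr[OF that]] .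
    ultimately have "(\<lambda>x. Determinant.det (mat_delete (F x) l k)) differentiable (at w)"
      by (intro differentiable_det[OF W])
    then have "(\<lambda>x. cofactor (F x) l k) differentiable (at w)"
      unfolding cofactor_def by (intro differentiable_mult) auto
    moreover have "(\<lambda>x. Determinant.det (F x)) differentiable (at w)"
      by (rule differentiable_det[OF W carr F(2)])
    ultimately show "(\<lambda>x. cofactor (F x) l k / Determinant.det (F x)) differentiable (at w)"
      using positive_definite_det[OF F(1)[OF W(2)]] by (intro differentiable_divide) auto
  qed
qed

lemma mat_eq_uminusI:
  fixes X Y :: "complex mat"
  assumes "X \<in> carrier_mat n n" "Y \<in> carrier_mat n n" "X + Y = 0\<^sub>m n n"
  shows "X = - Y"
proof (rule eq_matI)
  fix i j assume "i < dim_row (- Y)" "j < dim_col (- Y)"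
  then have ij: "i < n" "j < n" using assms by auto
  have "(X + Y) $$ (i, j) = 0" using assms(3) ij by simp
  then show "X $$ (i, j) = (- Y) $$ (i, j)"
    using assms(1,2) ij by (simp add: add_eq_0_iff2)
qed (use assms in auto)

lemma mat_wirtinger_inv:
  assumes W: "open W" "w \<in> W"
    and F: "\<And>x. x \<in> W \<Longrightarrow> positive_definite n (F x)" "mat_differentiable n F w"
  shows "mat_wirtinger e n (\<lambda>x. mat_inv (F x)) w = - (mat_inv (F w) * (mat_wirtinger e n F w * mat_inv (F w)))"
proof -
  note carr = positive_definite_carrier[OF F(1)] and inv = positive_definite_inverse[OF F(1)]
  let ?G = "mat_inv (F w)" and ?G' = "mat_wirtinger e n (\<lambda>x. mat_inv (F x)) w" and ?F' = "mat_wirtinger e n F w"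
  note [simp] = inv(1)[OF W(2)] carr[OF W(2)]
  have "mat_wirtinger e n (\<lambda>x. mat_inv (F x) * F x) w = mat_wirtinger e n (\<lambda>x. 1\<^sub>m n) w"
    by (rule mat_wirtinger_cong[OF W]) (rule inv(3))
  then have "?G' * F w + ?G * ?F' = 0\<^sub>m n n"
    using mat_wirtinger_mult(2)[OF W inv(1) mat_differentiable_inv[OF W F] carr F(2), of e]
    by (simp add: mat_wirtinger_const)
  then have "(?G' * F w + ?G * ?F') * ?G = 0\<^sub>m n n"
    using left_mult_zero_mat[OF inv(1)[OF W(2)]] by metis
  then have "?G' + ?G * (?F' * ?G) = 0\<^sub>m n n"
    using inv(2)[OF W(2)] by (simp add: add_mult_distrib_mat[of _ n n _ _ n] assoc_mult_mat[of _ n n _ n _ n])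
  then show ?thesis by (intro mat_eq_uminusI[of _ n]) simp_all
qed

section \<open>The relative trace of two solutions of the Hitchin equation\<close>

text \<open>
  The Hitchin equation in one coordinate disc, together with the regularity needed to differentiate
  it.
\<close>

definition local_hitchin :: "nat \<Rightarrow> complex set \<Rightarrow> (complex \<Rightarrow> complex mat) \<Rightarrow> (complex \<Rightarrow> complex mat) \<Rightarrow> bool" where
  "local_hitchin n W \<Phi> H \<longleftrightarrow> open W \<and>
     (\<forall>w\<in>W. positive_definite n (H w) \<and> \<Phi> w \<in> carrier_mat n n \<and>
        mat_differentiable n H w \<and> mat_differentiable n (mat_d_z n H) w \<and>
        mat_d_zbar n (chern_connection_form n H) w =
          \<Phi> w * higgs_adjoint (H w) (\<Phi> w) - higgs_adjoint (H w) (\<Phi> w) * \<Phi> w)"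

lemma mat_minus_eq_zeroD:
  fixes X Y :: "complex mat"
  assumes "X \<in> carrier_mat n n" "Y \<in> carrier_mat n n" "X - Y = 0\<^sub>m n n"
  shows "X = Y"
proof (rule eq_matI)
  fix i j assume "i < dim_row Y" "j < dim_col Y"
  then have ij: "i < n" "j < n" using assms by auto
  have "(X - Y) $$ (i, j) = 0" using assms(3) ij by simp
  then show "X $$ (i, j) = Y $$ (i, j)"
    using assms(1,2) ij by simp
qed (use assms in auto)

lemma mat_uminus_mult_add:
  fixes A B C :: "complex mat"
  assumes "A \<in> carrier_mat n n" "B \<in> carrier_mat n n" "C \<in> carrier_mat n n"
  shows "- A * B + C = C - A * B"
proof -
  have "- A * B = - (A * B)" using assms by (intro uminus_mult_left_mat) auto
  then show ?thesis using assms by (intro eq_matI) auto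
qed

lemma commutator_minus:
  fixes P X Y :: "complex mat"
  assumes "P \<in> carrier_mat n n" "X \<in> carrier_mat n n" "Y \<in> carrier_mat n n"
  shows "(P * X - X * P) - (P * Y - Y * P) = P * (X - Y) - (X - Y) * P"
proof -
  have *: "(a - b) - (c - d) = (a - c) - (b - d)"
    if "a \<in> carrier_mat n n" "b \<in> carrier_mat n n" "c \<in> carrier_mat n n" "d \<in> carrier_mat n n"
    for a b c d :: "complex mat"
    using that by (intro eq_matI) auto
  show ?thesis
    using assms *[of "P * X" "X * P" "P * Y" "Y * P"]
    by (simp add: mult_minus_distrib_mat[of _ n n _ n] minus_mult_distrib_mat[of _ n n _ _ n])
qed

lemma local_hitchinD:
  assumes "local_hitchin n W \<Phi> H"
  shows "open W"
    and "w \<in> W \<Longrightarrow> positive_definite n (H w)"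
    and "w \<in> W \<Longrightarrow> \<Phi> w \<in> carrier_mat n n"
    and "w \<in> W \<Longrightarrow> mat_differentiable n H w"
    and "w \<in> W \<Longrightarrow> mat_differentiable n (mat_d_z n H) w"
    and "w \<in> W \<Longrightarrow> mat_d_zbar n (chern_connection_form n H) w =
          \<Phi> w * higgs_adjoint (H w) (\<Phi> w) - higgs_adjoint (H w) (\<Phi> w) * \<Phi> w"
  using assms by (auto simp: local_hitchin_def)

lemma mat_d_z_carrier [simp]: "mat_d_z n F w \<in> carrier_mat n n"
  and mat_d_zbar_carrier [simp]: "mat_d_zbar n F w \<in> carrier_mat n n"
  by (simp_all add: mat_d_z_eq_wirtinger mat_d_zbar_eq_wirtinger)

lemma chern_connection_form_carrier:
  "positive_definite n (H w) \<Longrightarrow> chern_connection_form n H w \<in> carrier_mat n n"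
  unfolding chern_connection_form_def by (simp add: positive_definite_inverse)

lemma higgs_adjoint_carrier:
  "positive_definite n A \<Longrightarrow> B \<in> carrier_mat n n \<Longrightarrow> higgs_adjoint A B \<in> carrier_mat n n"
  unfolding higgs_adjoint_def by (simp add: positive_definite_inverse positive_definite_carrier)

lemma chern_connection_form_differentiable:
  assumes "local_hitchin n W \<Phi> H" "w \<in> W"
  shows "mat_differentiable n (chern_connection_form n H) w"
proof -
  note L = local_hitchinD[OF assms(1)]
  have "mat_differentiable n (\<lambda>x. mat_inv (H x) * mat_d_z n H x) w"
    by (rule mat_wirtinger_mult(1)[OF L(1) assms(2)])
      (use positive_definite_inverse[OF L(2)] mat_differentiable_inv[OF L(1) assms(2) L(2) L(4)] L(5) assms(2) in auto)
  then show ?thesis by (simp add: chern_connection_form_def[abs_def])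
qed

text \<open>
  The zero-order term in the Laplacian of the relative trace is a squared norm.  With
  \<open>R = \<phi>\<^sup>*\<^sup>K - \<phi>\<^sup>*\<^sup>H\<close> one has \<open>K R = \<phi>\<^sup>\<dagger> K - K H\<^sup>-\<^sup>1 \<phi>\<^sup>\<dagger> H\<close>, and the adjoint of this matrix
  multiplied by \<open>H\<^sup>-\<^sup>1\<close> is the commutator of \<open>H\<^sup>-\<^sup>1 K\<close> with \<open>\<phi>\<close>.
\<close>

lemma higgs_trace_identity:
  fixes H K \<Phi> :: "complex mat"
  assumes H: "positive_definite n H" and K: "positive_definite n K" and \<Phi>: "\<Phi> \<in> carrier_mat n n"
  defines "R \<equiv> higgs_adjoint K \<Phi> - higgs_adjoint H \<Phi>"
  shows "mat_trace ((mat_inv H * K) * (\<Phi> * R - R * \<Phi>))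
    = mat_trace (mat_inv H * (mat_adjoint (K * R) * (mat_inv K * (K * R))))"
proof -
  define G where "G = mat_inv H"
  define N where "N = mat_inv K"
  define P where "P = mat_adjoint \<Phi>"
  note Hc = positive_definite_carrier[OF H] and Kc = positive_definite_carrier[OF K]
  have Gc: "G \<in> carrier_mat n n" and Nc: "N \<in> carrier_mat n n"
    using positive_definite_inverse[OF H] positive_definite_inverse[OF K] by (auto simp: G_def N_def)
  have Pc: "P \<in> carrier_mat n n" using \<Phi> by (simp add: P_def)
  have Rc: "R \<in> carrier_mat n n"
    unfolding R_def by (intro minus_carrier_mat higgs_adjoint_carrier H \<Phi>)
  note [simp] = Hc Kc Gc Nc Pc Rc \<Phi>
  note assoc = assoc_mult_mat[of _ n n _ n _ n]
  have KN: "K * (N * X) = X" "N * (K * X) = X" "G * (H * X) = X" if "X \<in> carrier_mat n n" for X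
    using that positive_definite_inverse[OF H] positive_definite_inverse[OF K]
    by (auto simp: N_def G_def intro!: mat_cancel_left)
  have KR: "K * R = P * K - K * (G * (P * H))"
  proof -
    have "K * R = K * (N * (P * K)) - K * (G * (P * H))"
      unfolding R_def higgs_adjoint_def P_def[symmetric] N_def[symmetric] G_def[symmetric]
      by (simp add: mult_minus_distrib_mat[of _ n n _ n] assoc)
    then show ?thesis by (simp add: KN)
  qed
  have "mat_adjoint G = G" "mat_adjoint H = H" "mat_adjoint K = K" "mat_adjoint P = \<Phi>"
    using positive_definite_adjoint[OF positive_definite_mat_inv[OF H]] positive_definite_adjoint[OF H]
      positive_definite_adjoint[OF K] by (auto simp: G_def P_def)
  then have KR': "mat_adjoint (K * R) = K * \<Phi> - H * (\<Phi> * (G * K))"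
    unfolding KR by (simp add: mat_adjoint_minus[of _ n] mat_adjoint_mult[of _ n] assoc)
  have GKR: "G * mat_adjoint (K * R) = G * (K * \<Phi>) - \<Phi> * (G * K)"
    unfolding KR' by (simp add: mult_minus_distrib_mat[of _ n n _ n] KN)
  have "G * (mat_adjoint (K * R) * (N * (K * R))) = (G * mat_adjoint (K * R)) * R"
    by (simp add: KN) (rule assoc_mult_mat[symmetric, of _ n n _ n _ n], simp_all)
  also have "\<dots> = G * (K * (\<Phi> * R)) - \<Phi> * (G * (K * R))"
    unfolding GKR by (simp add: minus_mult_distrib_mat[of _ n n _ _ n] assoc)
  finally have 1: "mat_trace (G * (mat_adjoint (K * R) * (N * (K * R))))
     = mat_trace (G * (K * (\<Phi> * R))) - mat_trace (\<Phi> * (G * (K * R)))"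
    by (simp add: mat_trace_minus[of _ n])
  have "(G * K) * (\<Phi> * R - R * \<Phi>) = G * (K * (\<Phi> * R)) - (G * (K * R)) * \<Phi>"
    by (simp add: mult_minus_distrib_mat[of _ n n _ n] assoc)
  then have "mat_trace ((G * K) * (\<Phi> * R - R * \<Phi>)) = mat_trace (G * (K * (\<Phi> * R))) - mat_trace ((G * (K * R)) * \<Phi>)"
    by (simp add: mat_trace_minus[of _ n])
  also have "mat_trace ((G * (K * R)) * \<Phi>) = mat_trace (\<Phi> * (G * (K * R)))"
    by (rule mat_trace_mult_commute[of _ n]) simp_all
  finally show ?thesis using 1 by (simp add: G_def N_def)
qed

text \<open>
  Let \<open>h = H\<^sup>-\<^sup>1 K\<close> be the relative endomorphism and \<open>Z\<close> the difference of the two connection forms.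
  The first derivative of \<open>tr h\<close> is \<open>tr (h Z)\<close>.  In the second one, \<open>dbar h = H\<^sup>-\<^sup>1 Z\<^sup>* K\<close> because the
  metrics are Hermitian, while \<open>dbar Z\<close> is a commutator with \<open>\<phi>\<close> by the two Hitchin equations.  No
  second derivatives of the metrics survive, and both terms are squared norms.
\<close>

lemma trace_laplacian:
  assumes H: "local_hitchin n W \<Phi> H" and K: "local_hitchin n W \<Phi> K"
  defines "u \<equiv> \<lambda>x. Re (mat_trace (mat_inv (H x) * K x))"
    and "Z \<equiv> \<lambda>w. chern_connection_form n K w - chern_connection_form n H w"
    and "R \<equiv> \<lambda>w. higgs_adjoint (K w) (\<Phi> w) - higgs_adjoint (H w) (\<Phi> w)"
  shows "twice_differentiable_on u W"
    and "w \<in> W \<Longrightarrow> laplacian u w =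
      Re (mat_trace (mat_inv (H w) * (mat_adjoint (Z w) * (K w * Z w)))) +
      Re (mat_trace (mat_inv (H w) * (mat_adjoint (K w * R w) * (mat_inv (K w) * (K w * R w)))))"
proof -
  note LH = local_hitchinD[OF H] and LK = local_hitchinD[OF K]
  note W = LH(1)
  define G where "G = (\<lambda>x. mat_inv (H x))"
  define A where "A = chern_connection_form n H"
  define B where "B = chern_connection_form n K"
  define h where "h = (\<lambda>x. G x * K x)"
  note Hc = positive_definite_carrier[OF LH(2)] and Kc = positive_definite_carrier[OF LK(2)]
  have Gc: "G x \<in> carrier_mat n n" if "x \<in> W" for x
    using positive_definite_inverse[OF LH(2)[OF that]] by (simp add: G_def)
  have Ac: "A x \<in> carrier_mat n n" if "x \<in> W" for x
    unfolding A_def by (rule chern_connection_form_carrier[where H = H, OF LH(2)[OF that]])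
  have Bc: "B x \<in> carrier_mat n n" if "x \<in> W" for x
    unfolding B_def by (rule chern_connection_form_carrier[where H = K, OF LK(2)[OF that]])
  have Zc: "Z x \<in> carrier_mat n n" if "x \<in> W" for x
    unfolding Z_def using Ac[OF that] by (intro minus_carrier_mat) (simp add: A_def)
  have hc: "h x \<in> carrier_mat n n" if "x \<in> W" for x
    unfolding h_def using Gc[OF that] Kc[OF that] by simp
  have Gd: "mat_differentiable n G x" if "x \<in> W" for x
    unfolding G_def by (rule mat_differentiable_inv[OF W that LH(2) LH(4)]) (use that in auto)
  have hd: "mat_differentiable n h x" if "x \<in> W" for x
    unfolding h_def by (rule mat_wirtinger_mult(1)[OF W that Gc Gd Kc LK(4)]) (use that in auto)
  have Zd: "mat_differentiable n Z x" if "x \<in> W" for x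
    unfolding Z_def
    by (rule mat_wirtinger_diff(1)[OF W that]) (use chern_connection_form_differentiable[OF H that]
      chern_connection_form_differentiable[OF K that] Ac Bc in \<open>auto simp: A_def B_def\<close>)
  have inv: "H x * (G x * X) = X" "G x * (H x * X) = X" "K x * (mat_inv (K x) * X) = X" if "x \<in> W" "X \<in> carrier_mat n n" for x X
    using assoc_mult_mat[OF Hc[OF that(1)] Gc[OF that(1)] that(2)]
      assoc_mult_mat[OF Gc[OF that(1)] Hc[OF that(1)] that(2)]
      assoc_mult_mat[OF Kc[OF that(1)] positive_definite_inverse(1)[OF LK(2)[OF that(1)]] that(2)]
      positive_definite_inverse[OF LH(2)[OF that(1)]] positive_definite_inverse[OF LK(2)[OF that(1)]] that
    by (simp_all add: G_def)
  have Hz: "mat_d_z n H x = H x * A x" and Kz: "mat_d_z n K x = K x * B x" if "x \<in> W" for x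
    using inv[OF that, of "mat_d_z n H x"] inv[OF that, of "mat_d_z n K x"]
    by (simp_all add: A_def B_def chern_connection_form_def G_def)
  have adj: "mat_adjoint (H x) = H x" "mat_adjoint (K x) = K x" "mat_adjoint (G x) = G x" if "x \<in> W" for x
    using positive_definite_adjoint LH(2)[OF that] LK(2)[OF that] positive_definite_mat_inv
    by (auto simp: G_def)
  note assoc = assoc_mult_mat[of _ n n _ n _ n]
  have u_eq: "complex_of_real (u x) = mat_trace (h x)" if "x \<in> W" for x
  proof -
    have "cnj (mat_trace (h x)) = mat_trace (K x * G x)"
      using mat_trace_adjoint[OF hc[OF that]] adj[OF that] mat_adjoint_mult[OF Gc[OF that] Kc[OF that]]
      by (simp add: h_def)
    also have "\<dots> = mat_trace (h x)"
      unfolding h_def by (rule mat_trace_mult_commute[OF Kc[OF that] Gc[OF that]])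
    finally show ?thesis by (simp add: u_def h_def G_def complex_eq_iff)
  qed
  (* first derivative: G is differentiated by the rule for inverses, and the trace is cyclic *)
  have u_z: "d_z (\<lambda>x. complex_of_real (u x)) x = mat_trace (h x * Z x)" if x: "x \<in> W" for x
  proof -
    note [simp] = Hc[OF x] Kc[OF x] Gc[OF x] Ac[OF x] Bc[OF x] hc[OF x]
    have Gz: "mat_d_z n G x = - (A x * G x)"
      unfolding G_def mat_d_z_eq_wirtinger
      using mat_wirtinger_inv[OF W x LH(2) LH(4), of "- \<i>"] x
      by (simp add: A_def chern_connection_form_def mat_d_z_eq_wirtinger G_def[symmetric, unfolded fun_eq_iff] assoc)
    have "d_z (\<lambda>x. complex_of_real (u x)) x = wirtinger (- \<i>) (\<lambda>x. mat_trace (h x)) x"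
      unfolding d_z_eq_wirtinger by (rule wirtinger_cong, rule eventually_nhds_in[OF W x], rule u_eq)
    also have "\<dots> = mat_trace (mat_d_z n h x)"
      unfolding mat_d_z_eq_wirtinger by (rule wirtinger_trace(2)[OF W x hc hd[OF x]])
    also have "mat_d_z n h x = mat_d_z n G x * K x + G x * mat_d_z n K x"
      unfolding h_def mat_d_z_eq_wirtinger by (rule mat_wirtinger_mult(2)[OF W x Gc Gd[OF x] Kc LK(4)[OF x]])
    also have "\<dots> = G x * (K x * B x) - A x * G x * K x"
      unfolding Gz Kz[OF x] by (rule mat_uminus_mult_add[of _ n]) simp_all
    also have "\<dots> = h x * B x - A x * h x"
      unfolding h_def by (simp add: assoc)
    also have "mat_trace \<dots> = mat_trace (h x * B x) - mat_trace (h x * A x)"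
      using mat_trace_mult_commute[OF Ac[OF x] hc[OF x]] by (simp add: mat_trace_minus[of _ n])
    also have "\<dots> = mat_trace (h x * Z x)"
      by (simp add: Z_def A_def[symmetric] B_def[symmetric] mult_minus_distrib_mat[of _ n n _ n] mat_trace_minus[of _ n])
    finally show ?thesis .
  qed
  have hZc: "h x * Z x \<in> carrier_mat n n" if "x \<in> W" for x
    using hc[OF that] Zc[OF that] by simp
  have hZd: "mat_differentiable n (\<lambda>x. h x * Z x) x" if "x \<in> W" for x
    by (rule mat_wirtinger_mult(1)[OF W that hc hd[OF that] Zc Zd[OF that]])
  show "twice_differentiable_on u W"
    unfolding twice_differentiable_on_def
  proof (intro ballI conjI)
    fix x assume x: "x \<in> W"
    show "(\<lambda>x. complex_of_real (u x)) differentiable at x"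
      by (rule differentiable_at_cong[OF W x _ wirtinger_trace(1)[OF W x hc hd[OF x]]]) (simp add: u_eq)
    show "d_z (\<lambda>x. complex_of_real (u x)) differentiable at x"
      by (rule differentiable_at_cong[OF W x _ wirtinger_trace(1)[OF W x hZc hZd[OF x]]]) (simp add: u_z)
  qed
  assume w: "w \<in> W"
  note [simp] = Hc[OF w] Kc[OF w] Gc[OF w] Ac[OF w] Bc[OF w] hc[OF w] Zc[OF w] LH(3)[OF w]
    higgs_adjoint_carrier[OF LH(2) LH(3), OF w w] higgs_adjoint_carrier[OF LK(2) LH(3), OF w w]
  have Hzb: "mat_d_zbar n H w = mat_adjoint (A w) * H w"
    using mat_wirtinger_hermitian[OF W w Hc LH(4)[OF w] adj(1), of \<i>] Hz[OF w] adj[OF w]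
    by (simp add: mat_d_zbar_eq_wirtinger mat_d_z_eq_wirtinger mat_adjoint_mult[of _ n])
  have Kzb: "mat_d_zbar n K w = mat_adjoint (B w) * K w"
    using mat_wirtinger_hermitian[OF W w Kc LK(4)[OF w] adj(2), of \<i>] Kz[OF w] adj[OF w]
    by (simp add: mat_d_zbar_eq_wirtinger mat_d_z_eq_wirtinger mat_adjoint_mult[of _ n])
  have Gzb: "mat_d_zbar n G w = - (G w * mat_adjoint (A w))"
  proof -
    have "mat_d_zbar n G w = - (G w * (mat_adjoint (A w) * H w * G w))"
      using mat_wirtinger_inv[OF W w LH(2) LH(4)[OF w], of \<i>] Hzb
      by (simp add: mat_d_zbar_eq_wirtinger G_def)
    also have "mat_adjoint (A w) * H w * G w = mat_adjoint (A w)"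
      using positive_definite_inverse[OF LH(2)[OF w]] right_mult_one_mat[OF mat_adjoint_carrier[OF Ac[OF w]]]
      by (simp add: assoc G_def)
    finally show ?thesis .
  qed
  (* the adjoint of Z appears because the dbar-derivatives of H and K are adjoint to the d-derivatives *)
  have hzb: "mat_d_zbar n h w = G w * (mat_adjoint (Z w) * K w)"
  proof -
    have "mat_d_zbar n h w = mat_d_zbar n G w * K w + G w * mat_d_zbar n K w"
      unfolding h_def mat_d_zbar_eq_wirtinger by (rule mat_wirtinger_mult(2)[OF W w Gc Gd[OF w] Kc LK(4)[OF w]])
    also have "\<dots> = G w * (mat_adjoint (B w) * K w) - G w * mat_adjoint (A w) * K w"
      unfolding Gzb Kzb by (rule mat_uminus_mult_add[of _ n]) simp_all
    also have "\<dots> = G w * (mat_adjoint (B w) * K w) - G w * (mat_adjoint (A w) * K w)"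
      by (simp add: assoc)
    also have "\<dots> = G w * (mat_adjoint (Z w) * K w)"
      unfolding Z_def A_def[symmetric] B_def[symmetric]
      by (simp add: mat_adjoint_minus[of _ n] mult_minus_distrib_mat[of _ n n _ n] minus_mult_distrib_mat[of _ n n _ _ n])
    finally show ?thesis .
  qed
  have Zzb: "mat_d_zbar n Z w = \<Phi> w * R w - R w * \<Phi> w"
  proof -
    have "mat_d_zbar n Z w = mat_d_zbar n B w - mat_d_zbar n A w"
      unfolding Z_def mat_d_zbar_eq_wirtinger A_def B_def
      by (rule mat_wirtinger_diff(2)[OF W w]) (use chern_connection_form_differentiable[OF H w]
      chern_connection_form_differentiable[OF K w] Ac Bc in \<open>auto simp: A_def B_def\<close>)
    also have "\<dots> = \<Phi> w * R w - R w * \<Phi> w"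
      unfolding A_def B_def LH(6)[OF w] LK(6)[OF w] R_def
      by (rule commutator_minus[of _ n]) simp_all
    finally show ?thesis .
  qed
  have Rc: "R w \<in> carrier_mat n n" unfolding R_def by (intro minus_carrier_mat) simp
  have c1: "G w * (mat_adjoint (Z w) * (K w * Z w)) \<in> carrier_mat n n" by simp
  have c2: "(G w * K w) * (\<Phi> w * R w - R w * \<Phi> w) \<in> carrier_mat n n"
    by (intro square_mult_carrier minus_carrier_mat) (simp_all add: Rc)
  have "d_zbar (d_z (\<lambda>x. complex_of_real (u x))) w = wirtinger \<i> (\<lambda>x. mat_trace (h x * Z x)) w"
    unfolding d_zbar_eq_wirtinger by (rule wirtinger_cong, rule eventually_nhds_in[OF W w], rule u_z)
  also have "\<dots> = mat_trace (mat_d_zbar n (\<lambda>x. h x * Z x) w)"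
    unfolding mat_d_zbar_eq_wirtinger by (rule wirtinger_trace(2)[OF W w hZc hZd[OF w]])
  also have "mat_d_zbar n (\<lambda>x. h x * Z x) w = mat_d_zbar n h w * Z w + h w * mat_d_zbar n Z w"
    unfolding mat_d_zbar_eq_wirtinger by (rule mat_wirtinger_mult(2)[OF W w hc hd[OF w] Zc Zd[OF w]])
  also have "\<dots> = G w * (mat_adjoint (Z w) * (K w * Z w)) + (G w * K w) * (\<Phi> w * R w - R w * \<Phi> w)"
    unfolding hzb Zzb unfolding h_def by (simp add: assoc Rc)
  also have "mat_trace \<dots> = mat_trace (G w * (mat_adjoint (Z w) * (K w * Z w))) +
      mat_trace (G w * (mat_adjoint (K w * R w) * (mat_inv (K w) * (K w * R w))))"
    unfolding mat_trace_add[OF c1 c2]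
    using higgs_trace_identity[OF LH(2)[OF w] LK(2)[OF w] LH(3)[OF w]] by (simp only: G_def R_def)
  finally show "laplacian u w =
      Re (mat_trace (mat_inv (H w) * (mat_adjoint (Z w) * (K w * Z w)))) +
      Re (mat_trace (mat_inv (H w) * (mat_adjoint (K w * R w) * (mat_inv (K w) * (K w * R w)))))"
    by (simp add: laplacian_def G_def)
qed

lemma trace_laplacian_nonneg:
  assumes H: "local_hitchin n W \<Phi> H" and K: "local_hitchin n W \<Phi> K" and w: "w \<in> W"
  defines "u \<equiv> \<lambda>x. Re (mat_trace (mat_inv (H x) * K x))"
  shows "0 \<le> laplacian u w"
    and "laplacian u w = 0 \<Longrightarrow> chern_connection_form n K w = chern_connection_form n H w"
    and "laplacian u w = 0 \<Longrightarrow> higgs_adjoint (K w) (\<Phi> w) = higgs_adjoint (H w) (\<Phi> w)"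
proof -
  note LH = local_hitchinD[OF H] and LK = local_hitchinD[OF K]
  define Z where "Z = chern_connection_form n K w - chern_connection_form n H w"
  define R where "R = higgs_adjoint (K w) (\<Phi> w) - higgs_adjoint (H w) (\<Phi> w)"
  have c: "chern_connection_form n K w \<in> carrier_mat n n" "chern_connection_form n H w \<in> carrier_mat n n"
    "higgs_adjoint (K w) (\<Phi> w) \<in> carrier_mat n n" "higgs_adjoint (H w) (\<Phi> w) \<in> carrier_mat n n"
    using LH LK w by (auto intro!: chern_connection_form_carrier higgs_adjoint_carrier)
  note Kc = positive_definite_carrier[OF LK(2)[OF w]]
  have Zc: "Z \<in> carrier_mat n n" and Rc: "R \<in> carrier_mat n n" using c by (auto simp: Z_def R_def intro!: minus_carrier_mat)
  have KR: "K w * R \<in> carrier_mat n n" using Kc Rc by simp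
  note pH = positive_definite_mat_inv[OF LH(2)[OF w]] and pK = positive_definite_mat_inv[OF LK(2)[OF w]]
  let ?a = "Re (mat_trace (mat_inv (H w) * (mat_adjoint Z * (K w * Z))))"
  let ?b = "Re (mat_trace (mat_inv (H w) * (mat_adjoint (K w * R) * (mat_inv (K w) * (K w * R)))))"
  have lap: "laplacian u w = ?a + ?b"
    unfolding u_def Z_def R_def by (rule trace_laplacian(2)[OF H K w])
  have ab: "0 \<le> ?a" "0 \<le> ?b"
    by (rule trace_positive[OF pH LK(2)[OF w] Zc], rule trace_positive[OF pH pK KR])
  then show "0 \<le> laplacian u w" using lap by simp
  assume 0: "laplacian u w = 0"
  have "?a = 0" "?b = 0" using lap ab 0 by linarith+
  then have "Z = 0\<^sub>m n n" and KR0: "K w * R = 0\<^sub>m n n"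
    using trace_positive(2)[OF pH LK(2)[OF w] Zc] trace_positive(2)[OF pH pK KR] by auto
  then show "chern_connection_form n K w = chern_connection_form n H w"
    using mat_minus_eq_zeroD[OF c(1,2)] by (simp add: Z_def)
  have "mat_inv (K w) * (K w * R) = 0\<^sub>m n n"
    unfolding KR0 by (rule right_mult_zero_mat[OF positive_definite_inverse(1)[OF LK(2)[OF w]]])
  moreover have "mat_inv (K w) * (K w * R) = R"
    using assoc_mult_mat[OF positive_definite_inverse(1)[OF LK(2)[OF w]] Kc Rc]
      positive_definite_inverse(3)[OF LK(2)[OF w]] Rc by simp
  ultimately show "higgs_adjoint (K w) (\<Phi> w) = higgs_adjoint (H w) (\<Phi> w)"
    using mat_minus_eq_zeroD[OF c(3,4)] by (simp add: R_def)
qed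

section \<open>Rotating a solution by a constant unitary matrix\<close>

lemma mat_one_adjoint [simp]: "mat_adjoint (1\<^sub>m n :: complex mat) = 1\<^sub>m n"
  by (rule eq_matI) (auto simp: mat_adjoint_index)

lemma smult_smult_mat: "a \<cdot>\<^sub>m (b \<cdot>\<^sub>m A) = (a * b :: complex) \<cdot>\<^sub>m A"
  by (rule eq_matI) auto

lemma one_smult_mat [simp]: "(1 :: complex) \<cdot>\<^sub>m A = A"
  by (rule eq_matI) auto

text \<open>
  A change of frame \<open>g\<close>, with inverse \<open>g'\<close>, acts on Gram matrices by congruence.
\<close>

lemma mat_inv_congruence:
  assumes H: "positive_definite n H" and g: "g \<in> carrier_mat n n" "g' \<in> carrier_mat n n"
    and inv: "g * g' = 1\<^sub>m n" "g' * g = 1\<^sub>m n"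
  shows "positive_definite n (mat_adjoint g * H * g)"
    and "mat_inv (mat_adjoint g * H * g) = g' * mat_inv H * mat_adjoint g'"
proof -
  note Hc = positive_definite_carrier[OF H] and Hi = positive_definite_inverse[OF H]
  note [simp] = Hc Hi(1) g
  show pd: "positive_definite n (mat_adjoint g * H * g)"
    by (rule positive_definite_congruence[OF H g inv(2)])
  note assoc = assoc_mult_mat[of _ n n _ n _ n]
  have adj: "mat_adjoint g * mat_adjoint g' = 1\<^sub>m n"
    using mat_adjoint_mult[OF g(2,1)] inv by simp
  have "(mat_adjoint g * H * g) * (g' * mat_inv H * mat_adjoint g')
      = mat_adjoint g * (H * (g * (g' * (mat_inv H * mat_adjoint g'))))"
    by (simp add: assoc)
  also have "g * (g' * (mat_inv H * mat_adjoint g')) = mat_inv H * mat_adjoint g'"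
    by (rule mat_cancel_left[OF inv(1)]) simp_all
  also have "H * \<dots> = mat_adjoint g'"
    by (rule mat_cancel_left[OF Hi(2)]) simp_all
  finally have "(mat_adjoint g * H * g) * (g' * mat_inv H * mat_adjoint g') = 1\<^sub>m n"
    using adj by simp
  then show "mat_inv (mat_adjoint g * H * g) = g' * mat_inv H * mat_adjoint g'"
    by (intro inverse_unique[OF positive_definite_carrier[OF pd] positive_definite_inverse(1)[OF pd] _ positive_definite_inverse(3)[OF pd]])
      simp_all
qed

lemma trace_congruence:
  assumes H: "positive_definite n H" and K: "K \<in> carrier_mat n n"
    and g: "g \<in> carrier_mat n n" "g' \<in> carrier_mat n n"
    and inv: "g * g' = 1\<^sub>m n" "g' * g = 1\<^sub>m n"
  shows "mat_trace (mat_inv (mat_adjoint g * H * g) * (mat_adjoint g * K * g)) = mat_trace (mat_inv H * K)"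
proof -
  note Hi = positive_definite_inverse[OF H]
  note [simp] = Hi(1) g K
  note assoc = assoc_mult_mat[of _ n n _ n _ n]
  have adj: "mat_adjoint g' * mat_adjoint g = 1\<^sub>m n"
    using mat_adjoint_mult[OF g] inv by simp
  have "mat_inv (mat_adjoint g * H * g) * (mat_adjoint g * K * g)
      = g' * (mat_inv H * (mat_adjoint g' * (mat_adjoint g * (K * g))))"
    unfolding mat_inv_congruence(2)[OF H g inv] by (simp add: assoc)
  also have "mat_adjoint g' * (mat_adjoint g * (K * g)) = K * g"
    by (rule mat_cancel_left[OF adj]) simp_all
  also have "mat_trace (g' * (mat_inv H * (K * g))) = mat_trace (mat_inv H * (K * g) * g')"
    by (rule mat_trace_mult_commute[of _ n]) simp_all
  also have "mat_inv H * (K * g) * g' = mat_inv H * K"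
    using inv right_mult_one_mat[OF K] by (simp add: assoc)
  finally show ?thesis .
qed

lemma mat_wirtinger_sandwich:
  assumes W: "open W" "w \<in> W" and F: "\<And>x. x \<in> W \<Longrightarrow> F x \<in> carrier_mat n n" "mat_differentiable n F w"
    and LR: "L \<in> carrier_mat n n" "R \<in> carrier_mat n n"
  shows "mat_differentiable n (\<lambda>x. L * F x * R) w" "mat_wirtinger e n (\<lambda>x. L * F x * R) w = L * mat_wirtinger e n F w * R"
proof -
  have Lc: "L * F x \<in> carrier_mat n n" if "x \<in> W" for x using LR F(1)[OF that] by simp
  note 1 = mat_wirtinger_mult[OF W LR(1) mat_differentiable_const F]
  note 2 = mat_wirtinger_mult[OF W Lc 1(1) LR(2) mat_differentiable_const]
  show "mat_differentiable n (\<lambda>x. L * F x * R) w" using 2(1) .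
  have "mat_wirtinger e n (\<lambda>x. L * F x * R) w = (0\<^sub>m n n * F w + L * mat_wirtinger e n F w) * R + L * F w * 0\<^sub>m n n"
    using 1(2)[of e] 2(2)[of e] by (simp add: mat_wirtinger_const)
  also have "\<dots> = L * mat_wirtinger e n F w * R"
    using left_mult_zero_mat[OF F(1)[OF W(2)]] right_mult_zero_mat[OF Lc[OF W(2)]] LR
    by simp
  finally show "mat_wirtinger e n (\<lambda>x. L * F x * R) w = L * mat_wirtinger e n F w * R" .
qed

text \<open>
  If \<open>D\<close> is a constant unitary matrix that commutes with \<open>\<phi>\<close> up to a phase, then pulling \<open>H\<close> back
  by \<open>D\<close> gives a metric whose curvature and whose \<open>[\<phi>, \<phi>\<^sup>*]\<close> are both conjugated by \<open>D\<close>: the phases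
  of \<open>\<phi>\<close> and \<open>\<phi>\<^sup>*\<close> cancel in the commutator.
\<close>

lemma rotated_local_hitchin:
  assumes H: "local_hitchin n W \<Phi> H"
    and D: "D \<in> carrier_mat n n" "mat_adjoint D * D = 1\<^sub>m n" "D * mat_adjoint D = 1\<^sub>m n"
    and c: "c * cnj c = 1" and com: "\<And>w. w \<in> W \<Longrightarrow> D * \<Phi> w = c \<cdot>\<^sub>m (\<Phi> w * D)"
  defines "K \<equiv> \<lambda>w. mat_adjoint D * H w * D"
  shows "local_hitchin n W \<Phi> K"
    and "w \<in> W \<Longrightarrow> chern_connection_form n K w = mat_adjoint D * chern_connection_form n H w * D"
    and "w \<in> W \<Longrightarrow> higgs_adjoint (K w) (\<Phi> w) = cnj c \<cdot>\<^sub>m (mat_adjoint D * higgs_adjoint (H w) (\<Phi> w) * D)"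
proof -
  note LH = local_hitchinD[OF H]
  note Hc = positive_definite_carrier[OF LH(2)]
  let ?E = "mat_adjoint D"
  have E: "?E \<in> carrier_mat n n" using D(1) by simp
  note assoc = assoc_mult_mat[of _ n n _ n _ n]
  have Kpd: "positive_definite n (K w)" and Kinv: "mat_inv (K w) = ?E * mat_inv (H w) * D" if "w \<in> W" for w
    using mat_inv_congruence[OF LH(2)[OF that] D(1) E D(3,2)] by (simp_all add: K_def)
  have DE: "D * (?E * X) = X" if "X \<in> carrier_mat n n" for X
    using assoc_mult_mat[OF D(1) E that] D(3) that by simp
  have Kd: "mat_differentiable n K w" and Kz: "mat_d_z n K w = ?E * mat_d_z n H w * D" if "w \<in> W" for w
    unfolding K_def mat_d_z_eq_wirtinger
    using mat_wirtinger_sandwich[OF LH(1) that Hc LH(4)[OF that] E D(1)] by auto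
  have Kzd: "mat_differentiable n (mat_d_z n K) w" if "w \<in> W" for w
    by (rule mat_wirtinger_cong(2)[OF LH(1) that _ mat_wirtinger_sandwich(1)[OF LH(1) that _ LH(5)[OF that] E D(1)]])
      (simp_all add: Kz)
  have chern: "chern_connection_form n K w = ?E * chern_connection_form n H w * D" if w: "w \<in> W" for w
  proof -
    note [simp] = D(1) E Hc[OF w] positive_definite_inverse(1)[OF LH(2)[OF w]]
    have "chern_connection_form n K w = ?E * (mat_inv (H w) * (D * (?E * (mat_d_z n H w * D))))"
      unfolding chern_connection_form_def Kinv[OF w] Kz[OF w] by (simp add: assoc)
    then show ?thesis by (simp add: DE assoc chern_connection_form_def)
  qed
  have higgs: "higgs_adjoint (K w) (\<Phi> w) = cnj c \<cdot>\<^sub>m (?E * higgs_adjoint (H w) (\<Phi> w) * D)"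
    and PhiE: "\<Phi> w * ?E = c \<cdot>\<^sub>m (?E * \<Phi> w)" if w: "w \<in> W" for w
  proof -
    note [simp] = D(1) E Hc[OF w] positive_definite_inverse(1)[OF LH(2)[OF w]] LH(3)[OF w]
    have adj_com: "mat_adjoint (\<Phi> w) * ?E = cnj c \<cdot>\<^sub>m (?E * mat_adjoint (\<Phi> w))"
    proof -
      have "mat_adjoint (\<Phi> w) * ?E = mat_adjoint (D * \<Phi> w)" by (simp add: mat_adjoint_mult[of _ n])
      also have "\<dots> = cnj c \<cdot>\<^sub>m mat_adjoint (\<Phi> w * D)"
        unfolding com[OF w] using carrier_matD[OF LH(3)[OF w]] carrier_matD[OF D(1)]
        by (intro eq_matI) (auto simp: mat_adjoint_index)
      also have "mat_adjoint (\<Phi> w * D) = ?E * mat_adjoint (\<Phi> w)" by (simp add: mat_adjoint_mult[of _ n])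
      finally show ?thesis .
    qed
    have "higgs_adjoint (K w) (\<Phi> w) = ?E * (mat_inv (H w) * (D * ((mat_adjoint (\<Phi> w) * ?E) * (H w * D))))"
      unfolding higgs_adjoint_def Kinv[OF w] unfolding K_def by (simp add: assoc)
    also have "(mat_adjoint (\<Phi> w) * ?E) * (H w * D) = cnj c \<cdot>\<^sub>m (?E * (mat_adjoint (\<Phi> w) * (H w * D)))"
      unfolding adj_com by (simp add: mult_smult_assoc_mat[of _ n n _ n] assoc)
    also have "?E * (mat_inv (H w) * (D * \<dots>)) = cnj c \<cdot>\<^sub>m (?E * (mat_inv (H w) * (D * (?E * (mat_adjoint (\<Phi> w) * (H w * D))))))"
      by (simp add: mult_smult_distrib[of _ n n _ n])
    also have "D * (?E * (mat_adjoint (\<Phi> w) * (H w * D))) = mat_adjoint (\<Phi> w) * (H w * D)"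
      by (rule DE) simp
    finally show "higgs_adjoint (K w) (\<Phi> w) = cnj c \<cdot>\<^sub>m (?E * higgs_adjoint (H w) (\<Phi> w) * D)"
      by (simp add: higgs_adjoint_def assoc)
    have "\<Phi> w * ?E = ?E * (D * \<Phi> w) * ?E"
      using assoc_mult_mat[OF E D(1) LH(3)[OF w]] left_mult_one_mat[OF LH(3)[OF w]]
      unfolding D(2) by argo
    also have "\<dots> = c \<cdot>\<^sub>m (?E * (\<Phi> w * (D * ?E)))"
      unfolding com[OF w] by (simp add: mult_smult_assoc_mat[of _ n n _ n] mult_smult_distrib[of _ n n _ n] assoc)
    finally show "\<Phi> w * ?E = c \<cdot>\<^sub>m (?E * \<Phi> w)"
      using D(3) right_mult_one_mat[OF LH(3)[OF w]] by simp
  qed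
  have eq: "mat_d_zbar n (chern_connection_form n K) w =
      \<Phi> w * higgs_adjoint (K w) (\<Phi> w) - higgs_adjoint (K w) (\<Phi> w) * \<Phi> w" if w: "w \<in> W" for w
  proof -
    define P where "P = higgs_adjoint (H w) (\<Phi> w)"
    have Pc: "P \<in> carrier_mat n n" unfolding P_def by (rule higgs_adjoint_carrier[OF LH(2)[OF w] LH(3)[OF w]])
    note [simp] = D(1) E Hc[OF w] positive_definite_inverse(1)[OF LH(2)[OF w]] LH(3)[OF w] Pc
    have "mat_d_zbar n (chern_connection_form n K) w = mat_d_zbar n (\<lambda>w. ?E * chern_connection_form n H w * D) w"
      unfolding mat_d_zbar_eq_wirtinger by (rule mat_wirtinger_cong(1)[OF LH(1) w chern])
    also have "\<dots> = ?E * mat_d_zbar n (chern_connection_form n H) w * D"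
      unfolding mat_d_zbar_eq_wirtinger
      by (rule mat_wirtinger_sandwich(2)[OF LH(1) w chern_connection_form_carrier[where H = H, OF LH(2)]
            chern_connection_form_differentiable[OF H w] E D(1)])
    also have "\<dots> = ?E * (\<Phi> w * P - P * \<Phi> w) * D" unfolding LH(6)[OF w] P_def ..
    also have "\<dots> = ?E * (\<Phi> w * (P * D)) - ?E * (P * (\<Phi> w * D))"
      by (simp add: mult_minus_distrib_mat[of _ n n _ n] minus_mult_distrib_mat[of _ n n _ _ n] assoc)
    also have "?E * (\<Phi> w * (P * D)) = \<Phi> w * (cnj c \<cdot>\<^sub>m (?E * P * D))"
    proof -
      have "\<Phi> w * (cnj c \<cdot>\<^sub>m (?E * P * D)) = cnj c \<cdot>\<^sub>m ((\<Phi> w * ?E) * (P * D))"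
        by (simp add: mult_smult_distrib[of _ n n _ n] assoc)
      also have "\<dots> = (c * cnj c) \<cdot>\<^sub>m (?E * (\<Phi> w * (P * D)))"
        unfolding PhiE[OF w] by (simp add: mult_smult_assoc_mat[of _ n n _ n] assoc smult_smult_mat mult.commute)
      finally show ?thesis using c by simp
    qed
    also have "?E * (P * (\<Phi> w * D)) = (cnj c \<cdot>\<^sub>m (?E * P * D)) * \<Phi> w"
    proof -
      have "(cnj c \<cdot>\<^sub>m (?E * P * D)) * \<Phi> w = cnj c \<cdot>\<^sub>m (?E * (P * (D * \<Phi> w)))"
        by (simp add: mult_smult_assoc_mat[of _ n n _ n] assoc)
      also have "\<dots> = (c * cnj c) \<cdot>\<^sub>m (?E * (P * (\<Phi> w * D)))"
        unfolding com[OF w] by (simp add: mult_smult_distrib[of _ n n _ n] smult_smult_mat mult.commute)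
      finally show ?thesis using c by simp
    qed
    finally show ?thesis unfolding higgs[OF w] P_def .
  qed
  show "local_hitchin n W \<Phi> K"
    unfolding local_hitchin_def using LH(1,3) Kpd Kd Kzd eq by auto
  show "w \<in> W \<Longrightarrow> chern_connection_form n K w = mat_adjoint D * chern_connection_form n H w * D"
    by (rule chern)
  show "w \<in> W \<Longrightarrow> higgs_adjoint (K w) (\<Phi> w) = cnj c \<cdot>\<^sub>m (mat_adjoint D * higgs_adjoint (H w) (\<Phi> w) * D)"
    by (rule higgs)
qed

section \<open>Two global solutions have the same connection and adjoint\<close>

lemma laplacian_locally_constant:
  assumes "open W" "w \<in> W" "\<And>x. x \<in> W \<Longrightarrow> u x = M"
  shows "laplacian u w = 0"
proof -
  have "d_z (\<lambda>x. complex_of_real (u x)) x = 0" if "x \<in> W" for x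
    using wirtinger_cong[OF eventually_nhds_in[OF assms(1) that], of "\<lambda>x. complex_of_real (u x)" "\<lambda>x. of_real M"] assms(3)
    by (simp add: d_z_eq_wirtinger)
  then have "d_zbar (d_z (\<lambda>x. complex_of_real (u x))) w = wirtinger \<i> (\<lambda>x. 0) w"
    unfolding d_zbar_eq_wirtinger by (intro wirtinger_cong eventually_nhds_in[OF assms(1,2)])
  then show ?thesis by (simp add: laplacian_def)
qed

text \<open>
  The relative trace does not depend on the frame, so it is a function on the closed surface.  Being
  subharmonic it is constant, and the two squared norms that make up its Laplacian vanish.  The
  metrics themselves may still differ by a parallel automorphism that commutes with \<open>\<phi>\<close>.
\<close>

lemma hitchin_solutions_comparison:
  fixes H K :: "'i \<Rightarrow> 'a \<Rightarrow> complex mat"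
  assumes S: "closed_riemann_surface S"
    and H: "\<And>i. i \<in> charts S \<Longrightarrow> local_hitchin n (chart_image S i) (\<lambda>w. \<Phi> i (chart_inv S i w)) (\<lambda>w. H i (chart_inv S i w))"
    and K: "\<And>i. i \<in> charts S \<Longrightarrow> local_hitchin n (chart_image S i) (\<lambda>w. \<Phi> i (chart_inv S i w)) (\<lambda>w. K i (chart_inv S i w))"
    and trans: "\<And>i j p. i \<in> charts S \<Longrightarrow> j \<in> charts S \<Longrightarrow> p \<in> chart_dom S i \<Longrightarrow> p \<in> chart_dom S j \<Longrightarrow>
      \<exists>g\<in>carrier_mat n n. \<exists>g'\<in>carrier_mat n n. g * g' = 1\<^sub>m n \<and> g' * g = 1\<^sub>m n \<and>
        H j p = mat_adjoint g * H i p * g \<and> K j p = mat_adjoint g * K i p * g"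
    and i: "i \<in> charts S" and w: "w \<in> chart_image S i"
  shows "chern_connection_form n (\<lambda>w. K i (chart_inv S i w)) w = chern_connection_form n (\<lambda>w. H i (chart_inv S i w)) w"
    and "higgs_adjoint (K i (chart_inv S i w)) (\<Phi> i (chart_inv S i w)) =
      higgs_adjoint (H i (chart_inv S i w)) (\<Phi> i (chart_inv S i w))"
proof -
  define u where "u = (\<lambda>i p. Re (mat_trace (mat_inv (H i p) * K i p)))"
  have comp: "u i \<circ> chart_inv S i = (\<lambda>w. Re (mat_trace (mat_inv (H i (chart_inv S i w)) * K i (chart_inv S i w))))" for i
    by (simp add: u_def fun_eq_iff)
  have pd: "positive_definite n (H i p)" "positive_definite n (K i p)" if "i \<in> charts S" "p \<in> chart_dom S i" for i p
    using local_hitchinD(2)[OF H[OF that(1)] coord_in[OF that(2)]] local_hitchinD(2)[OF K[OF that(1)] coord_in[OF that(2)]]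
      chart_inv_coord[OF S that] by simp_all
  have agree: "agree_on_overlaps S u"
    unfolding agree_on_overlaps_def
  proof (intro ballI)
    fix i j p assume ij: "i \<in> charts S" "j \<in> charts S" and p: "p \<in> chart_dom S i \<inter> chart_dom S j"
    then obtain g g' where "g \<in> carrier_mat n n" "g' \<in> carrier_mat n n" "g * g' = 1\<^sub>m n" "g' * g = 1\<^sub>m n"
        "H j p = mat_adjoint g * H i p * g" "K j p = mat_adjoint g * K i p * g"
      using trans[OF ij] by blast
    then show "u i p = u j p"
      using trace_congruence[OF pd(1) positive_definite_carrier[OF pd(2)]] ij p by (simp add: u_def)
  qed
  have tw: "twice_differentiable_on (u i \<circ> chart_inv S i) (chart_image S i)" if "i \<in> charts S" for i
    unfolding comp by (rule trace_laplacian(1)[OF H[OF that] K[OF that]])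
  have lap: "0 \<le> laplacian (u i \<circ> chart_inv S i) w" if "i \<in> charts S" "w \<in> chart_image S i" for i w
    unfolding comp by (rule trace_laplacian_nonneg(1)[OF H[OF that(1)] K[OF that(1)] that(2)])
  obtain i0 p0 where m: "i0 \<in> charts S" "p0 \<in> chart_dom S i0"
    "\<And>j q. j \<in> charts S \<Longrightarrow> q \<in> chart_dom S j \<Longrightarrow> u j q \<le> u i0 p0"
    using maximum_attained[OF S agree twice_differentiable_on_imp_continuous_on[OF tw] i chart_inv_in[OF w]]
    by blast
  have const: "u j q = u i0 p0" if "j \<in> charts S" "q \<in> chart_dom S j" for j q
    by (rule strong_maximum_principle[OF S agree tw, where c = "\<lambda>_ _. 0"])
      (use lap m that in auto)
  have "laplacian (u i \<circ> chart_inv S i) w = 0"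
    by (rule laplacian_locally_constant[OF chart_image_open[OF S i] w, where M = "u i0 p0"])
      (simp add: const[OF i chart_inv_in])
  then show "chern_connection_form n (\<lambda>w. K i (chart_inv S i w)) w = chern_connection_form n (\<lambda>w. H i (chart_inv S i w)) w"
    "higgs_adjoint (K i (chart_inv S i w)) (\<Phi> i (chart_inv S i w)) =
      higgs_adjoint (H i (chart_inv S i w)) (\<Phi> i (chart_inv S i w))"
    using trace_laplacian_nonneg(2,3)[OF H[OF i] K[OF i] w] unfolding comp by blast+
qed

lemma Ck_on_differentiable:
  assumes "Ck_on 2 f W" "open W" "w \<in> W"
  shows "f differentiable (at w)" "d_z f differentiable (at w)"
proof -
  have *: "f differentiable_on W" "partial_x f differentiable_on W" "partial_y f differentiable_on W"
    using assms(1) by (simp_all add: numeral_2_eq_2)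
  then have d: "f differentiable (at w)" "partial_x f differentiable (at w)" "partial_y f differentiable (at w)"
    using assms(2,3) by (simp_all add: differentiable_on_eq_differentiable_at)
  show "f differentiable (at w)" by (fact d)
  have "(\<lambda>x. (1/2) * (partial_x f x - \<i> * partial_y f x)) differentiable (at w)"
    using d by (intro differentiable_mult differentiable_diff differentiable_const)
  moreover have "d_z f = (\<lambda>x. (1/2) * (partial_x f x - \<i> * partial_y f x))"
    by (simp add: fun_eq_iff d_z_def)
  ultimately show "d_z f differentiable (at w)" by simp
qed

lemma harmonic_metric_local_hitchin:
  assumes S: "closed_riemann_surface S" and h: "harmonic_metric S n L \<delta> \<Phi> H"
    and \<Phi>: "\<And>i p. \<Phi> i p \<in> carrier_mat n n" and i: "i \<in> charts S"
  shows "local_hitchin n (chart_image S i) (\<lambda>w. \<Phi> i (chart_inv S i w)) (\<lambda>w. H i (chart_inv S i w))"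
  unfolding local_hitchin_def
proof (intro conjI ballI)
  let ?W = "chart_image S i" and ?H = "\<lambda>w. H i (chart_inv S i w)"
  note W = chart_image_open[OF S i]
  have hm: "hermitian_metric S n L H" and he: "hitchin_equation S n \<Phi> H"
    using h by (simp_all add: harmonic_metric_def)
  note hm' = hm[unfolded hermitian_metric_def]
  fix w assume w: "w \<in> ?W"
  have smooth: "Ck_on 2 (\<lambda>w. ?H w $$ (k, l)) ?W" if "k < n" "l < n" for k l
    using hm'[THEN conjunct2, THEN conjunct1, rule_format, OF i that] unfolding smooth_on_def ..
  show pd: "positive_definite n (?H w)"
    by (rule hm'[THEN conjunct1, rule_format, OF i chart_inv_in[OF w]])
  show "mat_differentiable n ?H w"
    unfolding mat_differentiable_def using Ck_on_differentiable(1)[OF smooth W w] by blast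
  show "mat_differentiable n (mat_d_z n ?H) w"
    unfolding mat_differentiable_def mat_d_z_def using Ck_on_differentiable(2)[OF smooth W w] by simp
  define C where "C = \<Phi> i (chart_inv S i w) * higgs_adjoint (?H w) (\<Phi> i (chart_inv S i w)) -
    higgs_adjoint (?H w) (\<Phi> i (chart_inv S i w)) * \<Phi> i (chart_inv S i w)"
  have Cc: "C \<in> carrier_mat n n"
    unfolding C_def by (intro minus_carrier_mat square_mult_carrier higgs_adjoint_carrier[OF pd] \<Phi>)
  have "- mat_d_zbar n (chern_connection_form n ?H) w + C = 0\<^sub>m n n"
    using he[unfolded hitchin_equation_def chern_curvature_def, rule_format, OF i chart_inv_in[OF w]]
    unfolding coord_chart_inv[OF w] C_def .
  then have "- mat_d_zbar n (chern_connection_form n ?H) w = - C"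
    by (intro mat_eq_uminusI[of _ n]) (use Cc in simp_all)
  then show "mat_d_zbar n (chern_connection_form n ?H) w = C"
    by (metis uminus_uminus_mat)
qed (use \<Phi> chart_image_open[OF S i] in auto)

section \<open>The Toda equations for the diagonal entries\<close>

abbreviation cyc_suc :: "nat \<Rightarrow> nat \<Rightarrow> nat" where
  "cyc_suc n k \<equiv> (k + 1) mod n"

text \<open>
  The summand \<open>n\<close> keeps the subtraction on natural numbers from truncating at \<open>k = 0\<close>.
\<close>

abbreviation cyc_pred :: "nat \<Rightarrow> nat \<Rightarrow> nat" where
  "cyc_pred n k \<equiv> (k + n - 1) mod n"

lemma cyc_suc_pred: "k < n \<Longrightarrow> cyc_suc n (cyc_pred n k) = k"
  by (cases k) (simp_all add: mod_Suc)

lemma cyc_pred_suc: "k < n \<Longrightarrow> cyc_pred n (cyc_suc n k) = k"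
  by (cases "k + 1 = n") auto

lemma cyc_suc_inj: "j < n \<Longrightarrow> k < n \<Longrightarrow> cyc_suc n j = cyc_suc n k \<Longrightarrow> j = k"
  by (metis cyc_pred_suc)

lemma sum_cyc_suc: "(\<Sum>k<n. f (cyc_suc n k)) = (\<Sum>k<n. f k)"
  by (rule sum.reindex_bij_witness[where i = "cyc_pred n" and j = "cyc_suc n"])
    (auto simp del: One_nat_def simp: cyc_suc_pred cyc_pred_suc)

lemma sum_cyc_pred: "(\<Sum>k<n. f (cyc_pred n k)) = (\<Sum>k<n. f k)"
  by (rule sum.reindex_bij_witness[where i = "cyc_suc n" and j = "cyc_pred n"])
    (auto simp del: One_nat_def simp: cyc_suc_pred cyc_pred_suc)

lemma sum_single:
  assumes "finite A" "k \<in> A" "\<And>j. j \<in> A \<Longrightarrow> j \<noteq> k \<Longrightarrow> f j = 0"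
  shows "sum f A = f k"
  using assms by (simp add: sum.remove[of A k])

lemma positive_definite_diagonal:
  assumes A: "positive_definite n A" and k: "k < n"
  shows "A $$ (k, k) = of_real (Re (A $$ (k, k)))" "0 < Re (A $$ (k, k))"
proof -
  note Ac = positive_definite_carrier[OF A]
  have "A $$ (k, k) = cnj (A $$ (k, k))"
    using mat_adjoint_index[of k A k] positive_definite_adjoint[OF A] Ac k by simp
  then show "A $$ (k, k) = of_real (Re (A $$ (k, k)))" by (simp add: complex_eq_iff)
  have "unit_vec n k \<noteq> (0\<^sub>v n :: complex Matrix.vec)" using k by simp
  then have "0 < Re ((A *\<^sub>v unit_vec n k) \<bullet>c unit_vec n k)"
    by (rule A[unfolded positive_definite_def, THEN conjunct2, THEN conjunct2, rule_format, OF unit_vec_carrier])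
  also have "(A *\<^sub>v unit_vec n k) \<bullet>c unit_vec n k = A $$ (k, k)"
  proof -
    let ?u = "unit_vec n k :: complex Matrix.vec"
    have "(A *\<^sub>v ?u) \<bullet>c ?u = (\<Sum>i<n. \<Sum>j<n. cnj (vec_index ?u i) * A $$ (i, j) * vec_index ?u j)"
      by (rule quadratic_form[OF Ac unit_vec_carrier])
    also have "\<dots> = (\<Sum>j<n. cnj (vec_index ?u k) * A $$ (k, j) * vec_index ?u j)"
      by (rule sum_single) (use k in auto)
    also have "\<dots> = cnj (vec_index ?u k) * A $$ (k, k) * vec_index ?u k"
      by (rule sum_single) (use k in auto)
    finally show ?thesis using k by simp
  qed
  finally show "0 < Re (A $$ (k, k))" .
qed

lemma cyclic_higgs_field_index:
  "l < n \<Longrightarrow> k < n \<Longrightarrow> scale_higgs_field t (cyclic_higgs_field n \<gamma>) i p $$ (l, k) =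
     (if l = cyc_suc n k then t * \<gamma> k i p else 0)"
  by (simp add: scale_higgs_field_def cyclic_higgs_field_def)

lemma cyclic_higgs_field_carrier: "scale_higgs_field t (cyclic_higgs_field n \<gamma>) i p \<in> carrier_mat n n"
  by (simp add: scale_higgs_field_def cyclic_higgs_field_def)

lemma primitive_root_of_unity:
  assumes "n > 0"
  defines "\<omega> \<equiv> cis (2 * pi / real n)"
  shows "\<omega> ^ n = 1" "\<omega> * cnj \<omega> = 1" "\<omega> ^ (m mod n) = \<omega> ^ m"
    and "j < n \<Longrightarrow> k < n \<Longrightarrow> \<omega> ^ j = \<omega> ^ k \<Longrightarrow> j = k"
proof -
  have pow: "\<omega> ^ k = cis (2 * pi * real k / real n)" for k
    by (simp add: \<omega>_def Complex.DeMoivre mult_ac)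
  show 1: "\<omega> ^ n = 1" using assms(1) by (simp add: pow)
  show "\<omega> * cnj \<omega> = 1" by (simp add: \<omega>_def cis_cnj cis_mult)
  have "\<omega> ^ m = \<omega> ^ (n * (m div n) + m mod n)" by simp
  also have "\<dots> = \<omega> ^ (m mod n)" unfolding power_add power_mult 1 by simp
  finally show "\<omega> ^ (m mod n) = \<omega> ^ m" ..
  assume "j < n" "k < n" "\<omega> ^ j = \<omega> ^ k"
  then show "j = k"
    using Complex.bij_betw_roots_unity[OF assms(1)] by (auto simp: pow bij_betw_def inj_on_def)
qed

text \<open>
  The matrix \<open>D\<close> with entries \<open>\<omega> ^ k\<close> for a primitive \<open>n\<close>-th root of unity \<open>\<omega>\<close> satisfies
  \<open>D \<phi> = \<omega> \<phi> D\<close>, and this includes the last component of the cycle because \<open>\<omega> ^ n = 1\<close>.  So the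
  rotated metric solves the Hitchin equation as well, and by comparison the connection form commutes with
  \<open>D\<close> and \<open>\<phi>\<^sup>*\<close> commutes with it up to the inverse phase.  As the powers of \<open>\<omega>\<close> are distinct, the
  connection is diagonal and \<open>\<phi>\<^sup>*\<close> lives on the transposed cycle.  The metric itself may
  still have entries off the diagonal.
\<close>

lemma harmonic_metric_diagonal_structure:
  assumes S: "closed_riemann_surface S" and n: "n > 0"
    and L: "\<forall>k<n. line_bundle S (L k)"
    and h: "harmonic_metric S n L \<delta> (scale_higgs_field t (cyclic_higgs_field n \<gamma>)) H"
    and i: "i \<in> charts S" and w: "w \<in> chart_image S i" and kl: "k < n" "l < n"
  shows "k \<noteq> l \<Longrightarrow> chern_connection_form n (\<lambda>w. H i (chart_inv S i w)) w $$ (k, l) = 0"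
    and "l \<noteq> cyc_suc n k \<Longrightarrow> higgs_adjoint (H i (chart_inv S i w))
      (scale_higgs_field t (cyclic_higgs_field n \<gamma>) i (chart_inv S i w)) $$ (k, l) = 0"
proof -
  define \<omega> where "\<omega> = cis (2 * pi / real n)"
  note \<omega> = primitive_root_of_unity[OF n, folded \<omega>_def]
  define \<Phi> where "\<Phi> = scale_higgs_field t (cyclic_higgs_field n \<gamma>)"
  define D where "D = mat_diag n (\<lambda>k. \<omega> ^ k)"
  have Dc: "D \<in> carrier_mat n n" by (simp add: D_def)
  have E: "mat_adjoint D = mat_diag n (\<lambda>k. cnj \<omega> ^ k)"
    by (rule eq_matI) (auto simp: D_def mat_diag_def mat_adjoint_index)
  have pw: "cnj \<omega> ^ k * \<omega> ^ k = 1" "\<omega> ^ k * cnj \<omega> ^ k = 1" for k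
    using \<omega>(2) by (simp_all add: mult.commute flip: power_mult_distrib)
  have unit: "mat_adjoint D * D = 1\<^sub>m n" "D * mat_adjoint D = 1\<^sub>m n"
    unfolding E by (simp_all add: D_def pw)
  have \<Phi>c: "\<Phi> i p \<in> carrier_mat n n" for i p
    unfolding \<Phi>_def by (rule cyclic_higgs_field_carrier)
  have com: "D * \<Phi> i p = \<omega> \<cdot>\<^sub>m (\<Phi> i p * D)" for i p
  proof (rule eq_matI)
    fix a b assume "a < dim_row (\<omega> \<cdot>\<^sub>m (\<Phi> i p * D))" "b < dim_col (\<omega> \<cdot>\<^sub>m (\<Phi> i p * D))"
    then have ab: "a < n" "b < n" using \<Phi>c[of i p] Dc by auto
    have "\<omega> ^ cyc_suc n b = \<omega> * \<omega> ^ b" using \<omega>(3)[of "b + 1"] by simp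
    then show "(D * \<Phi> i p) $$ (a, b) = (\<omega> \<cdot>\<^sub>m (\<Phi> i p * D)) $$ (a, b)"
      using ab \<Phi>c[of i p] Dc unfolding D_def mat_diag_mult_left[OF \<Phi>c] mat_diag_mult_right[OF \<Phi>c]
      by (simp add: \<Phi>_def cyclic_higgs_field_index del: One_nat_def)
  qed (use \<Phi>c[of i p] Dc in auto)
  define K where "K = (\<lambda>i p. mat_adjoint D * H i p * D)"
  have LH: "local_hitchin n (chart_image S i) (\<lambda>w. \<Phi> i (chart_inv S i w)) (\<lambda>w. H i (chart_inv S i w))"
    if "i \<in> charts S" for i
    by (rule harmonic_metric_local_hitchin[OF S h[folded \<Phi>_def] \<Phi>c that])
  note rot = rotated_local_hitchin[OF LH Dc unit \<omega>(2) com]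
  have LK: "local_hitchin n (chart_image S i) (\<lambda>w. \<Phi> i (chart_inv S i w)) (\<lambda>w. K i (chart_inv S i w))"
    if "i \<in> charts S" for i
    using rot(1)[OF that] by (simp add: K_def)
  have trans: "\<exists>g\<in>carrier_mat n n. \<exists>g'\<in>carrier_mat n n. g * g' = 1\<^sub>m n \<and> g' * g = 1\<^sub>m n \<and>
        H j p = mat_adjoint g * H i p * g \<and> K j p = mat_adjoint g * K i p * g"
    if ij: "i \<in> charts S" "j \<in> charts S" and p: "p \<in> chart_dom S i" "p \<in> chart_dom S j" for i j p
  proof (intro bexI conjI)
    let ?g = "mat_diag n (\<lambda>k. L k i j p)" and ?g' = "mat_diag n (\<lambda>k. inverse (L k i j p))"
    have "L k i j p \<noteq> 0" if "k < n" for k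
      using L that ij p unfolding line_bundle_def by blast
    then show "?g * ?g' = 1\<^sub>m n" "?g' * ?g = 1\<^sub>m n"
      by (auto intro!: eq_matI simp: mat_diag_def[of n "\<lambda>i. _ i * _ i"])
    show Hj: "H j p = mat_adjoint ?g * H i p * ?g"
      using h ij p unfolding harmonic_metric_def hermitian_metric_def by blast
    have Hc: "H i p \<in> carrier_mat n n"
      using h ij p unfolding harmonic_metric_def hermitian_metric_def positive_definite_def by blast
    have gD: "?g * D = D * ?g" unfolding D_def by (simp add: mult.commute)
    have Eg: "mat_adjoint D * mat_adjoint ?g = mat_adjoint ?g * mat_adjoint D"
      using arg_cong[OF gD, of mat_adjoint] mat_adjoint_mult[OF Dc mat_diag_dim] mat_adjoint_mult[OF mat_diag_dim Dc]
      by metis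
    note assoc = assoc_mult_mat[of _ n n _ n _ n]
    note [simp] = Hc Dc mat_adjoint_carrier[OF Dc] mat_adjoint_carrier[OF mat_diag_dim]
    have "K j p = (mat_adjoint D * mat_adjoint ?g) * H i p * (?g * D)"
      unfolding K_def Hj by (simp add: assoc)
    also have "\<dots> = mat_adjoint ?g * K i p * ?g"
      unfolding gD Eg K_def by (simp add: assoc)
    finally show "K j p = mat_adjoint ?g * K i p * ?g" .
  qed simp_all
  note comp = hitchin_solutions_comparison[OF S LH LK trans i w]
  let ?H = "\<lambda>w. H i (chart_inv S i w)" and ?\<Phi> = "\<Phi> i (chart_inv S i w)"
  have pd: "positive_definite n (?H w)" by (rule local_hitchinD(2)[OF LH[OF i] w])
  have sandwich: "(mat_adjoint D * A * D) $$ (k, l) = cnj \<omega> ^ k * A $$ (k, l) * \<omega> ^ l"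
    if A: "A \<in> carrier_mat n n" for A
  proof -
    have "mat_adjoint D * A = Matrix.mat n n (\<lambda>(i, j). cnj \<omega> ^ i * A $$ (i, j))"
      unfolding E by (rule mat_diag_mult_left[OF A])
    moreover have "\<dots> * D = Matrix.mat n n (\<lambda>(a, b). \<dots> $$ (a, b) * \<omega> ^ b)"
      unfolding D_def by (rule mat_diag_mult_right) simp
    ultimately show ?thesis using kl by simp
  qed
  have solve: "\<omega> ^ m = \<omega> ^ l" if "cnj \<omega> ^ m * x * \<omega> ^ l = x" "x \<noteq> 0" for m and x :: complex
  proof -
    have "\<omega> ^ m * (cnj \<omega> ^ m * x * \<omega> ^ l) = (\<omega> ^ m * cnj \<omega> ^ m) * (x * \<omega> ^ l)" by simp
    then have "\<omega> ^ m * x = x * \<omega> ^ l" unfolding that(1) pw by simp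
    then show ?thesis using that(2) by simp
  qed
  have Ac: "chern_connection_form n ?H w \<in> carrier_mat n n"
    by (rule chern_connection_form_carrier[where H = ?H, OF pd])
  have "cnj \<omega> ^ k * chern_connection_form n ?H w $$ (k, l) * \<omega> ^ l = chern_connection_form n ?H w $$ (k, l)"
    using comp(1) rot(2)[OF i w] sandwich[OF Ac] by (simp add: K_def)
  then show "k \<noteq> l \<Longrightarrow> chern_connection_form n ?H w $$ (k, l) = 0"
    using solve \<omega>(4)[OF kl] by blast
  define P where "P = higgs_adjoint (?H w) ?\<Phi>"
  have Pc: "P \<in> carrier_mat n n" unfolding P_def by (rule higgs_adjoint_carrier[OF pd \<Phi>c])
  have "cnj \<omega> \<cdot>\<^sub>m (mat_adjoint D * P * D) = P"
    using comp(2) rot(3)[OF i w] by (simp add: K_def P_def)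
  then have "P $$ (k, l) = (cnj \<omega> \<cdot>\<^sub>m (mat_adjoint D * P * D)) $$ (k, l)" by simp
  also have "\<dots> = cnj \<omega> * (mat_adjoint D * P * D) $$ (k, l)"
    using kl Pc Dc mat_adjoint_carrier[OF Dc] by (intro index_smult_mat) auto
  finally have "cnj \<omega> ^ Suc k * P $$ (k, l) * \<omega> ^ l = P $$ (k, l)"
    unfolding sandwich[OF Pc] by (simp add: mult_ac)
  then have "P $$ (k, l) \<noteq> 0 \<Longrightarrow> \<omega> ^ (Suc k mod n) = \<omega> ^ l" using solve \<omega>(3) by metis
  then show "l \<noteq> cyc_suc n k \<Longrightarrow> higgs_adjoint (?H w)
      (scale_higgs_field t (cyclic_higgs_field n \<gamma>) i (chart_inv S i w)) $$ (k, l) = 0"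
    using \<omega>(4)[of "Suc k mod n" l] kl by (fastforce simp: P_def \<Phi>_def)
qed

definition diag_weight :: "('i \<Rightarrow> 'a \<Rightarrow> complex mat) \<Rightarrow> 'i \<Rightarrow> nat \<Rightarrow> 'a \<Rightarrow> real" where
  "diag_weight H i k p = Re (H i p $$ (k, k))"

text \<open>
  The squared norm of the component \<open>t \<gamma>\<^sub>k\<close> of the Higgs field in the diagonal metric whose weights are
  the diagonal entries of \<open>H\<close>.
\<close>

definition component_energy ::
    "nat \<Rightarrow> complex \<Rightarrow> (nat \<Rightarrow> 'i \<Rightarrow> 'a \<Rightarrow> complex) \<Rightarrow> ('i \<Rightarrow> 'a \<Rightarrow> complex mat) \<Rightarrow> 'i \<Rightarrow> nat \<Rightarrow> 'a \<Rightarrow> real"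
  where
  "component_energy n t \<gamma> H i k p =
     (cmod (t * \<gamma> k i p))\<^sup>2 * diag_weight H i (cyc_suc n k) p / diag_weight H i k p"

text \<open>
  Let \<open>h\<^sub>k\<close> be the diagonal entries of \<open>H\<close>.  Since the connection form \<open>A\<close> is diagonal, the diagonal of
  \<open>\<partial>H = H A\<close> says that the entries of \<open>A\<close> are the logarithmic derivatives of the \<open>h\<^sub>k\<close>, exactly as
  for a diagonal metric.  In the same way the identity \<open>H \<phi>\<^sup>* = \<phi>\<^sup>\<dagger> H\<close>, read at the places where
  \<open>\<phi>\<^sup>*\<close> is nonzero, gives \<open>\<phi>\<^sup>*\<close> in terms of the \<open>h\<^sub>k\<close>.  So the diagonal of the Hitchin equation is
  the Toda system for the diagonal entries.
\<close>

lemma toda_equations: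
  assumes S: "closed_riemann_surface S" and n: "n > 0"
    and L: "\<forall>k<n. line_bundle S (L k)"
    and h: "harmonic_metric S n L \<delta> (scale_higgs_field t (cyclic_higgs_field n \<gamma>)) H"
    and i: "i \<in> charts S"
  shows "k < n \<Longrightarrow> p \<in> chart_dom S i \<Longrightarrow> 0 < diag_weight H i k p"
    and "k < n \<Longrightarrow> twice_differentiable_on (\<lambda>w. ln (diag_weight H i k (chart_inv S i w))) (chart_image S i)"
    and "k < n \<Longrightarrow> w \<in> chart_image S i \<Longrightarrow> laplacian (\<lambda>w. ln (diag_weight H i k (chart_inv S i w))) w =
           component_energy n t \<gamma> H i (cyc_pred n k) (chart_inv S i w) - component_energy n t \<gamma> H i k (chart_inv S i w)"
    and "p \<in> chart_dom S i \<Longrightarrow>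
           pullback_metric n (scale_higgs_field t (cyclic_higgs_field n \<gamma>)) H i p = 2 * real n * (\<Sum>k<n. component_energy n t \<gamma> H i k p)"
proof -
  let ?h = "diag_weight H i" and ?f = "component_energy n t \<gamma> H i"
  define \<Phi> where "\<Phi> = scale_higgs_field t (cyclic_higgs_field n \<gamma>)"
  let ?W = "chart_image S i" and ?H = "\<lambda>w. H i (chart_inv S i w)" and ?\<Phi> = "\<lambda>w. \<Phi> i (chart_inv S i w)"
  have \<Phi>c: "\<Phi> i p \<in> carrier_mat n n" for i p
    unfolding \<Phi>_def by (rule cyclic_higgs_field_carrier)
  have \<Phi>_index: "\<Phi> i p $$ (l, k) = (if l = cyc_suc n k then t * \<gamma> k i p else 0)" if "l < n" "k < n" for l k p
    using that unfolding \<Phi>_def by (rule cyclic_higgs_field_index)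
  note LH = local_hitchinD[OF harmonic_metric_local_hitchin[OF S h[folded \<Phi>_def] \<Phi>c i]]
  note diag = harmonic_metric_diagonal_structure[OF S n L h i, folded \<Phi>_def]
  have pd: "positive_definite n (H i p)" if "p \<in> chart_dom S i" for p
    using LH(2)[OF coord_in[OF that]] chart_inv_coord[OF S i that] by simp
  show pos: "0 < ?h k p" if "k < n" "p \<in> chart_dom S i" for k p
    unfolding diag_weight_def by (rule positive_definite_diagonal(2)[OF pd[OF that(2)] that(1)])
  have real: "H i p $$ (k, k) = of_real (?h k p)" if "k < n" "p \<in> chart_dom S i" for k p
    unfolding diag_weight_def by (rule positive_definite_diagonal(1)[OF pd[OF that(2)] that(1)])
  define A where "A = chern_connection_form n ?H"
  define P where "P = (\<lambda>w. higgs_adjoint (?H w) (?\<Phi> w))"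
  have Ac: "A w \<in> carrier_mat n n" if "w \<in> ?W" for w
    unfolding A_def by (rule chern_connection_form_carrier[where H = ?H, OF LH(2)[OF that]])
  have Pc: "P w \<in> carrier_mat n n" if "w \<in> ?W" for w
    unfolding P_def by (rule higgs_adjoint_carrier[OF LH(2)[OF that] \<Phi>c])
  note Hc = positive_definite_carrier[OF LH(2)]
  have cancel: "?H w * (mat_inv (?H w) * X) = X" if "w \<in> ?W" "X \<in> carrier_mat n n" for w X
    using assoc_mult_mat[OF Hc[OF that(1)] positive_definite_inverse(1)[OF LH(2)[OF that(1)]] that(2)]
      positive_definite_inverse(2)[OF LH(2)[OF that(1)]] that(2) by simp
  have \<eta>z: "d_z (\<lambda>x. ?H x $$ (k, k)) w = ?H w $$ (k, k) * A w $$ (k, k)" if k: "k < n" and w: "w \<in> ?W" for k w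
  proof -
    have "d_z (\<lambda>x. ?H x $$ (k, k)) w = mat_d_z n ?H w $$ (k, k)"
      using k by (simp add: mat_d_z_def)
    also have "mat_d_z n ?H w = ?H w * A w"
      using cancel[OF w, of "mat_d_z n ?H w"] by (simp add: A_def chern_connection_form_def)
    also have "(?H w * A w) $$ (k, k) = (\<Sum>j<n. ?H w $$ (k, j) * A w $$ (j, k))"
      by (rule mat_mult_index[OF Hc[OF w] Ac[OF w] k k])
    also have "\<dots> = ?H w $$ (k, k) * A w $$ (k, k)"
      by (rule sum_single) (use k diag(1)[OF w] in \<open>auto simp: A_def\<close>)
    finally show ?thesis .
  qed
  have \<eta>d: "(\<lambda>x. complex_of_real (?h k (chart_inv S i x))) differentiable (at w)" if k: "k < n" and w: "w \<in> ?W" for k w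
    by (rule differentiable_at_cong[OF LH(1) w, of "\<lambda>x. ?H x $$ (k, k)"])
      (use k LH(4)[OF w] in \<open>simp_all add: mat_differentiable_def real[OF k chart_inv_in]\<close>)
  have lnz: "d_z (\<lambda>x. complex_of_real (ln (?h k (chart_inv S i x)))) w = A w $$ (k, k)" if k: "k < n" and w: "w \<in> ?W" for k w
  proof -
    have "d_z (\<lambda>x. complex_of_real (?h k (chart_inv S i x))) w = d_z (\<lambda>x. ?H x $$ (k, k)) w"
      unfolding d_z_eq_wirtinger
      by (rule wirtinger_cong, rule eventually_nhds_in[OF LH(1) w]) (simp add: real[OF k chart_inv_in])
    then show ?thesis
      using wirtinger_of_real_ln(2)[OF \<eta>d[OF k w] pos[OF k chart_inv_in[OF w]], of "- \<i>"] \<eta>z[OF k w]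
        real[OF k chart_inv_in[OF w]] pos[OF k chart_inv_in[OF w]] by (simp add: d_z_eq_wirtinger)
  qed
  have Ad: "(\<lambda>x. A x $$ (k, k)) differentiable (at w)" if "k < n" "w \<in> ?W" for k w
    using chern_connection_form_differentiable[OF harmonic_metric_local_hitchin[OF S h[folded \<Phi>_def] \<Phi>c i] that(2)] that(1)
    by (simp add: A_def mat_differentiable_def)
  show "twice_differentiable_on (\<lambda>w. ln (?h k (chart_inv S i w))) ?W" if k: "k < n" for k
    unfolding twice_differentiable_on_def
  proof (intro ballI conjI)
    fix w assume w: "w \<in> ?W"
    show "(\<lambda>x. complex_of_real (ln (?h k (chart_inv S i x)))) differentiable at w"
      by (rule wirtinger_of_real_ln(1)[OF \<eta>d[OF k w] pos[OF k chart_inv_in[OF w]]])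
    show "d_z (\<lambda>x. complex_of_real (ln (?h k (chart_inv S i x)))) differentiable at w"
      by (rule differentiable_at_cong[OF LH(1) w _ Ad[OF k w]]) (simp add: lnz[OF k])
  qed
  (* compare the entries (k, k + 1) of H P and of the adjoint of the Higgs field times H *)
  have P_index: "P w $$ (k, cyc_suc n k) = cnj (t * \<gamma> k i (chart_inv S i w)) *
      of_real (?h (cyc_suc n k) (chart_inv S i w) / ?h k (chart_inv S i w))"
    if k: "k < n" and w: "w \<in> ?W" for k w
  proof -
    let ?s = "cyc_suc n k"
    have s: "?s < n" using k by simp
    have "?H w * P w = mat_adjoint (?\<Phi> w) * ?H w"
      unfolding P_def higgs_adjoint_def
      using cancel[OF w, of "mat_adjoint (?\<Phi> w) * ?H w"] \<Phi>c Hc[OF w]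
        assoc_mult_mat[OF positive_definite_inverse(1)[OF LH(2)[OF w]] mat_adjoint_carrier[OF \<Phi>c] Hc[OF w]]
      by simp
    then have "(?H w * P w) $$ (k, ?s) = (mat_adjoint (?\<Phi> w) * ?H w) $$ (k, ?s)" by simp
    also have "(?H w * P w) $$ (k, ?s) = (\<Sum>j<n. ?H w $$ (k, j) * P w $$ (j, ?s))"
      by (rule mat_mult_index[OF Hc[OF w] Pc[OF w] k s])
    also have "\<dots> = ?H w $$ (k, k) * P w $$ (k, ?s)"
    proof (rule sum_single)
      fix j assume "j \<in> {..<n}" "j \<noteq> k"
      then have "j < n" "?s \<noteq> cyc_suc n j" using cyc_suc_inj[of j n k] k by auto
      then show "?H w $$ (k, j) * P w $$ (j, ?s) = 0"
        using diag(2)[OF w _ s] by (simp add: P_def)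
    qed (use k in auto)
    also have "(mat_adjoint (?\<Phi> w) * ?H w) $$ (k, ?s) = (\<Sum>j<n. mat_adjoint (?\<Phi> w) $$ (k, j) * ?H w $$ (j, ?s))"
      by (rule mat_mult_index[OF mat_adjoint_carrier[OF \<Phi>c] Hc[OF w] k s])
    also have "\<dots> = (\<Sum>j<n. cnj (?\<Phi> w $$ (j, k)) * ?H w $$ (j, ?s))"
      using \<Phi>c[of i "chart_inv S i w"] k by (intro sum.cong) (auto simp: mat_adjoint_index)
    also have "\<dots> = cnj (?\<Phi> w $$ (?s, k)) * ?H w $$ (?s, ?s)"
      by (rule sum_single) (use s k \<Phi>_index in auto)
    finally show ?thesis
      using real[OF k chart_inv_in[OF w]] real[OF s chart_inv_in[OF w]] pos[OF k chart_inv_in[OF w]] s k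
      by (simp add: \<Phi>_index field_simps)
  qed
  have f_eq: "?\<Phi> w $$ (cyc_suc n k, k) * P w $$ (k, cyc_suc n k) = of_real (?f k (chart_inv S i w))"
    if k: "k < n" and w: "w \<in> ?W" for k w
  proof -
    let ?x = "t * \<gamma> k i (chart_inv S i w)"
    have s: "cyc_suc n k < n" using k by simp
    let ?r = "?h (cyc_suc n k) (chart_inv S i w) / ?h k (chart_inv S i w)"
    have "?\<Phi> w $$ (cyc_suc n k, k) * P w $$ (k, cyc_suc n k) = ?x * cnj ?x * of_real ?r"
      unfolding P_index[OF k w] using \<Phi>_index[OF s k] by simp
    also have "\<dots> = of_real ((cmod ?x)\<^sup>2 * ?r)"
      unfolding complex_norm_square[symmetric] by (simp only: of_real_mult)
    finally show ?thesis by (simp only: component_energy_def diag_weight_def times_divide_eq_right)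
  qed
  have \<Phi>P: "(?\<Phi> w * P w) $$ (k, k) = of_real (?f (cyc_pred n k) (chart_inv S i w))"
    and P\<Phi>: "(P w * ?\<Phi> w) $$ (k, k) = of_real (?f k (chart_inv S i w))"
    if k: "k < n" and w: "w \<in> ?W" for k w
  proof -
    let ?p = "cyc_pred n k" and ?s = "cyc_suc n k"
    have ps: "?p < n" "?s < n" using k by auto
    have "(?\<Phi> w * P w) $$ (k, k) = (\<Sum>j<n. ?\<Phi> w $$ (k, j) * P w $$ (j, k))"
      by (rule mat_mult_index[OF \<Phi>c Pc[OF w] k k])
    also have "\<dots> = ?\<Phi> w $$ (k, ?p) * P w $$ (?p, k)"
    proof (rule sum_single)
      fix j assume "j \<in> {..<n}" "j \<noteq> ?p"
      then have "j < n" "k \<noteq> cyc_suc n j" using cyc_pred_suc[of j n] by auto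
      then show "?\<Phi> w $$ (k, j) * P w $$ (j, k) = 0" using k by (simp add: \<Phi>_index)
    qed (use ps in auto)
    finally show "(?\<Phi> w * P w) $$ (k, k) = of_real (?f (cyc_pred n k) (chart_inv S i w))"
      using f_eq[OF ps(1) w] cyc_suc_pred[OF k] by simp
    have "(P w * ?\<Phi> w) $$ (k, k) = (\<Sum>j<n. P w $$ (k, j) * ?\<Phi> w $$ (j, k))"
      by (rule mat_mult_index[OF Pc[OF w] \<Phi>c k k])
    also have "\<dots> = P w $$ (k, ?s) * ?\<Phi> w $$ (?s, k)"
      by (rule sum_single) (use ps k in \<open>auto simp: \<Phi>_index\<close>)
    finally show "(P w * ?\<Phi> w) $$ (k, k) = of_real (?f k (chart_inv S i w))"
      using f_eq[OF k w] by (simp add: mult.commute)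
  qed
  show "laplacian (\<lambda>w. ln (?h k (chart_inv S i w))) w =
           ?f (cyc_pred n k) (chart_inv S i w) - ?f k (chart_inv S i w)" if k: "k < n" and w: "w \<in> ?W" for k w
  proof -
    have "d_zbar (d_z (\<lambda>x. complex_of_real (ln (?h k (chart_inv S i x))))) w = d_zbar (\<lambda>x. A x $$ (k, k)) w"
      unfolding d_zbar_eq_wirtinger by (rule wirtinger_cong, rule eventually_nhds_in[OF LH(1) w]) (rule lnz[OF k])
    also have "\<dots> = mat_d_zbar n A w $$ (k, k)"
      using k by (simp add: mat_d_zbar_def)
    also have "mat_d_zbar n A w = ?\<Phi> w * P w - P w * ?\<Phi> w"
      unfolding A_def P_def by (rule LH(6)[OF w])
    also have "\<dots> $$ (k, k) = (?\<Phi> w * P w) $$ (k, k) - (P w * ?\<Phi> w) $$ (k, k)"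
      by (rule index_minus_mat) (use k Pc[OF w] \<Phi>c[of i "chart_inv S i w"] in auto)
    finally show ?thesis
      unfolding laplacian_def \<Phi>P[OF k w] P\<Phi>[OF k w] by simp
  qed
  show "pullback_metric n (scale_higgs_field t (cyclic_higgs_field n \<gamma>)) H i p = 2 * real n * (\<Sum>k<n. ?f k p)"
    if p: "p \<in> chart_dom S i"
  proof -
    define w where "w = coord S i p"
    have w: "w \<in> ?W" "chart_inv S i w = p"
      using coord_in[OF p] chart_inv_coord[OF S i p] by (simp_all add: w_def)
    have "mat_trace (?\<Phi> w * P w) = (\<Sum>k<n. of_real (?f (cyc_pred n k) p))"
      using \<Phi>P[OF _ w(1)] \<Phi>c[of i p] w(2) by (simp add: mat_trace_def del: index_mult_mat(1))
    also have "\<dots> = of_real (\<Sum>k<n. ?f k p)"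
      using sum_cyc_pred[of "\<lambda>k. ?f k p" n] by (simp flip: of_real_sum)
    finally show ?thesis
      unfolding pullback_metric_def \<Phi>_def[symmetric] using w(2) by (simp add: P_def)
  qed
qed

section \<open>A maximum principle for the cyclic system\<close>

text \<open>
  One term of the Laplacian of \<open>u = - (\<Sum>k\<in>N. v k)\<close> after summation by parts; \<open>P\<close> says whether the
  index belongs to \<open>N\<close>, \<open>x\<close> counts its neighbours in \<open>N\<close>, and \<open>d\<close> is the distance of \<open>u\<close> to its
  supremum.  If \<open>v\<close> had the sign expected from \<open>P\<close>, the term would be nonnegative; \<open>d\<close> bounds the
  deviation from this sign, and the term is bounded below in proportion to \<open>d\<close>.
\<close>

lemma toda_term_bound:
  fixes b v d x :: real
  assumes b: "b \<ge> 0" and d: "d \<ge> 0" and x: "0 \<le> x" "x \<le> 2"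
    and in_N: "P \<Longrightarrow> v \<le> d" and not_in_N: "\<not> P \<Longrightarrow> - v \<le> d"
  shows "- 2 * (b * exp v + b) * d \<le> b * (exp v - 1) * (x - (if P then 2 else 0))"
proof (cases P)
  case True
  have "1 - v \<le> exp (- v)" using exp_ge_add_one_self[of "- v"] by simp
  then have "exp v * (1 - v) \<le> exp v * exp (- v)" by (intro mult_left_mono) auto
  then have "exp v - 1 \<le> exp v * v" by (simp add: algebra_simps flip: exp_add)
  also have "\<dots> \<le> exp v * d" using in_N[OF True] by (intro mult_left_mono) auto
  finally have F: "b * (exp v - 1) \<le> b * (exp v * d)" using b by (rule mult_left_mono)
  have bd: "0 \<le> b * d" "0 \<le> b * (exp v * d)" using b d by auto
  have "- 2 * (b * (exp v * d)) \<le> b * (exp v - 1) * (x - 2)"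
  proof (cases "b * (exp v - 1) \<le> 0")
    case True
    then have "0 \<le> b * (exp v - 1) * (x - 2)" using x by (intro mult_nonpos_nonpos) auto
    then show ?thesis using bd by linarith
  next
    case False
    then have "b * (exp v - 1) * (- 2) \<le> b * (exp v - 1) * (x - 2)"
      using x by (intro mult_left_mono) auto
    then show ?thesis using F by linarith
  qed
  then show ?thesis using True bd by (simp add: algebra_simps)
next
  case False
  have "b * (- d) \<le> b * (exp v - 1)"
    using not_in_N[OF False] exp_ge_add_one_self[of v] b by (intro mult_left_mono) linarith+
  moreover have bd: "0 \<le> b * d" "0 \<le> b * (exp v * d)" using b d by auto
  moreover have "- 2 * (b * d) \<le> b * (exp v - 1) * x"
  proof (cases "b * (exp v - 1) \<ge> 0")
    case True
    then have "0 \<le> b * (exp v - 1) * x" using x by simp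
    then show ?thesis using bd by linarith
  next
    case False
    then have "b * (exp v - 1) * 2 \<le> b * (exp v - 1) * x"
      using x by (intro mult_left_mono_neg) auto
    then show ?thesis using calculation by linarith
  qed
  ultimately show ?thesis using False by (simp add: algebra_simps)
qed

text \<open>
  In the sum on the right the coefficient of \<open>F k\<close> is nonpositive for \<open>k\<close> in \<open>N\<close> and nonnegative
  outside, because each column of the cyclic Cartan matrix has sum zero and its only positive entry on
  the diagonal.
\<close>

lemma cyclic_summation_by_parts:
  fixes F :: "nat \<Rightarrow> real"
  assumes N: "N \<subseteq> {..<n}"
  shows "(\<Sum>k\<in>N. 2 * F k - F (cyc_suc n k) - F (cyc_pred n k)) =
    - (\<Sum>k<n. F k * ((of_bool (cyc_suc n k \<in> N) + of_bool (cyc_pred n k \<in> N)) - (if k \<in> N then 2 else 0)))"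
proof -
  define ind :: "nat \<Rightarrow> real" where "ind = (\<lambda>k. of_bool (k \<in> N))"
  have "(\<Sum>k\<in>N. 2 * F k - F (cyc_suc n k) - F (cyc_pred n k)) =
      (\<Sum>k<n. ind k * (2 * F k - F (cyc_suc n k) - F (cyc_pred n k)))"
    using N by (intro sum.mono_neutral_cong_left) (auto simp: ind_def)
  also have "\<dots> = (\<Sum>k<n. 2 * ind k * F k) - (\<Sum>k<n. ind k * F (cyc_suc n k)) - (\<Sum>k<n. ind k * F (cyc_pred n k))"
    by (simp add: sum_subtractf algebra_simps)
  also have "(\<Sum>k<n. ind k * F (cyc_suc n k)) = (\<Sum>k<n. ind (cyc_pred n k) * F k)"
  proof -
    have "(\<Sum>k<n. ind (cyc_pred n k) * F k) = (\<Sum>k<n. ind (cyc_pred n (cyc_suc n k)) * F (cyc_suc n k))"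
      using sum_cyc_suc[of "\<lambda>k. ind (cyc_pred n k) * F k" n] by simp
    then show ?thesis using cyc_pred_suc by (simp del: One_nat_def)
  qed
  also have "(\<Sum>k<n. ind k * F (cyc_pred n k)) = (\<Sum>k<n. ind (cyc_suc n k) * F k)"
  proof -
    have "(\<Sum>k<n. ind (cyc_suc n k) * F k) = (\<Sum>k<n. ind (cyc_suc n (cyc_pred n k)) * F (cyc_pred n k))"
      using sum_cyc_pred[of "\<lambda>k. ind (cyc_suc n k) * F k" n] by simp
    then show ?thesis using cyc_suc_pred by (simp del: One_nat_def)
  qed
  also have "(\<Sum>k<n. 2 * ind k * F k) - (\<Sum>k<n. ind (cyc_pred n k) * F k) - (\<Sum>k<n. ind (cyc_suc n k) * F k)
    = - (\<Sum>k<n. F k * ((ind (cyc_suc n k) + ind (cyc_pred n k)) - 2 * ind k))"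
    by (simp add: sum_subtractf sum.distrib sum_negf algebra_simps)
  also have "\<dots> = - (\<Sum>k<n. F k * ((of_bool (cyc_suc n k \<in> N) + of_bool (cyc_pred n k \<in> N)) - (if k \<in> N then 2 else 0)))"
    unfolding ind_def by (intro arg_cong[where f = uminus] sum.cong) auto
  finally show ?thesis .
qed

lemma cyclic_boundary:
  assumes "N \<subseteq> {..<n}" "N \<noteq> {}" "N \<noteq> {..<n}"
  obtains j where "j < n" "j \<notin> N" "cyc_pred n j \<in> N"
proof (rule ccontr)
  assume no: "\<not> thesis"
  have step: "cyc_suc n k \<in> N" if "k \<in> N" for k
  proof (rule ccontr)
    have k: "k < n" using that assms(1) by auto
    assume "cyc_suc n k \<notin> N"
    moreover have "cyc_suc n k < n" using k by simp
    moreover have "cyc_pred n (cyc_suc n k) \<in> N" using cyc_pred_suc[OF k] that by simp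
    ultimately show False using that no \<open>\<And>j. j < n \<Longrightarrow> j \<notin> N \<Longrightarrow> cyc_pred n j \<in> N \<Longrightarrow> thesis\<close> by blast
  qed
  obtain k where k: "k \<in> N" "k < n" using assms by auto
  have all: "(k + m) mod n \<in> N" for m
  proof (induction m)
    case (Suc m)
    then show ?case using step[of "(k + m) mod n"] by (simp add: mod_Suc_eq)
  qed (use k in simp)
  have "j \<in> N" if "j < n" for j
    using all[of "j + n - k"] k that by simp
  then show False using assms by auto
qed

text \<open>
  Suppose some \<open>v k\<close> is nonpositive somewhere.  Let \<open>W\<close> be the sum of the negative parts of the \<open>v k\<close>
  and \<open>c0\<close> its maximum; choose a point where \<open>W\<close> is maximal and the set \<open>N\<close> of indices with
  \<open>v k \<le> 0\<close> is not empty.  Then \<open>u = - (\<Sum>k\<in>N. v k)\<close> is a smooth function with \<open>u \<le> W \<le> c0\<close>, with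
  equality at this point.  The gap \<open>c0 - u\<close> controls the positive part of \<open>v k\<close> for \<open>k\<close> in \<open>N\<close> and
  the negative part for the other \<open>k\<close>, so the Laplacian of \<open>u\<close> is bounded below by a multiple of
  \<open>u - c0\<close>, and the strong maximum principle makes \<open>u\<close> constant.

  It follows that \<open>N\<close> is the set of indices with \<open>v k \<le> 0\<close> at every point of the surface, and that all
  terms of the Laplacian of \<open>u\<close> vanish.  As the sum of all \<open>v k\<close> is positive, \<open>N\<close> is a proper
  subset of the cycle, so there is an index \<open>j\<close> outside \<open>N\<close> whose predecessor lies in \<open>N\<close>.  Its term is a
  positive multiple of \<open>b j * (exp (v j) - 1)\<close> with \<open>v j > 0\<close>; hence \<open>b j\<close> vanishes identically, a
  contradiction.
\<close>

lemma cyclic_comparison: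
  fixes v b :: "nat \<Rightarrow> 'i \<Rightarrow> 'a \<Rightarrow> real" and S :: "('a, 'i) surface"
  assumes S: "closed_riemann_surface S"
    and agree: "\<And>k. k < n \<Longrightarrow> agree_on_overlaps S (v k)"
    and tw: "\<And>k i. k < n \<Longrightarrow> i \<in> charts S \<Longrightarrow>
      twice_differentiable_on (v k i \<circ> chart_inv S i) (chart_image S i)"
    and b: "\<And>k i p. k < n \<Longrightarrow> i \<in> charts S \<Longrightarrow> p \<in> chart_dom S i \<Longrightarrow> b k i p \<ge> 0"
    and cont_b: "\<And>k i. k < n \<Longrightarrow> i \<in> charts S \<Longrightarrow> continuous_on (chart_image S i) (b k i \<circ> chart_inv S i)"
    and lap: "\<And>k i w. k < n \<Longrightarrow> i \<in> charts S \<Longrightarrow> w \<in> chart_image S i \<Longrightarrow>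
      laplacian (v k i \<circ> chart_inv S i) w =
        (let F = \<lambda>k. b k i (chart_inv S i w) * (exp (v k i (chart_inv S i w)) - 1)
         in 2 * F k - F (cyc_suc n k) - F (cyc_pred n k))"
    and pos: "\<And>i p. i \<in> charts S \<Longrightarrow> p \<in> chart_dom S i \<Longrightarrow> 0 < (\<Sum>k<n. v k i p)"
    and nz: "\<And>k. k < n \<Longrightarrow> \<exists>i\<in>charts S. \<exists>p\<in>chart_dom S i. b k i p \<noteq> 0"
    and k: "k < n" and i: "i \<in> charts S" and p: "p \<in> chart_dom S i"
  shows "0 < v k i p"
proof (rule ccontr)
  assume "\<not> 0 < v k i p"
  then have vk: "v k i p \<le> 0" by simp
  define m where "m = (\<lambda>k i p. max 0 (- v k i p))"
  define W where "W = (\<lambda>i p. \<Sum>k<n. m k i p)"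
  define F where "F = (\<lambda>k i p. b k i p * (exp (v k i p) - 1))"
  define N where "N = (\<lambda>i p. {k. k < n \<and> v k i p \<le> 0})"
  define u where "u = (\<lambda>N i p. \<Sum>k\<in>N. - 1 * v k i p)"
  have cont_v: "continuous_on (chart_image S i) (\<lambda>w. v k i (chart_inv S i w))" if "k < n" "i \<in> charts S" for k i
    using twice_differentiable_on_imp_continuous_on[OF tw[OF that]] by (simp add: o_def)
  have contW: "continuous_on (chart_image S i) (W i \<circ> chart_inv S i)" if "i \<in> charts S" for i
    unfolding W_def m_def o_def using cont_v that by (intro continuous_intros) auto
  have agreeW: "agree_on_overlaps S W"
    unfolding agree_on_overlaps_def W_def m_def
  proof (intro ballI sum.cong refl)
    fix i j p k assume "i \<in> charts S" "j \<in> charts S" "p \<in> chart_dom S i \<inter> chart_dom S j" "k \<in> {..<n}"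
    then have "v k i p = v k j p" using agree_on_overlapsD[OF agree] by blast
    then show "max 0 (- v k i p) = max 0 (- v k j p)" by simp
  qed
  obtain ia pa where a: "ia \<in> charts S" "pa \<in> chart_dom S ia"
    "\<And>j q. j \<in> charts S \<Longrightarrow> q \<in> chart_dom S j \<Longrightarrow> W j q \<le> W ia pa"
    using maximum_attained[OF S agreeW contW i p] by blast
  define c0 where "c0 = W ia pa"
  have m0: "0 \<le> m k i p" "0 \<le> m k i p + v k i p" "- v k i p \<le> m k i p" for k i p by (auto simp: m_def)
  have W0: "0 \<le> W i p" for i p unfolding W_def by (intro sum_nonneg m0)
  have Wc0: "W j q \<le> c0" if "j \<in> charts S" "q \<in> chart_dom S j" for j q
    using a(3)[OF that] by (simp add: c0_def)
  have u_comp: "u N j \<circ> chart_inv S j = (\<lambda>w. \<Sum>k\<in>N. - 1 * (v k j \<circ> chart_inv S j) w)" for N j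
    by (simp add: u_def fun_eq_iff)
  have gap_sum: "(\<Sum>k\<in>N. m k j q + v k j q) + (\<Sum>k\<in>{..<n} - N. m k j q) \<le> c0 - u N j q"
    if N: "N \<subseteq> {..<n}" and jq: "j \<in> charts S" "q \<in> chart_dom S j" for N j q
  proof -
    have "W j q = (\<Sum>k\<in>{..<n} - N. m k j q) + (\<Sum>k\<in>N. m k j q)"
      unfolding W_def by (rule sum.subset_diff[OF N]) simp
    then show ?thesis using Wc0[OF jq] by (simp add: u_def sum.distrib sum_negf)
  qed
  have gap: "0 \<le> c0 - u N j q"
    and gap_in: "\<And>k. k \<in> N \<Longrightarrow> v k j q \<le> c0 - u N j q"
    and gap_out: "\<And>k. k < n \<Longrightarrow> k \<notin> N \<Longrightarrow> - v k j q \<le> c0 - u N j q"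
    if N: "N \<subseteq> {..<n}" and jq: "j \<in> charts S" "q \<in> chart_dom S j" for N j q
  proof -
    have s: "0 \<le> (\<Sum>k\<in>N. m k j q + v k j q)" "0 \<le> (\<Sum>k\<in>{..<n} - N. m k j q)"
      by (intro sum_nonneg m0)+
    then show "0 \<le> c0 - u N j q" using gap_sum[OF that] by linarith
    have fin: "finite N" using N finite_subset by blast
    show "v k j q \<le> c0 - u N j q" if k: "k \<in> N" for k
    proof -
      have "m k j q + v k j q \<le> (\<Sum>k\<in>N. m k j q + v k j q)"
        by (rule member_le_sum[OF k]) (use m0 fin in auto)
      then show ?thesis using s gap_sum[OF N jq] m0(1)[of k j q] by linarith
    qed
    show "- v k j q \<le> c0 - u N j q" if k: "k < n" "k \<notin> N" for k
    proof -
      have "m k j q \<le> (\<Sum>k\<in>{..<n} - N. m k j q)"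
        by (rule member_le_sum) (use k m0 in auto)
      then show ?thesis using s gap_sum[OF N jq] m0(3)[of k j q] by linarith
    qed
  qed
  define x where "x = (\<lambda>N k. of_bool (cyc_suc n k \<in> N) + of_bool (cyc_pred n k \<in> N) :: real)"
  have x: "0 \<le> x N k" "x N k \<le> 2" for N k by (auto simp: x_def)
  have term_le: "- 2 * (b k j q * exp (v k j q) + b k j q) * (c0 - u N j q) \<le> F k j q * (x N k - (if k \<in> N then 2 else 0))"
    if "k < n" "N \<subseteq> {..<n}" "j \<in> charts S" "q \<in> chart_dom S j" for k N j q
    unfolding F_def
    by (rule toda_term_bound[OF b[OF that(1,3,4)] gap[OF that(2-4)] x gap_in[OF that(2-4)] gap_out[OF that(2-4) that(1)]])
  have lap_u: "laplacian (u N j \<circ> chart_inv S j) w =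
      (\<Sum>k<n. F k j (chart_inv S j w) * (x N k - (if k \<in> N then 2 else 0)))"
    and tw_u: "twice_differentiable_on (u N j \<circ> chart_inv S j) (chart_image S j)"
    if N: "N \<subseteq> {..<n}" and j: "j \<in> charts S" and w: "w \<in> chart_image S j" for N j w
  proof -
    note W = chart_image_open[OF S j]
    have tw': "twice_differentiable_on (v k j \<circ> chart_inv S j) (chart_image S j)" if "k \<in> N" for k
      using tw N j that by blast
    show "twice_differentiable_on (u N j \<circ> chart_inv S j) (chart_image S j)"
      unfolding u_comp by (rule twice_differentiable_on_sum(1)[OF W tw'])
    have "laplacian (u N j \<circ> chart_inv S j) w = (\<Sum>k\<in>N. - 1 * laplacian (v k j \<circ> chart_inv S j) w)"
      unfolding u_comp by (rule twice_differentiable_on_sum(2)[OF W tw' w])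
    also have "\<dots> = - (\<Sum>k\<in>N. 2 * F k j (chart_inv S j w) - F (cyc_suc n k) j (chart_inv S j w)
        - F (cyc_pred n k) j (chart_inv S j w))"
      unfolding sum_negf[symmetric] using N by (intro sum.cong refl) (auto simp: lap j w F_def Let_def)
    also have "\<dots> = (\<Sum>k<n. F k j (chart_inv S j w) * (x N k - (if k \<in> N then 2 else 0)))"
      unfolding cyclic_summation_by_parts[OF N, of "\<lambda>k. F k j (chart_inv S j w)"] x_def by simp
    finally show "laplacian (u N j \<circ> chart_inv S j) w =
      (\<Sum>k<n. F k j (chart_inv S j w) * (x N k - (if k \<in> N then 2 else 0)))" .
  qed
  have const: "u (N i p) j q = c0"
    if ip: "i \<in> charts S" "p \<in> chart_dom S i" "W i p = c0" and jq: "j \<in> charts S" "q \<in> chart_dom S j" for i p j q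
  proof (rule strong_maximum_principle[OF S])
    let ?N = "N i p"
    have N: "?N \<subseteq> {..<n}" by (auto simp: N_def)
    let ?c = "\<lambda>j w. \<Sum>k<n. 2 * (b k j (chart_inv S j w) * exp (v k j (chart_inv S j w)) + b k j (chart_inv S j w))"
    show "agree_on_overlaps S (u ?N)"
      unfolding agree_on_overlaps_def u_def
    proof (intro ballI sum.cong refl)
      fix i j p k assume "i \<in> charts S" "j \<in> charts S" "p \<in> chart_dom S i \<inter> chart_dom S j" "k \<in> ?N"
      then have "v k i p = v k j p" using agree_on_overlapsD[OF agree] N by blast
      then show "- 1 * v k i p = - 1 * v k j p" by simp
    qed
    show "twice_differentiable_on (u ?N j \<circ> chart_inv S j) (chart_image S j)" if "j \<in> charts S" for j
      using tw_u[OF N that] by (auto simp: twice_differentiable_on_def)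
    show "continuous_on (chart_image S j) (?c j)" if "j \<in> charts S" for j
      using cont_v cont_b that unfolding o_def by (intro continuous_intros) auto
    show "u ?N j q \<le> c0" if "j \<in> charts S" "q \<in> chart_dom S j" for j q
      using gap[OF N that] by simp
    show "u ?N i p = c0"
    proof -
      have "W i p = (\<Sum>k\<in>?N. - 1 * v k i p)"
        unfolding W_def by (rule sum.mono_neutral_cong_right) (auto simp: N_def m_def)
      then show ?thesis using ip(3) by (simp add: u_def)
    qed
    show "laplacian (u ?N j \<circ> chart_inv S j) w \<ge> ?c j w * (u ?N j (chart_inv S j w) - c0)"
      if j: "j \<in> charts S" and w: "w \<in> chart_image S j" for j w
    proof -
      let ?q = "chart_inv S j w"
      have "?c j w * (u ?N j ?q - c0)
         = (\<Sum>k<n. - 2 * (b k j ?q * exp (v k j ?q) + b k j ?q) * (c0 - u ?N j ?q))"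
        unfolding sum_distrib_right by (intro sum.cong refl) (simp add: algebra_simps)
      also have "\<dots> \<le> (\<Sum>k<n. F k j ?q * (x ?N k - (if k \<in> ?N then 2 else 0)))"
        by (rule sum_mono) (rule term_le[OF _ N j chart_inv_in[OF w]], simp)
      finally show ?thesis unfolding lap_u[OF N j w] .
    qed
  qed (use ip jq in auto)
  (* for c0 = 0 every point is a maximum of W, and the point violating the claim is taken *)
  obtain i1 p1 where 1: "i1 \<in> charts S" "p1 \<in> chart_dom S i1" "W i1 p1 = c0" "N i1 p1 \<noteq> {}"
  proof (cases "c0 = 0")
    case True
    have "W i p = c0" using W0[of i p] Wc0[OF i p] True by simp
    moreover have "N i p \<noteq> {}" using vk k by (auto simp: N_def)
    ultimately show ?thesis using that i p by blast
  next
    case False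
    have "N ia pa \<noteq> {}"
    proof
      assume "N ia pa = {}"
      then have "W ia pa = 0" unfolding W_def by (intro sum.neutral) (auto simp: N_def m_def)
      then show False using False by (simp add: c0_def)
    qed
    then show ?thesis using that a by (simp add: c0_def)
  qed
  define N1 where "N1 = N i1 p1"
  have N1: "N1 \<subseteq> {..<n}" by (auto simp: N1_def N_def)
  note const1 = const[OF 1(1-3), folded N1_def]
  (* every point is now a maximum of W, so any two of the sets N contain each other *)
  have N_const: "N j q = N1" if jq: "j \<in> charts S" "q \<in> chart_dom S j" for j q
  proof -
    have sub: "N j' q' \<subseteq> N j q" if "W j' q' = c0" "j' \<in> charts S" "q' \<in> chart_dom S j'"
        and jq: "j \<in> charts S" "q \<in> chart_dom S j" for j q j' q'
    proof
      fix k assume k: "k \<in> N j' q'"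
      have "N j' q' \<subseteq> {..<n}" by (auto simp: N_def)
      from gap_in[OF this jq k] have "v k j q \<le> 0"
        using const[OF that(2,3,1) jq] by simp
      then show "k \<in> N j q" using k by (auto simp: N_def)
    qed
    have "W j q = c0"
    proof -
      have "c0 = (\<Sum>k\<in>N1. - v k j q)" using const1[OF jq] by (simp add: u_def)
      also have "\<dots> \<le> (\<Sum>k\<in>N1. m k j q)" by (intro sum_mono m0)
      also have "\<dots> \<le> W j q" unfolding W_def by (rule sum_mono2) (use N1 m0 in auto)
      finally show ?thesis using Wc0[OF jq] by simp
    qed
    then show ?thesis using sub[of j q i1 p1] sub[of i1 p1 j q] 1 jq unfolding N1_def by blast
  qed
  have "N1 \<noteq> {..<n}"
  proof
    assume "N1 = {..<n}"
    then have "\<forall>k<n. v k i1 p1 \<le> 0" by (auto simp: N1_def N_def)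
    then have "(\<Sum>k<n. v k i1 p1) \<le> 0" by (intro sum_nonpos) auto
    then show False using pos[OF 1(1,2)] by simp
  qed
  then obtain j where j: "j < n" "j \<notin> N1" "cyc_pred n j \<in> N1"
    using cyclic_boundary[OF N1] 1(4) unfolding N1_def by blast
  obtain i2 p2 where 2: "i2 \<in> charts S" "p2 \<in> chart_dom S i2" "b j i2 p2 \<noteq> 0" using nz[OF j(1)] by blast
  define w where "w = coord S i2 p2"
  have w: "w \<in> chart_image S i2" "chart_inv S i2 w = p2"
    using coord_in[OF 2(2)] chart_inv_coord[OF S 2(1,2)] by (simp_all add: w_def)
  have "laplacian (u N1 i2 \<circ> chart_inv S i2) w = 0"
    by (rule laplacian_locally_constant[OF chart_image_open[OF S 2(1)] w(1), where M = c0])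
      (simp add: const1[OF 2(1) chart_inv_in])
  then have sum0: "(\<Sum>k<n. F k i2 p2 * (x N1 k - (if k \<in> N1 then 2 else 0))) = 0"
    unfolding lap_u[OF N1 2(1) w(1)] w(2) .
  have nn: "0 \<le> F k i2 p2 * (x N1 k - (if k \<in> N1 then 2 else 0))" if "k < n" for k
    using term_le[OF that N1 2(1,2)] const1[OF 2(1,2)] by simp
  have "F j i2 p2 * (x N1 j - (if j \<in> N1 then 2 else 0)) = 0"
    using sum0 nn j(1) by (subst (asm) sum_nonneg_eq_0_iff) auto
  moreover have "x N1 j \<ge> 1" using j(3) by (simp add: x_def)
  ultimately have "F j i2 p2 = 0" using j(2) by auto
  then have "exp (v j i2 p2) = 1" using 2(3) by (simp add: F_def)
  then have "j \<in> N i2 p2" using j(1) by (simp add: N_def)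
  then show False using N_const[OF 2(1,2)] j(2) by simp
qed

section \<open>Monotonicity along the orbit\<close>

text \<open>
  Here \<open>v k\<close> is the logarithm of the quotient of the two component energies.  It is written in terms
  of the weights only, since the factors \<open>|\<gamma> k|\<^sup>2\<close> cancel, and is therefore smooth across the zeros of
  \<open>\<gamma> k\<close>; the factors coming from a change of frame cancel as well.  In the sum over the cycle the weights
  cancel and \<open>n * ln (|t|\<^sup>2 / |t'|\<^sup>2)\<close> remains.
\<close>

lemma component_energy_increasing:
  assumes S: "closed_riemann_surface S" and n: "n > 0"
    and higgs: "cyclic_higgs_bundle S n L \<delta> \<gamma>" and nz: "\<not> zero_section S (\<gamma> (n - 1))"
    and t: "0 < cmod t'" "cmod t' < cmod t"
    and h: "harmonic_metric S n L \<delta> (scale_higgs_field t (cyclic_higgs_field n \<gamma>)) H"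
    and h': "harmonic_metric S n L \<delta> (scale_higgs_field t' (cyclic_higgs_field n \<gamma>)) H'"
    and k: "k < n" and i: "i \<in> charts S" and p: "p \<in> chart_dom S i"
  shows "component_energy n t' \<gamma> H' i k p \<le> component_energy n t \<gamma> H i k p"
    and "\<gamma> k i p \<noteq> 0 \<Longrightarrow> component_energy n t' \<gamma> H' i k p < component_energy n t \<gamma> H i k p"
proof -
  have L: "\<forall>k<n. line_bundle S (L k)"
    and \<gamma>_hol: "\<And>k i. k < n \<Longrightarrow> i \<in> charts S \<Longrightarrow> (\<gamma> k i \<circ> chart_inv S i) holomorphic_on chart_image S i"
    using higgs by (auto simp: cyclic_higgs_bundle_def holomorphic_section_def)
  have \<gamma>_nz: "\<exists>i\<in>charts S. \<exists>p\<in>chart_dom S i. \<gamma> k i p \<noteq> 0" if "k < n" for k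
  proof -
    have "\<not> zero_section S (\<gamma> k)"
      using higgs nz that by (cases "k = n - 1") (auto simp: cyclic_higgs_bundle_def)
    then show ?thesis by (simp add: zero_section_def)
  qed
  define \<eta> where "\<eta> = diag_weight H"
  define \<eta>' where "\<eta>' = diag_weight H'"
  define f where "f = component_energy n t \<gamma> H"
  define f' where "f' = component_energy n t' \<gamma> H'"
  have f_def': "f i k p = (cmod (t * \<gamma> k i p))\<^sup>2 * \<eta> i (cyc_suc n k) p / \<eta> i k p"
    and f'_def': "f' i k p = (cmod (t' * \<gamma> k i p))\<^sup>2 * \<eta>' i (cyc_suc n k) p / \<eta>' i k p" for i k p
    by (simp_all add: f_def f'_def \<eta>_def \<eta>'_def component_energy_def)
  note T = toda_equations[OF S n L h, folded \<eta>_def f_def]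
  note T' = toda_equations[OF S n L h', folded \<eta>'_def f'_def]
  define c where "c = ln ((cmod t)\<^sup>2 / (cmod t')\<^sup>2)"
  have c: "c > 0"
  proof -
    have "(cmod t')\<^sup>2 < (cmod t)\<^sup>2" using t by (intro power_strict_mono) auto
    then have "1 < (cmod t)\<^sup>2 / (cmod t')\<^sup>2" using t(1) by (subst less_divide_eq_1_pos) auto
    then show ?thesis unfolding c_def by (rule ln_gt_zero)
  qed
  define \<rho> where "\<rho> = (\<lambda>k i p. 1 * ln (\<eta> i k p) + (- 1) * ln (\<eta>' i k p))"
  define v where "v = (\<lambda>k i p. 1 * (1 * \<rho> (cyc_suc n k) i p + (- 1) * \<rho> k i p) + 1 * c)"
  have \<rho>_comp: "\<rho> k i \<circ> chart_inv S i = (\<lambda>w. 1 * ln (\<eta> i k (chart_inv S i w)) + (- 1) * ln (\<eta>' i k (chart_inv S i w)))" for k i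
    by (simp add: \<rho>_def fun_eq_iff)
  have v_comp: "v k i \<circ> chart_inv S i =
      (\<lambda>w. 1 * (1 * (\<rho> (cyc_suc n k) i \<circ> chart_inv S i) w + (- 1) * (\<rho> k i \<circ> chart_inv S i) w) + 1 * c)" for k i
    by (simp add: v_def fun_eq_iff)
  have \<rho>_tw: "twice_differentiable_on (\<rho> k i \<circ> chart_inv S i) (chart_image S i)"
    and \<rho>_lap: "\<And>w. w \<in> chart_image S i \<Longrightarrow> laplacian (\<rho> k i \<circ> chart_inv S i) w =
      (f i (cyc_pred n k) (chart_inv S i w) - f i k (chart_inv S i w)) -
      (f' i (cyc_pred n k) (chart_inv S i w) - f' i k (chart_inv S i w))"
    if k: "k < n" and i: "i \<in> charts S" for k i
  proof -
    note W = chart_image_open[OF S i]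
    show "twice_differentiable_on (\<rho> k i \<circ> chart_inv S i) (chart_image S i)"
      unfolding \<rho>_comp by (rule twice_differentiable_on_combination(1)[OF W T(2)[OF i k] T'(2)[OF i k]])
    show "laplacian (\<rho> k i \<circ> chart_inv S i) w =
      (f i (cyc_pred n k) (chart_inv S i w) - f i k (chart_inv S i w)) -
      (f' i (cyc_pred n k) (chart_inv S i w) - f' i k (chart_inv S i w))"
      if w: "w \<in> chart_image S i" for w
      unfolding \<rho>_comp twice_differentiable_on_combination(2)[OF W T(2)[OF i k] T'(2)[OF i k] w]
        T(3)[OF i k w] T'(3)[OF i k w] by simp
  qed
  have suc: "cyc_suc n k < n" for k using n by simp
  have exp_v: "f i k p = f' i k p * exp (v k i p)" if k: "k < n" and i: "i \<in> charts S" and p: "p \<in> chart_dom S i" for k i p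
  proof -
    have pos: "0 < \<eta> i k p" "0 < \<eta>' i k p" "0 < \<eta> i (cyc_suc n k) p" "0 < \<eta>' i (cyc_suc n k) p"
      using T(1)[OF i _ p] T'(1)[OF i _ p] k suc by auto
    have "exp (v k i p) = exp (ln (\<eta> i (cyc_suc n k) p)) / exp (ln (\<eta>' i (cyc_suc n k) p)) /
        (exp (ln (\<eta> i k p)) / exp (ln (\<eta>' i k p))) * exp c"
      by (simp add: v_def \<rho>_def exp_add exp_diff del: exp_ln)
    also have "\<dots> = \<eta> i (cyc_suc n k) p / \<eta>' i (cyc_suc n k) p / (\<eta> i k p / \<eta>' i k p) * ((cmod t)\<^sup>2 / (cmod t')\<^sup>2)"
    proof -
      have "exp c = (cmod t)\<^sup>2 / (cmod t')\<^sup>2"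
        unfolding c_def by (rule exp_ln) (use t in \<open>intro divide_pos_pos zero_less_power; linarith\<close>)
      then show ?thesis using pos by simp
    qed
    finally show ?thesis
      using pos t(1) by (simp add: f_def' f'_def' norm_mult power_mult_distrib field_simps)
  qed
  have f'_nonneg: "0 \<le> f' i k p" if "k < n" "i \<in> charts S" "p \<in> chart_dom S i" for k i p
    unfolding f'_def' by (intro divide_nonneg_pos mult_nonneg_nonneg zero_le_power2
        less_imp_le[OF T'(1)[OF that(2) suc that(3)]] T'(1)[OF that(2,1,3)])
  have pos_v: "0 < v k i p" if "k < n" "i \<in> charts S" "p \<in> chart_dom S i" for k i p
  proof (rule cyclic_comparison[where b = "\<lambda>k i. f' i k" and v = v, OF S])
    show "agree_on_overlaps S (v k)" if k: "k < n" for k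
      unfolding agree_on_overlaps_def
    proof (intro ballI)
      fix i j p assume ij: "i \<in> charts S" "j \<in> charts S" and p: "p \<in> chart_dom S i \<inter> chart_dom S j"
      have "\<rho> k j p = \<rho> k i p" if k: "k < n" for k
      proof -
        have "L k i j p \<noteq> 0" using L k ij p unfolding line_bundle_def by blast
        then have l: "0 < (cmod (L k i j p))\<^sup>2" by simp
        have diag: "Re (M j p $$ (k, k)) = (cmod (L k i j p))\<^sup>2 * Re (M i p $$ (k, k))"
          if M: "hermitian_metric S n L M" for M
        proof -
          let ?g = "mat_diag n (\<lambda>k. L k i j p)"
          have Mj: "M j p = mat_adjoint ?g * M i p * ?g"
            using M ij p unfolding hermitian_metric_def by blast
          have Mc: "M i p \<in> carrier_mat n n"
            using M ij p unfolding hermitian_metric_def positive_definite_def by blast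
          have adj: "mat_adjoint ?g = mat_diag n (\<lambda>k. cnj (L k i j p))"
            by (rule eq_matI) (auto simp: mat_diag_def mat_adjoint_index)
          have "M j p = Matrix.mat n n (\<lambda>(a, b). (cnj (L a i j p) * M i p $$ (a, b)) * L b i j p)"
            unfolding Mj adj mat_diag_mult_left[OF Mc] by (subst mat_diag_mult_right[of _ n]) (auto intro!: cong_mat)
          then have "M j p $$ (k, k) = of_real ((cmod (L k i j p))\<^sup>2) * M i p $$ (k, k)"
            unfolding complex_norm_square using k by simp
          then show ?thesis by simp
        qed
        have "hermitian_metric S n L H" "hermitian_metric S n L H'"
          using h h' by (simp_all add: harmonic_metric_def)
        then have "\<eta> j k p = (cmod (L k i j p))\<^sup>2 * \<eta> i k p" "\<eta>' j k p = (cmod (L k i j p))\<^sup>2 * \<eta>' i k p"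
          using diag unfolding \<eta>_def \<eta>'_def diag_weight_def by blast+
        moreover have "0 < \<eta> i k p" "0 < \<eta>' i k p"
          using T(1)[OF ij(1) k] T'(1)[OF ij(1) k] p by blast+
        ultimately show ?thesis
          using l by (simp add: \<rho>_def ln_mult)
      qed
      from this[OF k] this[OF suc] show "v k i p = v k j p" by (simp add: v_def)
    qed
    show "twice_differentiable_on (v k i \<circ> chart_inv S i) (chart_image S i)" if "k < n" "i \<in> charts S" for k i
      unfolding v_comp
      by (intro twice_differentiable_on_combination(1) chart_image_open[OF S] \<rho>_tw twice_differentiable_on_const suc that)
    show "0 \<le> f' i k p" if "k < n" "i \<in> charts S" "p \<in> chart_dom S i" for k i p
      by (rule f'_nonneg[OF that])
    show "continuous_on (chart_image S i) (f' i k \<circ> chart_inv S i)" if k: "k < n" and i: "i \<in> charts S" for k i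
    proof -
      have ln: "continuous_on (chart_image S i) (\<lambda>w. ln (\<eta>' i k (chart_inv S i w)))" if "k < n" for k
        by (rule twice_differentiable_on_imp_continuous_on[OF T'(2)[OF i that]])
      have "continuous_on (chart_image S i) (\<lambda>w. (cmod (t' * (\<gamma> k i \<circ> chart_inv S i) w))\<^sup>2 *
          exp (ln (\<eta>' i (cyc_suc n k) (chart_inv S i w))) / exp (ln (\<eta>' i k (chart_inv S i w))))"
        by (intro continuous_intros holomorphic_on_imp_continuous_on[OF \<gamma>_hol[OF k i]] ln k suc) simp
      then show ?thesis
        by (rule continuous_on_eq)
          (use T'(1)[OF i k chart_inv_in] T'(1)[OF i suc chart_inv_in] in \<open>simp add: f'_def'\<close>)
    qed
    show "laplacian (v k i \<circ> chart_inv S i) w =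
        (let F = \<lambda>k. f' i k (chart_inv S i w) * (exp (v k i (chart_inv S i w)) - 1)
         in 2 * F k - F (cyc_suc n k) - F (cyc_pred n k))"
      if k: "k < n" and i: "i \<in> charts S" and w: "w \<in> chart_image S i" for k i w
    proof -
      note W = chart_image_open[OF S i]
      let ?q = "chart_inv S i w"
      have F: "f' i k ?q * (exp (v k i ?q) - 1) = f i k ?q - f' i k ?q" if "k < n" for k
        using exp_v[OF that i chart_inv_in[OF w]] by (simp add: algebra_simps)
      have pred: "cyc_pred n k < n" using n by simp
      have "laplacian (v k i \<circ> chart_inv S i) w =
          laplacian (\<rho> (cyc_suc n k) i \<circ> chart_inv S i) w - laplacian (\<rho> k i \<circ> chart_inv S i) w"
        unfolding v_comp twice_differentiable_on_combination(2)[OF W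
            twice_differentiable_on_combination(1)[OF W \<rho>_tw[OF suc[of k] i] \<rho>_tw[OF k i]] twice_differentiable_on_const w]
          twice_differentiable_on_combination(2)[OF W \<rho>_tw[OF suc[of k] i] \<rho>_tw[OF k i] w]
        by (simp add: laplacian_const)
      then show ?thesis
        unfolding Let_def F[OF k] F[OF suc] F[OF pred] \<rho>_lap[OF suc i w] \<rho>_lap[OF k i w] cyc_pred_suc[OF k]
        by simp
    qed
    show "0 < (\<Sum>k<n. v k i p)" for i p
    proof -
      have "(\<Sum>k<n. v k i p) = (\<Sum>k<n. \<rho> (cyc_suc n k) i p) - (\<Sum>k<n. \<rho> k i p) + real n * c"
        by (simp add: v_def sum.distrib sum_subtractf)
      then show ?thesis using sum_cyc_suc[of "\<lambda>k. \<rho> k i p" n] n c by simp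
    qed
    show "\<exists>i\<in>charts S. \<exists>p\<in>chart_dom S i. f' i k p \<noteq> 0" if k: "k < n" for k
    proof -
      obtain i p where ip: "i \<in> charts S" "p \<in> chart_dom S i" "\<gamma> k i p \<noteq> 0" using \<gamma>_nz[OF k] by blast
      then have "f' i k p \<noteq> 0"
        using T'(1)[OF ip(1) k ip(2)] T'(1)[OF ip(1) suc[of k] ip(2)] t(1) by (auto simp: f'_def')
      then show ?thesis using ip by blast
    qed
  qed (use that in auto)
  have "f' i k p * 1 \<le> f' i k p * exp (v k i p)"
    using pos_v[OF k i p] by (intro mult_left_mono f'_nonneg[OF k i p]) simp
  then show "component_energy n t' \<gamma> H' i k p \<le> component_energy n t \<gamma> H i k p"
    using exp_v[OF k i p] by (simp add: f_def f'_def)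
  assume "\<gamma> k i p \<noteq> 0"
  then have "0 < f' i k p"
    using T'(1)[OF i k p] T'(1)[OF i suc[of k] p] t(1) by (auto simp: f'_def')
  then have "f' i k p < f i k p"
    using exp_v[OF k i p] pos_v[OF k i p] by simp
  then show "component_energy n t' \<gamma> H' i k p < component_energy n t \<gamma> H i k p"
    by (simp add: f_def f'_def)
qed

theorem theorem1p1:
  fixes S :: "('a, 'i) surface"
    and n g :: nat
    and L :: "nat \<Rightarrow> ('a, 'i) cocycle"
    and \<delta> :: "'i \<Rightarrow> 'a \<Rightarrow> complex"
    and \<gamma> :: "nat \<Rightarrow> 'i \<Rightarrow> 'a \<Rightarrow> complex"
    and t t' :: complex
    and H H' :: "'i \<Rightarrow> 'a \<Rightarrow> complex mat"
  assumes "n \<ge> 3"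
    and "closed_riemann_surface S"
    and "has_genus S g" and "g \<ge> 2"
    and "cyclic_higgs_bundle S n L \<delta> \<gamma>"
    and "\<not> zero_section S (\<gamma> (n - 1))"
    and "0 < cmod t'" and "cmod t' < cmod t"
    and "harmonic_metric S n L \<delta> (scale_higgs_field t (cyclic_higgs_field n \<gamma>)) H"
    and "harmonic_metric S n L \<delta> (scale_higgs_field t' (cyclic_higgs_field n \<gamma>)) H'"
    and "i \<in> charts S" and "p \<in> chart_dom S i"
    and "cyclic_higgs_field n \<gamma> i p \<noteq> 0\<^sub>m n n"
  shows "pullback_metric n (scale_higgs_field t' (cyclic_higgs_field n \<gamma>)) H' i p
       < pullback_metric n (scale_higgs_field t (cyclic_higgs_field n \<gamma>)) H i p"
proof -
  note i = assms(11) and p = assms(12)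
  have n: "n > 0" using assms(1) by simp
  have L: "\<forall>k<n. line_bundle S (L k)"
    using assms(5) by (simp add: cyclic_higgs_bundle_def)
  note inc = component_energy_increasing[OF assms(2) n assms(5-10) _ i p]
  obtain k where k: "k < n" "\<gamma> k i p \<noteq> 0"
  proof (rule ccontr)
    assume "\<not> thesis"
    then have "\<gamma> k i p = 0" if "k < n" for k
      using that \<open>\<And>k. k < n \<Longrightarrow> \<gamma> k i p \<noteq> 0 \<Longrightarrow> thesis\<close> by blast
    then have "cyclic_higgs_field n \<gamma> i p = 0\<^sub>m n n"
      by (intro eq_matI) (auto simp: cyclic_higgs_field_def)
    then show False using assms(13) by simp
  qed
  have "(\<Sum>k<n. component_energy n t' \<gamma> H' i k p) < (\<Sum>k<n. component_energy n t \<gamma> H i k p)"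
    by (rule sum_strict_mono_ex1) (use inc k in auto)
  then show ?thesis
    unfolding toda_equations(4)[OF assms(2) n L assms(9) i p] toda_equations(4)[OF assms(2) n L assms(10) i p]
    using n by simp
qed

end
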